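(* Let $k\in\{0,1,\dots,\infty\}$, let $V\subset M$ be an open connected subset such that $\Sigma$ is nowhere dense in $V$, and let $T$ be a compact, simply connected and locally path connected topological space with a point $\tau_0\in T$. Suppose that there is a point $z\in\Sigma\cap V$ such that one of the following conditions holds: (a) $z$ is not a $\mathsf{pn}$-point; (b) $z$ is a $\mathsf{pn}$-point, $j^1F(z)=0$, and $k\ge 1$; (c) $z$ is a strong $\mathsf{pn}$-point and $k\ge1$. Let $\Omega:V\times T\to M$ be a $(T,k)$-deformation in $Sh(\mathbf F,V)$, let $\alpha\in C^\infty(V,\mathbb R)$ be any shift function for $\Omega_{\tau_0}$, and let $\Lambda:(V\setminus\Sigma)\times T\to\mathbb R$ be the unique continuous shift function for $\Omega$ such that $\Lambda_{\tau_0}=\alpha$ on $V\setminus\Sigma$. Then there exists a neighbourhood $W\subset V$ of $z$ such that for each $\tau\in T$ the function $\Lambda_\tau=\Lambda(\cdot,\tau)$ extends to a $C^\infty$ function on $W$, so that $\Omega_\tau|_W=\varphi_W(\Lambda_\tau|_W)$.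
   Context: $M$ is a $C^\infty$ connected manifold, possibly non-compact, with or without boundary; $F$ is a $C^\infty$ vector field on $M$ tangent to $\partial M$ and generating a (global) flow $\mathbf F:M\times\mathbb R\to M$; $\Sigma$ is the set of zeros of $F$. $j^1F(z)=0$ means that the linear part of $F$ at the zero $z$ vanishes. For an open $V\subset M$ the shift map is $\varphi_V:C^\infty(V,\mathbb R)\to C^\infty(V,M)$, $\varphi_V(\alpha)(x)=\mathbf F(x,\alpha(x))$, and $Sh(\mathbf F,V)$ is its image. $\ker(\varphi_V)=\{\mu\in C^\infty(V,\mathbb R): \mathbf F(x,\mu(x))=x\ \forall x\in V\}$. For connected open $V$, $\varphi_V$ is called periodic if $\Sigma\cap V$ is nowhere dense in $V$ and $\ker(\varphi_V)=\{n\theta\}_{n\in\mathbb Z}$ for some $C^\infty$ function $\theta:V\to(0,+\infty)$, called the positive generator of $\ker(\varphi_V)$; otherwise $\varphi_V$ is non-periodic. $\mathsf{pn}$-points: $z\in\Sigma$ is a $\mathsf{pn}$-point if there is an open neighbourhood $V$ of $z$ such that $\widehat V=V\setminus\Sigma$ is connected and $\varphi_{\widehat V}$ is periodic, while for every open connected neighbourhood $W\subset V$ of $z$ the map $\varphi_W$ is non-periodic. If moreover the positive generator $\theta:\widehat V\to(0,+\infty)$ of $\ker(\varphi_{\widehat V})$ satisfies $\lim_{x\to z}\theta(x)=+\infty$, then $z$ is a strong $\mathsf{pn}$-point. Deformations: for $\mathcal H\subset C^\infty(V,M)$, a $(T,k)$-deformation in $\mathcal H$ is a continuous map $\Omega:V\times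 T\to M$ such that $\Omega_\tau=\Omega(\cdot,\tau)\in\mathcal H$ for all $\tau\in T$ and the map $V\times T\to J^k(V,M)$, $(x,\tau)\mapsto j^k\Omega_\tau(x)$, is continuous (for $k=\infty$: this holds for all finite $k$). Shift functions: a function $\alpha:A\to\mathbb R$, $A\subset V$, is a shift function for $h:V\to M$ on $A$ if $h(x)=\mathbf F(x,\alpha(x))$ for $x\in A$; a function $\Lambda:A\to\mathbb R$, $A\subset V\times T$, is a shift function for $\Omega$ if $\Omega(x,\tau)=\mathbf F(x,\Lambda(x,\tau))$ for $(x,\tau)\in A$. (Existence and uniqueness of the continuous $\Lambda$ on $(V\setminus\Sigma)\times T$ with $\Lambda_{\tau_0}=\alpha$ is known since $T$ is simply connected and locally path connected.) *)

theory Defs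
  imports "HOL-Analysis.Analysis" "HOL-Library.Extended_Nat"
begin

section \<open>Smoothness on relatively open subsets of a half-space\<close>

text \<open>All derivatives are taken within the set \<open>S\<close>. They are used only for sets \<open>S\<close> that are
  relatively open in a closed half-space (or in a half-space times the real line), where the
  derivative within \<open>S\<close> is unique; at boundary points it is the one-sided derivative. All notions
  depend only on the values of the function on \<open>S\<close>.\<close>

fun iterated_deriv ::
  "'a::real_normed_vector set \<Rightarrow> 'a list \<Rightarrow> ('a \<Rightarrow> 'b::real_normed_vector) \<Rightarrow> 'a \<Rightarrow> 'b" where
  "iterated_deriv S [] f = f"
| "iterated_deriv S (v # vs) f =
     (\<lambda>x. frechet_derivative (iterated_deriv S vs f) (at x within S) v)"

definition smooth_on ::
  "'a::real_normed_vector set \<Rightarrow> ('a \<Rightarrow> 'b::real_normed_vector) \<Rightarrow> bool" where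
  "smooth_on S f \<longleftrightarrow> (\<forall>vs. iterated_deriv S vs f differentiable_on S)"

definition normal_dir :: "'e::euclidean_space" where
  "normal_dir = (SOME b. b \<in> Basis)"

definition half_space :: "'e::euclidean_space set" where
  "half_space = {y. 0 \<le> y \<bullet> normal_dir}"


section \<open>Smooth manifolds with (possibly empty) boundary\<close>

text \<open>The manifold is the whole type \<open>'m\<close>; its dimension is \<open>DIM('e)\<close>. A chart is its domain
  together with its coordinate map, whose image is relatively open in the half-space. Interior
  charts are those whose image misses the bounding hyperplane.\<close>

type_synonym ('m, 'e) chart = "'m set \<times> ('m \<Rightarrow> 'e)"

abbreviation cdom :: "('m, 'e) chart \<Rightarrow> 'm set" where "cdom c \<equiv> fst c"
abbreviation cmap :: "('m, 'e) chart \<Rightarrow> 'm \<Rightarrow> 'e" where "cmap c \<equiv> snd c"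
abbreviation cinv :: "('m, 'e) chart \<Rightarrow> 'e \<Rightarrow> 'm" where "cinv c \<equiv> inv_into (cdom c) (cmap c)"

definition smooth_manifold ::
  "('m::{t2_space,second_countable_topology}, 'e::euclidean_space) chart set \<Rightarrow> bool" where
  "smooth_manifold A \<longleftrightarrow>
     (\<Union>c\<in>A. cdom c) = UNIV \<and>
     (\<forall>c\<in>A. open (cdom c) \<and>
        openin (top_of_set half_space) (cmap c ` cdom c) \<and>
        homeomorphism (cdom c) (cmap c ` cdom c) (cmap c) (cinv c)) \<and>
     (\<forall>c\<in>A. \<forall>c'\<in>A. smooth_on (cmap c ` (cdom c \<inter> cdom c')) (cmap c' \<circ> cinv c))"

definition manifold_boundary ::
  "('m::{t2_space,second_countable_topology}, 'e::euclidean_space) chart set \<Rightarrow> 'm set" where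
  "manifold_boundary A = {x. \<exists>c\<in>A. x \<in> cdom c \<and> cmap c x \<bullet> normal_dir = 0}"

text \<open>Functions and maps on an open subset \<open>V\<close> are total functions whose values outside \<open>V\<close> are
  irrelevant.\<close>

definition smooth_fun ::
  "('m::{t2_space,second_countable_topology}, 'e::euclidean_space) chart set
    \<Rightarrow> 'm set \<Rightarrow> ('m \<Rightarrow> real) \<Rightarrow> bool" where
  "smooth_fun A V f \<longleftrightarrow> (\<forall>c\<in>A. smooth_on (cmap c ` (cdom c \<inter> V)) (f \<circ> cinv c))"

definition smooth_map ::
  "('m::{t2_space,second_countable_topology}, 'e::euclidean_space) chart set
    \<Rightarrow> 'm set \<Rightarrow> ('m \<Rightarrow> 'm) \<Rightarrow> bool" where
  "smooth_map A V h \<longleftrightarrow> continuous_on V h \<and>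
     (\<forall>c\<in>A. \<forall>c'\<in>A.
        smooth_on (cmap c ` (cdom c \<inter> V \<inter> h -` cdom c')) (cmap c' \<circ> h \<circ> cinv c))"


section \<open>Vector fields and flows\<close>

text \<open>A tangent vector is given by its components in every chart around its base point, subject to
  the usual transformation law: \<open>F c x\<close> is the component vector of \<open>F(x)\<close> in the chart \<open>c\<close>,
  relevant for \<open>x \<in> cdom c\<close> only.\<close>

definition smooth_vector_field ::
  "('m::{t2_space,second_countable_topology}, 'e::euclidean_space) chart set
    \<Rightarrow> (('m, 'e) chart \<Rightarrow> 'm \<Rightarrow> 'e) \<Rightarrow> bool" where
  "smooth_vector_field A F \<longleftrightarrow>
     (\<forall>c\<in>A. smooth_on (cmap c ` cdom c) (F c \<circ> cinv c)) \<and>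
     (\<forall>c\<in>A. \<forall>c'\<in>A. \<forall>x\<in>cdom c \<inter> cdom c'.
        F c' x = frechet_derivative (cmap c' \<circ> cinv c)
                   (at (cmap c x) within cmap c ` (cdom c \<inter> cdom c')) (F c x))"

definition tangent_to_boundary ::
  "('m::{t2_space,second_countable_topology}, 'e::euclidean_space) chart set
    \<Rightarrow> (('m, 'e) chart \<Rightarrow> 'm \<Rightarrow> 'e) \<Rightarrow> bool" where
  "tangent_to_boundary A F \<longleftrightarrow>
     (\<forall>x\<in>manifold_boundary A. \<forall>c\<in>A. x \<in> cdom c \<longrightarrow> F c x \<bullet> normal_dir = 0)"

definition zeros ::
  "('m::{t2_space,second_countable_topology}, 'e::euclidean_space) chart set
    \<Rightarrow> (('m, 'e) chart \<Rightarrow> 'm \<Rightarrow> 'e) \<Rightarrow> 'm set" where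
  "zeros A F = {x. \<forall>c\<in>A. x \<in> cdom c \<longrightarrow> F c x = 0}"

definition one_jet_vanishes ::
  "('m::{t2_space,second_countable_topology}, 'e::euclidean_space) chart set
    \<Rightarrow> (('m, 'e) chart \<Rightarrow> 'm \<Rightarrow> 'e) \<Rightarrow> 'm \<Rightarrow> bool" where
  "one_jet_vanishes A F z \<longleftrightarrow> (\<forall>c\<in>A. z \<in> cdom c \<longrightarrow> F c z = 0 \<and>
     ((F c \<circ> cinv c) has_derivative (\<lambda>_. 0)) (at (cmap c z) within cmap c ` cdom c))"

text \<open>\<open>Fl\<close> is the global flow of \<open>F\<close>: a smooth action of the additive group of reals whose
  trajectories are the integral curves of \<open>F\<close>. The third and fourth clauses state smoothness of
  \<open>Fl\<close> on the product of the manifold with the real line, in product charts.\<close>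

definition global_flow ::
  "('m::{t2_space,second_countable_topology}, 'e::euclidean_space) chart set
    \<Rightarrow> (('m, 'e) chart \<Rightarrow> 'm \<Rightarrow> 'e) \<Rightarrow> ('m \<times> real \<Rightarrow> 'm) \<Rightarrow> bool" where
  "global_flow A F Fl \<longleftrightarrow>
     (\<forall>x. Fl (x, 0) = x) \<and>
     (\<forall>x s t. Fl (Fl (x, s), t) = Fl (x, s + t)) \<and>
     continuous_on UNIV Fl \<and>
     (\<forall>c\<in>A. \<forall>c'\<in>A.
        smooth_on ((\<lambda>(x, t). (cmap c x, t)) ` {(x, t). x \<in> cdom c \<and> Fl (x, t) \<in> cdom c'})
                  (\<lambda>(y, t). cmap c' (Fl (cinv c y, t)))) \<and>
     (\<forall>c\<in>A. \<forall>x t. Fl (x, t) \<in> cdom c \<longrightarrow>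
        ((\<lambda>s. cmap c (Fl (x, s))) has_vector_derivative F c (Fl (x, t))) (at t))"


section \<open>Shift maps\<close>

definition shift_map :: "('m \<times> real \<Rightarrow> 'm) \<Rightarrow> ('m \<Rightarrow> real) \<Rightarrow> 'm \<Rightarrow> 'm" where
  "shift_map Fl \<alpha> = (\<lambda>x. Fl (x, \<alpha> x))"

definition shift_image ::
  "('m::{t2_space,second_countable_topology}, 'e::euclidean_space) chart set
    \<Rightarrow> ('m \<times> real \<Rightarrow> 'm) \<Rightarrow> 'm set \<Rightarrow> ('m \<Rightarrow> 'm) set" where
  "shift_image A Fl V = {h. \<exists>\<alpha>. smooth_fun A V \<alpha> \<and> (\<forall>x\<in>V. h x = shift_map Fl \<alpha> x)}"

definition shift_ker ::
  "('m::{t2_space,second_countable_topology}, 'e::euclidean_space) chart set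
    \<Rightarrow> ('m \<times> real \<Rightarrow> 'm) \<Rightarrow> 'm set \<Rightarrow> ('m \<Rightarrow> real) set" where
  "shift_ker A Fl V = {\<mu>. smooth_fun A V \<mu> \<and> (\<forall>x\<in>V. shift_map Fl \<mu> x = x)}"

definition shift_function :: "('m \<times> real \<Rightarrow> 'm) \<Rightarrow> 'm set \<Rightarrow> ('m \<Rightarrow> 'm) \<Rightarrow> ('m \<Rightarrow> real) \<Rightarrow> bool" where
  "shift_function Fl B h \<alpha> \<longleftrightarrow> (\<forall>x\<in>B. h x = Fl (x, \<alpha> x))"

definition shift_function_family ::
  "('m \<times> real \<Rightarrow> 'm) \<Rightarrow> ('m \<times> 't) set \<Rightarrow> ('m \<times> 't \<Rightarrow> 'm) \<Rightarrow> ('m \<times> 't \<Rightarrow> real) \<Rightarrow> bool" where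
  "shift_function_family Fl B \<Omega> \<Lambda> \<longleftrightarrow> (\<forall>(x, \<tau>)\<in>B. \<Omega> (x, \<tau>) = Fl (x, \<Lambda> (x, \<tau>)))"

text \<open>Used for open \<open>V\<close> only, where it says that \<open>S \<inter> V\<close> is nowhere dense in the subspace \<open>V\<close>.\<close>

definition nowhere_dense_in :: "'m::topological_space set \<Rightarrow> 'm set \<Rightarrow> bool" where
  "nowhere_dense_in S V \<longleftrightarrow> interior (closure (S \<inter> V)) \<inter> V = {}"

definition positive_generator ::
  "('m::{t2_space,second_countable_topology}, 'e::euclidean_space) chart set
    \<Rightarrow> ('m \<times> real \<Rightarrow> 'm) \<Rightarrow> 'm set \<Rightarrow> ('m \<Rightarrow> real) \<Rightarrow> bool" where
  "positive_generator A Fl V \<theta> \<longleftrightarrow> smooth_fun A V \<theta> \<and> (\<forall>x\<in>V. 0 < \<theta> x) \<and>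
     shift_ker A Fl V = {\<mu>. \<exists>n::int. \<forall>x\<in>V. \<mu> x = of_int n * \<theta> x}"

text \<open>Applied to connected open \<open>V\<close> only. Connected sets are nonempty by convention here, unlike for the library constant
  \<^const>\<open>connected\<close>; hence the explicit \<open>V \<noteq> {}\<close>.\<close>

definition periodic_shift ::
  "('m::{t2_space,second_countable_topology}, 'e::euclidean_space) chart set
    \<Rightarrow> (('m, 'e) chart \<Rightarrow> 'm \<Rightarrow> 'e) \<Rightarrow> ('m \<times> real \<Rightarrow> 'm) \<Rightarrow> 'm set \<Rightarrow> bool" where
  "periodic_shift A F Fl V \<longleftrightarrow> V \<noteq> {} \<and> nowhere_dense_in (zeros A F) V \<and>
     (\<exists>\<theta>. positive_generator A Fl V \<theta>)"

definition pn_nbhd ::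
  "('m::{t2_space,second_countable_topology}, 'e::euclidean_space) chart set
    \<Rightarrow> (('m, 'e) chart \<Rightarrow> 'm \<Rightarrow> 'e) \<Rightarrow> ('m \<times> real \<Rightarrow> 'm) \<Rightarrow> 'm \<Rightarrow> 'm set \<Rightarrow> bool" where
  "pn_nbhd A F Fl z V \<longleftrightarrow> open V \<and> z \<in> V \<and> connected (V - zeros A F) \<and>
     periodic_shift A F Fl (V - zeros A F) \<and>
     (\<forall>W. open W \<and> connected W \<and> z \<in> W \<and> W \<subseteq> V \<longrightarrow> \<not> periodic_shift A F Fl W)"

definition pn_point ::
  "('m::{t2_space,second_countable_topology}, 'e::euclidean_space) chart set
    \<Rightarrow> (('m, 'e) chart \<Rightarrow> 'm \<Rightarrow> 'e) \<Rightarrow> ('m \<times> real \<Rightarrow> 'm) \<Rightarrow> 'm \<Rightarrow> bool" where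
  "pn_point A F Fl z \<longleftrightarrow> z \<in> zeros A F \<and> (\<exists>V. pn_nbhd A F Fl z V)"

definition strong_pn_point ::
  "('m::{t2_space,second_countable_topology}, 'e::euclidean_space) chart set
    \<Rightarrow> (('m, 'e) chart \<Rightarrow> 'm \<Rightarrow> 'e) \<Rightarrow> ('m \<times> real \<Rightarrow> 'm) \<Rightarrow> 'm \<Rightarrow> bool" where
  "strong_pn_point A F Fl z \<longleftrightarrow> z \<in> zeros A F \<and>
     (\<exists>V \<theta>. pn_nbhd A F Fl z V \<and> positive_generator A Fl (V - zeros A F) \<theta> \<and>
        filterlim \<theta> at_top (at z within (V - zeros A F)))"


section \<open>Jets and deformations\<close>

text \<open>The \<open>k\<close>-jet of \<open>h\<close> at \<open>x\<close> consists of the source \<open>x\<close>, the target \<open>h x\<close> and, for all charts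
  around source and target, the partial derivatives up to order \<open>k\<close> of the coordinate expression
  of \<open>h\<close> (as a function of the list of differentiation directions, extended by \<open>0\<close>). Two germs
  have the same such data iff they agree to order \<open>k\<close>. The topology on the jet space is the one
  generated by the source, the target and these jet coordinates.\<close>

type_synonym ('m, 'e) jet_data =
  "'m \<times> 'm \<times> (('m, 'e) chart \<Rightarrow> ('m, 'e) chart \<Rightarrow> 'e list \<Rightarrow> 'e)"

definition jet ::
  "('m::{t2_space,second_countable_topology}, 'e::euclidean_space) chart set
    \<Rightarrow> nat \<Rightarrow> 'm set \<Rightarrow> ('m \<Rightarrow> 'm) \<Rightarrow> 'm \<Rightarrow> ('m, 'e) jet_data" where
  "jet A k V h x = (x, h x, (\<lambda>c c' vs.
     if c \<in> A \<and> c' \<in> A \<and> x \<in> cdom c \<and> h x \<in> cdom c' \<and> length vs \<le> k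
     then iterated_deriv (cmap c ` (cdom c \<inter> V \<inter> h -` cdom c')) vs (cmap c' \<circ> h \<circ> cinv c) (cmap c x)
     else 0))"

definition jet_space ::
  "('m::{t2_space,second_countable_topology}, 'e::euclidean_space) chart set
    \<Rightarrow> nat \<Rightarrow> 'm set \<Rightarrow> ('m, 'e) jet_data topology" where
  "jet_space A k V =
     subtopology
       (topology_generated_by
         ({{(x, y, p). x \<in> S \<and> y \<in> S'} | S S'. open S \<and> open S'} \<union>
          {{(x, y, p). x \<in> cdom c \<and> y \<in> cdom c' \<and> p c c' vs \<in> B} | c c' vs B.
             c \<in> A \<and> c' \<in> A \<and> length vs \<le> k \<and> open B}))
       {jet A k V h x | h x. smooth_map A V h \<and> x \<in> V}"

definition deformation ::
  "('m::{t2_space,second_countable_topology}, 'e::euclidean_space) chart set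
    \<Rightarrow> enat \<Rightarrow> 'm set \<Rightarrow> 't::topological_space set \<Rightarrow> ('m \<Rightarrow> 'm) set \<Rightarrow> ('m \<times> 't \<Rightarrow> 'm) \<Rightarrow> bool" where
  "deformation A k V T \<H> \<Omega> \<longleftrightarrow>
     continuous_on (V \<times> T) \<Omega> \<and>
     (\<forall>\<tau>\<in>T. (\<lambda>x. \<Omega> (x, \<tau>)) \<in> \<H>) \<and>
     (let jet_cont = (\<lambda>n. continuous_map (top_of_set (V \<times> T)) (jet_space A n V)
                            (\<lambda>(x, \<tau>). jet A n V (\<lambda>y. \<Omega> (y, \<tau>)) x))
      in (case k of enat n \<Rightarrow> jet_cont n | \<infinity> \<Rightarrow> (\<forall>n. jet_cont n)))"

end

theory Submission
  imports Defs
begin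

text \<open>Fix smooth shift functions \<open>a \<tau>\<close> of \<open>\<Omega> (_, \<tau>)\<close>. The differences \<open>mu \<tau> = \<Lambda> (_, \<tau>) - a \<tau>\<close> are
  continuous period functions off the zeros \<open>Z\<close>: the flow returns at time \<open>mu \<tau> x\<close> to \<open>x\<close>. On a
  connected set such functions form a cyclic group, and one vanishing at a single point vanishes.

  Let \<open>W0\<close> be a small (half-)ball around \<open>z\<close>. If \<open>mu \<tau> \<noteq> 0\<close> on a component \<open>U\<close> of \<open>W0 - Z\<close>, then
  \<open>\<Lambda> (x, _)\<close> runs through a whole period for \<open>x\<close> in \<open>U\<close>; as \<open>\<Omega> (x, _)\<close> stays near \<open>y\<close> when \<open>x\<close> is
  near a zero \<open>y\<close>, the orbits in \<open>U\<close> shrink to \<open>y\<close>. By an argument in the style of Newman's theorem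
  on periodic transformations this is impossible unless \<open>U\<close> is all of \<open>W0 - Z\<close>. So either all
  \<open>mu \<tau>\<close> vanish, and \<open>a \<tau>\<close> extends \<open>\<Lambda> (_, \<tau>)\<close>, or \<open>W0 - Z\<close> is connected and consists of
  periodic points.

  In the second case, if \<open>z\<close> is no \<open>pn\<close>-point, there is a smooth period function \<open>\<theta> > 0\<close> around \<open>z\<close>,
  the argument applied to \<open>\<theta>\<close> shows that \<open>Z\<close> does not separate small balls, and \<open>mu \<tau>\<close> is a constant
  multiple of \<open>\<theta>\<close>. In the other two cases periods tend to infinity at \<open>z\<close>. Here \<open>mu \<tau>\<close> is
  locally constant in \<open>\<tau>\<close>: the derivative of \<open>\<Omega> (_, \<tau>)\<close> maps \<open>F\<close> to a multiple of \<open>F\<close> and is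
  continuous, so if \<open>mu\<close> jumped, the velocities at any two points of a short orbit would have positive
  inner product, which is absurd for a closed curve. Hence \<open>mu \<tau> = \<alpha> - a \<tau>\<^sub>0\<close>, which is smooth.\<close>

section \<open>Calculus on sets with unique derivatives\<close>

text \<open>Off \<open>Z\<close> nothing is at stake: period functions are smooth there
  automatically. All difficulty sits on \<open>Z\<close>, of which only closedness and empty
  interior in \<open>V\<close> are known. \<open>W0 - Z\<close> might have components accumulating
  at \<open>z\<close>, each with a period function of its own, and even a single period function
  need not extend over \<open>Z\<close>. The Newman argument removes the first obstacle and uses
  only continuity of \<Omega>. At a point that is no \<open>pn\<close>-point the second obstacle is
  absent as well, so no derivative of the deformation enters. At a \<open>pn\<close>-point it is
  real, and the correction terms must be shown not to depend on the parameter. Continuity of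
  \<Omega> cannot show this, because a full turn along a short orbit hardly moves any point; the
  direction of the velocity does turn, and the first derivative of \<Omega> sees it. This is where
  \<open>k\<close> at least 1 is spent. The manifold boundary is handled in two ways: derivatives
  are taken within relatively open sets of the half-space, and arguments with Euclidean balls are
  moved to the open half-space.\<close>

definition thick :: "'a::euclidean_space set \<Rightarrow> bool" where
  "thick S \<longleftrightarrow> (\<forall>x\<in>S. \<forall>i\<in>Basis. \<forall>e>0. \<exists>d. 0 < \<bar>d\<bar> \<and> \<bar>d\<bar> < e \<and> x + d *\<^sub>R i \<in> S)"

text \<open>Accumulation along each coordinate axis is what
  \<open>frechet_derivative_unique_within\<close> asks for. Boundary points of a half-space satisfy
  it from one side only, which suffices.\<close>

lemma thick_has_derivative_unique:
  fixes f :: "'a::euclidean_space \<Rightarrow> 'b::real_normed_vector"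
  assumes "thick S" "x \<in> S"
    and "(f has_derivative f') (at x within S)" "(f has_derivative f'') (at x within S)"
  shows "f' = f''"
  using assms by (intro frechet_derivative_unique_within[of f f' x S f'']) (auto simp: thick_def)

lemma thick_frechet_derivative:
  fixes f :: "'a::euclidean_space \<Rightarrow> 'b::real_normed_vector"
  assumes "thick S" "x \<in> S" and f: "(f has_derivative f') (at x within S)"
  shows "frechet_derivative f (at x within S) = f'"
  using thick_has_derivative_unique[OF assms(1,2) _ f] f
  by (meson differentiableI frechet_derivative_works)

lemma thick_openin:
  assumes "thick K" "openin (top_of_set K) S"
  shows "thick S"
  unfolding thick_def
proof (intro ballI allI impI)
  fix x i :: 'a and e :: real
  assume x: "x \<in> S" and i: "i \<in> Basis" and e: "e > 0"
  obtain r where r: "r > 0" "ball x r \<inter> K \<subseteq> S"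
    using assms(2) x unfolding openin_contains_ball by blast
  have "x \<in> K" using assms(2) x openin_subset by fastforce
  then obtain d where d: "0 < \<bar>d\<bar>" "\<bar>d\<bar> < min e r" "x + d *\<^sub>R i \<in> K"
    using assms(1) i e r(1) unfolding thick_def by (metis min_less_iff_conj)
  have "x + d *\<^sub>R i \<in> ball x r"
    using d i by (simp add: dist_norm)
  with d r show "\<exists>d. 0 < \<bar>d\<bar> \<and> \<bar>d\<bar> < e \<and> x + d *\<^sub>R i \<in> S"
    by (intro exI[of _ d]) auto
qed

lemma normal_dir_in_Basis: "(normal_dir :: 'e::euclidean_space) \<in> Basis"
  unfolding normal_dir_def by (rule someI_ex) (use nonempty_Basis in blast)

lemma thick_half_space: "thick (half_space :: 'e::euclidean_space set)"
  unfolding thick_def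
proof (intro ballI allI impI)
  fix x i :: 'e and e :: real
  assume "x \<in> half_space" "i \<in> Basis" "e > 0"
  then show "\<exists>d. 0 < \<bar>d\<bar> \<and> \<bar>d\<bar> < e \<and> x + d *\<^sub>R i \<in> half_space"
    using normal_dir_in_Basis[where 'e='e]
    by (intro exI[of _ "e/2"]) (auto simp: half_space_def inner_add_left inner_Basis)
qed

abbreviation ddir :: "'a::real_normed_vector set \<Rightarrow> 'a \<Rightarrow> ('a \<Rightarrow> 'b::real_normed_vector) \<Rightarrow> 'a \<Rightarrow> 'b" where
  "ddir S v f \<equiv> (\<lambda>x. frechet_derivative f (at x within S) v)"

text \<open>The index is shifted: \<open>ck n\<close> asks for derivatives up to order \<open>n + 1\<close>.\<close>
definition ck :: "nat \<Rightarrow> 'a::real_normed_vector set \<Rightarrow> ('a \<Rightarrow> 'b::real_normed_vector) \<Rightarrow> bool" where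
  "ck n S f \<longleftrightarrow> (\<forall>vs. length vs \<le> n \<longrightarrow> iterated_deriv S vs f differentiable_on S)"

lemma smooth_on_ck: "smooth_on S f \<longleftrightarrow> (\<forall>n. ck n S f)"
  by (auto simp: smooth_on_def ck_def)

lemma iterated_deriv_append:
  "iterated_deriv S (us @ vs) f = iterated_deriv S us (iterated_deriv S vs f)"
  by (induction us) auto

lemma ck_0: "ck 0 S f \<longleftrightarrow> f differentiable_on S"
  by (auto simp: ck_def)

lemma ck_Suc: "ck (Suc n) S f \<longleftrightarrow> f differentiable_on S \<and> (\<forall>v. ck n S (ddir S v f))"
proof (intro iffI conjI allI)
  assume *: "ck (Suc n) S f"
  show "f differentiable_on S"
    using *[unfolded ck_def, rule_format, of "[]"] by simp
  fix v show "ck n S (ddir S v f)"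
    unfolding ck_def
  proof (intro allI impI)
    fix vs :: "'a list" assume "length vs \<le> n"
    with *[unfolded ck_def, rule_format, of "vs @ [v]"]
    show "iterated_deriv S vs (ddir S v f) differentiable_on S"
      by (simp add: iterated_deriv_append)
  qed
next
  assume *: "f differentiable_on S \<and> (\<forall>v. ck n S (ddir S v f))"
  show "ck (Suc n) S f"
    unfolding ck_def
  proof (intro allI impI)
    fix vs :: "'a list" assume l: "length vs \<le> Suc n"
    show "iterated_deriv S vs f differentiable_on S"
    \<comment> \<open>The direction applied first to \<open>f\<close> is the last entry of the list,
      so the list is split at its end.\<close>
    proof (cases vs rule: rev_cases)
      case Nil then show ?thesis using * by simp
    next
      case (snoc us v)
      with l * show ?thesis by (simp add: iterated_deriv_append ck_def)
    qed
  qed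
qed

lemma ck_differentiable: "ck n S f \<Longrightarrow> f differentiable_on S"
  by (metis ck_def iterated_deriv.simps(1) list.size(3) zero_le)

lemma ck_mono: "ck n S f \<Longrightarrow> m \<le> n \<Longrightarrow> ck m S f"
  by (auto simp: ck_def)

lemma smooth_on_Suc: "smooth_on S f \<longleftrightarrow> f differentiable_on S \<and> (\<forall>v. smooth_on S (ddir S v f))"
proof
  assume *: "smooth_on S f"
  then have "ck (Suc n) S f" for n by (simp add: smooth_on_ck)
  then show "f differentiable_on S \<and> (\<forall>v. smooth_on S (ddir S v f))"
    by (simp add: smooth_on_ck ck_Suc)
next
  assume "f differentiable_on S \<and> (\<forall>v. smooth_on S (ddir S v f))"
  then have "ck (Suc n) S f" for n by (simp add: smooth_on_ck ck_Suc)
  then show "smooth_on S f" using ck_mono[OF _ le_SucI[OF order_refl]] by (auto simp: smooth_on_ck)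
qed

section \<open>Congruence and restriction of iterated derivatives\<close>

lemma frechet_derivative_cong:
  assumes "\<And>y. y \<in> S \<Longrightarrow> f y = g y" "x \<in> S"
  shows "frechet_derivative f (at x within S) = frechet_derivative g (at x within S)"
proof -
  have "(f has_derivative D) (at x within S) \<longleftrightarrow> (g has_derivative D) (at x within S)" for D
    using assms by (metis has_derivative_transform)
  then show ?thesis by (simp add: frechet_derivative_def)
qed

lemma iterated_deriv_cong:
  assumes "\<And>y. y \<in> S \<Longrightarrow> f y = g y" "x \<in> S"
  shows "iterated_deriv S vs f x = iterated_deriv S vs g x"
  using assms(2)
proof (induction vs arbitrary: x)
  case (Cons v vs)
  then show ?case using frechet_derivative_cong[of S "iterated_deriv S vs f"] by auto
qed (use assms in auto)

lemma differentiable_on_cong: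
  assumes "\<And>y. y \<in> S \<Longrightarrow> f y = g y"
  shows "f differentiable_on S \<longleftrightarrow> g differentiable_on S"
  unfolding differentiable_on_def differentiable_def
  using assms by (metis has_derivative_transform)

lemma ck_cong:
  assumes "\<And>y. y \<in> S \<Longrightarrow> f y = g y"
  shows "ck n S f \<longleftrightarrow> ck n S g"
proof -
  have "iterated_deriv S vs f differentiable_on S \<longleftrightarrow> iterated_deriv S vs g differentiable_on S" for vs
    by (rule differentiable_on_cong) (use iterated_deriv_cong assms in blast)
  then show ?thesis by (simp add: ck_def)
qed

lemma at_within_openin_eq:
  assumes "openin (top_of_set S) S'" "x \<in> S'"
  shows "at x within S' = at x within S"
proof -
  obtain U where "open U" "S' = S \<inter> U" using assms(1) openin_open by blast
  with assms(2) show ?thesis by (intro at_within_nhd[of x U]) auto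
qed

lemma iterated_deriv_openin:
  assumes "openin (top_of_set S) S'" "x \<in> S'"
  shows "iterated_deriv S' vs f x = iterated_deriv S vs f x"
  using assms(2)
proof (induction vs arbitrary: x)
  case (Cons v vs)
  have "frechet_derivative (iterated_deriv S' vs f) (at x within S')
      = frechet_derivative (iterated_deriv S vs f) (at x within S')"
    using Cons by (intro frechet_derivative_cong) auto
  then show ?case using at_within_openin_eq[OF assms(1) Cons.prems] by simp
qed auto

lemma smooth_on_openin:
  assumes "openin (top_of_set S) S'" "smooth_on S f"
  shows "smooth_on S' f"
  unfolding smooth_on_def
proof
  fix vs
  have "iterated_deriv S' vs f differentiable_on S' \<longleftrightarrow> iterated_deriv S vs f differentiable_on S'"
    by (rule differentiable_on_cong) (use iterated_deriv_openin assms in blast)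
  moreover have "iterated_deriv S vs f differentiable_on S'"
    using differentiable_on_subset[of "iterated_deriv S vs f" S S'] assms openin_imp_subset[OF assms(1)]
    unfolding smooth_on_def by simp
  ultimately show "iterated_deriv S' vs f differentiable_on S'" by simp
qed

lemma differentiable_on_has_derivative:
  "f differentiable_on S \<Longrightarrow> x \<in> S \<Longrightarrow>
     (f has_derivative frechet_derivative f (at x within S)) (at x within S)"
  by (simp add: differentiable_on_def frechet_derivative_works)

lemma smooth_on_has_derivative:
  "smooth_on S f \<Longrightarrow> x \<in> S \<Longrightarrow>
     (f has_derivative frechet_derivative f (at x within S)) (at x within S)"
  by (simp add: differentiable_on_has_derivative smooth_on_Suc[of S f])

lemma smooth_on_continuous: "smooth_on S f \<Longrightarrow> continuous_on S f"
  by (simp add: differentiable_imp_continuous_on smooth_on_Suc[of S f])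

lemma smooth_on_continuous_ddir: "smooth_on S f \<Longrightarrow> continuous_on S (ddir S v f)"
  by (simp add: smooth_on_continuous smooth_on_Suc[of S f])

text \<open>Lets each closure property be proved by induction from an explicit derivative formula:
  thickness identifies \<open>f'\<close> with the derivative chosen by
  \<open>frechet_derivative\<close>.\<close>

lemma ck_SucI:
  fixes f :: "'a::euclidean_space \<Rightarrow> 'b::real_normed_vector"
  assumes "thick S" and f: "\<And>x. x \<in> S \<Longrightarrow> (f has_derivative f' x) (at x within S)"
    and "\<And>v. ck n S (\<lambda>x. f' x v)"
  shows "ck (Suc n) S f"
  unfolding ck_Suc
proof (intro conjI allI)
  show "f differentiable_on S"
    using f unfolding differentiable_on_def differentiable_def by blast
  fix v
  have "ck n S (ddir S v f) \<longleftrightarrow> ck n S (\<lambda>x. f' x v)"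
  proof (rule ck_cong)
    fix x assume "x \<in> S"
    from thick_frechet_derivative[OF assms(1) this f[OF this]]
    show "ddir S v f x = f' x v" by simp
  qed
  with assms(3) show "ck n S (ddir S v f)" by simp
qed

section \<open>Stability of finite differentiability under algebra and composition\<close>

lemma ck_const: "thick S \<Longrightarrow> ck n S (\<lambda>x. c)"
proof (induction n arbitrary: c)
  case (Suc n)
  show ?case by (rule ck_SucI[OF Suc.prems has_derivative_const]) (use Suc in auto)
qed (simp add: ck_0)

lemma ck_bounded_linear:
  assumes "thick S" "bounded_linear L"
  shows "ck n S f \<Longrightarrow> ck n S (\<lambda>x. L (f x))"
proof (induction n arbitrary: f)
  case 0
  then have "((\<lambda>x. L (f x)) has_derivative (\<lambda>h. L (frechet_derivative f (at x within S) h))) (at x within S)"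
    if "x \<in> S" for x
    using bounded_linear.has_derivative[OF assms(2) differentiable_on_has_derivative[OF _ that]]
    by (simp add: ck_0)
  then show ?case unfolding ck_0 differentiable_on_def differentiable_def by blast
next
  case (Suc n)
  from Suc.prems have d: "f differentiable_on S" by (rule ck_differentiable)
  show ?case
    by (rule ck_SucI[OF assms(1) bounded_linear.has_derivative[OF assms(2) differentiable_on_has_derivative[OF d]]])
       (use Suc in \<open>auto simp: ck_Suc\<close>)
qed

lemma ck_id: "thick S \<Longrightarrow> ck n S (\<lambda>x. x)"
proof (cases n)
  case (Suc m)
  assume S: "thick S"
  show ?thesis unfolding Suc by (rule ck_SucI[OF S has_derivative_ident ck_const[OF S]])
qed (simp add: ck_0)

lemma ck_add:
  assumes "thick S"
  shows "ck n S f \<Longrightarrow> ck n S g \<Longrightarrow> ck n S (\<lambda>x. f x + g x)"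
proof (induction n arbitrary: f g)
  case 0
  then show ?case by (simp add: ck_0)
next
  case (Suc n)
  from Suc.prems have d: "f differentiable_on S" "g differentiable_on S" by (auto intro: ck_differentiable)
  show ?case
    by (rule ck_SucI[OF assms has_derivative_add[OF differentiable_on_has_derivative[OF d(1)] differentiable_on_has_derivative[OF d(2)]]])
       (use Suc in \<open>auto simp: ck_Suc\<close>)
qed

lemma ck_bilinear:
  assumes "thick S" "bounded_bilinear B"
  shows "ck n S f \<Longrightarrow> ck n S g \<Longrightarrow> ck n S (\<lambda>x. B (f x) (g x))"
proof (induction n arbitrary: f g)
  case 0
  have "(\<lambda>x. B (f x) (g x)) differentiable at x within S" if "x \<in> S" for x
    using bounded_bilinear.FDERIV[OF assms(2) 0[unfolded ck_0, THEN differentiable_on_has_derivative, OF that]]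
    by (rule differentiableI)
  then show ?case unfolding ck_0 differentiable_on_def by blast
next
  case (Suc n)
  from Suc.prems have d: "f differentiable_on S" "g differentiable_on S" by (auto intro: ck_differentiable)
  have n: "ck n S f" "ck n S g" using Suc.prems ck_mono le_SucI by blast+
  show ?case
    by (rule ck_SucI[OF assms(1) bounded_bilinear.FDERIV[OF assms(2) differentiable_on_has_derivative[OF d(1)] differentiable_on_has_derivative[OF d(2)]]])
       (use Suc n in \<open>auto simp: ck_Suc intro!: ck_add assms(1) Suc.IH\<close>)
qed

lemma ck_sum:
  assumes "thick S" "\<And>i. i \<in> I \<Longrightarrow> ck n S (f i)"
  shows "ck n S (\<lambda>x. \<Sum>i\<in>I. f i x)"
  using assms(2) by (induction I rule: infinite_finite_induct) (auto intro: ck_add ck_const assms(1))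

lemma ck_inverse:
  fixes g :: "'a::euclidean_space \<Rightarrow> real"
  assumes S: "thick S" and nz: "\<And>x. x \<in> S \<Longrightarrow> g x \<noteq> 0"
  shows "ck n S g \<Longrightarrow> ck n S (\<lambda>x. inverse (g x))"
proof (induction n)
  case 0
  then show ?case using nz by (simp add: ck_0 differentiable_on_def)
next
  case (Suc n)
  from Suc.prems have d: "g differentiable_on S" by (auto intro: ck_differentiable)
  have *: "((\<lambda>x. inverse (g x)) has_derivative (\<lambda>h. - (inverse (g x) * frechet_derivative g (at x within S) h * inverse (g x)))) (at x within S)"
     if "x \<in> S" for x
    using Deriv.has_derivative_inverse[OF nz[OF that] differentiable_on_has_derivative[OF d that]] .
  have "ck n S (\<lambda>x. - (inverse (g x) * ddir S v g x * inverse (g x)))" for v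
  proof -
    have "ck n S (\<lambda>x. inverse (g x))" using Suc ck_mono le_SucI by blast
    moreover have "ck n S (ddir S v g)" using Suc.prems by (simp add: ck_Suc)
    ultimately have "ck n S (\<lambda>x. (inverse (g x) * ddir S v g x) * inverse (g x))"
      using ck_bilinear[OF S bounded_bilinear_mult] by blast
    then show ?thesis using ck_bounded_linear[OF S bounded_linear_minus[OF bounded_linear_ident]] by blast
  qed
  then show ?case
    using ck_SucI[of S "\<lambda>x. inverse (g x)"
      "\<lambda>x h. - (inverse (g x) * frechet_derivative g (at x within S) h * inverse (g x))", OF S *] by simp
qed

lemma ck_compose:
  fixes f :: "'b::euclidean_space \<Rightarrow> 'c::real_normed_vector" and g :: "'a::euclidean_space \<Rightarrow> 'b"
  assumes S: "thick S" and gS: "g ` S \<subseteq> S'"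
  shows "ck n S' f \<Longrightarrow> ck n S g \<Longrightarrow> ck n S (\<lambda>x. f (g x))"
proof (induction n arbitrary: f)
  have D: "((\<lambda>x. f (g x)) has_derivative (\<lambda>h. frechet_derivative f (at (g x) within S') (frechet_derivative g (at x within S) h))) (at x within S)"
     if "f differentiable_on S'" "g differentiable_on S" "x \<in> S" for x and f :: "'b \<Rightarrow> 'c"
    by (rule has_derivative_in_compose2[of S' f "\<lambda>y. frechet_derivative f (at y within S')" g S])
       (use that gS in \<open>auto intro: differentiable_on_has_derivative\<close>)
  {
    case 0
    have "(\<lambda>x. f (g x)) differentiable at x within S" if "x \<in> S" for x
      using D[OF 0[unfolded ck_0] that] by (rule differentiableI)
    then show ?case unfolding ck_0 differentiable_on_def by blast
  next
    case (Suc n)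
    then have df: "f differentiable_on S'" and dg: "g differentiable_on S" by (auto intro: ck_differentiable)
    have n: "ck n S g" using Suc.prems ck_mono le_SucI by blast
    \<comment> \<open>The chain rule differentiates \<open>f\<close> in a direction that moves with
      \<open>x\<close>, while the induction hypothesis is about fixed directions. Expanding in the
      basis separates the moving coefficients from the fixed directions.\<close>
    have D': "((\<lambda>x. f (g x)) has_derivative
        (\<lambda>h. \<Sum>b\<in>Basis. (frechet_derivative g (at x within S) h \<bullet> b) *\<^sub>R ddir S' b f (g x))) (at x within S)"
      if x: "x \<in> S" for x
    proof -
      have l: "linear (frechet_derivative f (at (g x) within S'))"
        using df gS x by (intro linear_frechet_derivative) (auto simp: differentiable_on_def)
      have "frechet_derivative f (at (g x) within S') w = (\<Sum>b\<in>Basis. (w \<bullet> b) *\<^sub>R ddir S' b f (g x))" for w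
      proof -
        have "frechet_derivative f (at (g x) within S') w = frechet_derivative f (at (g x) within S') (\<Sum>b\<in>Basis. (w \<bullet> b) *\<^sub>R b)"
          by (simp add: euclidean_representation)
        then show ?thesis by (simp add: linear_sum[OF l] linear_cmul[OF l])
      qed
      then have "(\<lambda>h. frechet_derivative f (at (g x) within S') (frechet_derivative g (at x within S) h))
          = (\<lambda>h. \<Sum>b\<in>Basis. (frechet_derivative g (at x within S) h \<bullet> b) *\<^sub>R ddir S' b f (g x))"
        by (rule ext)
      with D[OF df dg x] show ?thesis by (rule subst[rotated])
    qed
    have "ck n S (\<lambda>x. \<Sum>b\<in>Basis. (ddir S v g x \<bullet> b) *\<^sub>R (ddir S' b f (g x)))" for v
      by (intro ck_sum S ck_bilinear[OF S bounded_bilinear_scaleR] ck_bilinear[OF S bounded_bilinear_inner] Suc.IH n)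
         (use Suc.prems ck_const S in \<open>auto simp: ck_Suc\<close>)
    then show ?case
      using ck_SucI[of S "\<lambda>x. f (g x)" "\<lambda>x h. \<Sum>b\<in>Basis. (frechet_derivative g (at x within S) h \<bullet> b) *\<^sub>R ddir S' b f (g x)",
        OF S D'] by blast
  }
qed

lemma smooth_on_add: "thick S \<Longrightarrow> smooth_on S f \<Longrightarrow> smooth_on S g \<Longrightarrow> smooth_on S (\<lambda>x. f x + g x)"
  by (simp add: smooth_on_ck ck_add)

lemma smooth_on_bounded_linear:
  "thick S \<Longrightarrow> bounded_linear L \<Longrightarrow> smooth_on S f \<Longrightarrow> smooth_on S (\<lambda>x. L (f x))"
  by (simp add: smooth_on_ck ck_bounded_linear)

section \<open>Flows in charts\<close>

locale flow_manifold =
  fixes A :: "('m::{t2_space,second_countable_topology}, 'e::euclidean_space) chart set"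
    and F :: "('m, 'e) chart \<Rightarrow> 'm \<Rightarrow> 'e"
    and Fl :: "'m \<times> real \<Rightarrow> 'm"
  assumes manifold: "smooth_manifold A"
    and field: "smooth_vector_field A F"
    and flow: "global_flow A F Fl"
begin

abbreviation Z :: "'m set" where "Z \<equiv> zeros A F"

abbreviation cimg :: "('m, 'e) chart \<Rightarrow> 'm set \<Rightarrow> 'e set" where
  "cimg c U \<equiv> cmap c ` (cdom c \<inter> U)"

lemma obtain_chart: obtains c where "c \<in> A" "x \<in> cdom c"
  using manifold unfolding smooth_manifold_def by blast

lemma open_cdom: "c \<in> A \<Longrightarrow> open (cdom c)"
  and cimg_UNIV_openin: "c \<in> A \<Longrightarrow> openin (top_of_set half_space) (cmap c ` cdom c)"
  and chart_homeomorphism: "c \<in> A \<Longrightarrow> homeomorphism (cdom c) (cmap c ` cdom c) (cmap c) (cinv c)"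
  and transition_smooth: "c \<in> A \<Longrightarrow> c' \<in> A \<Longrightarrow> smooth_on (cmap c ` (cdom c \<inter> cdom c')) (cmap c' \<circ> cinv c)"
  using manifold unfolding smooth_manifold_def by auto

lemma cinv_cmap [simp]: "c \<in> A \<Longrightarrow> x \<in> cdom c \<Longrightarrow> cinv c (cmap c x) = x"
  using chart_homeomorphism by (meson homeomorphism_apply1)

lemma cmap_inj: "c \<in> A \<Longrightarrow> x \<in> cdom c \<Longrightarrow> y \<in> cdom c \<Longrightarrow> cmap c x = cmap c y \<Longrightarrow> x = y"
  by (metis cinv_cmap)

lemma continuous_on_cmap: "c \<in> A \<Longrightarrow> continuous_on (cdom c) (cmap c)"
  and continuous_on_cinv: "c \<in> A \<Longrightarrow> continuous_on (cmap c ` cdom c) (cinv c)"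
  using chart_homeomorphism unfolding homeomorphism_def by auto

lemma cimg_openin_cimg:
  assumes "c \<in> A" "open U"
  shows "openin (top_of_set (cmap c ` cdom c)) (cimg c U)"
  using homeomorphism_imp_open_map[OF chart_homeomorphism[OF assms(1)], of "cdom c \<inter> U"] assms(2)
  by (simp add: openin_open_Int)

lemma cimg_openin: "c \<in> A \<Longrightarrow> open U \<Longrightarrow> openin (top_of_set half_space) (cimg c U)"
  using cimg_openin_cimg cimg_UNIV_openin openin_trans by blast

lemma thick_cimg: "c \<in> A \<Longrightarrow> open U \<Longrightarrow> thick (cimg c U)"
  using cimg_openin thick_half_space thick_openin by blast

lemma open_chart_preimage:
  assumes "c \<in> A" "open S"
  shows "open {x \<in> cdom c. cmap c x \<in> S}"
  using continuous_open_preimage[OF continuous_on_cmap[OF assms(1)] open_cdom[OF assms(1)] assms(2)]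
  by (simp add: vimage_def Int_def)

section \<open>Smooth functions on open subsets of the manifold\<close>

lemma smooth_fun_subset:
  assumes "smooth_fun A U f" "open W" "W \<subseteq> U"
  shows "smooth_fun A W f"
  unfolding smooth_fun_def
proof
  fix c assume c: "c \<in> A"
  have "openin (top_of_set (cimg c U)) (cimg c W)"
  proof (rule openin_subset_trans)
    show "openin (top_of_set (cmap c ` cdom c)) (cimg c W)" using cimg_openin_cimg c assms by blast
  qed (use assms in auto)
  then show "smooth_on (cimg c W) (f \<circ> cinv c)"
    using smooth_on_openin assms(1) c unfolding smooth_fun_def by blast
qed

lemma smooth_fun_add:
  "open U \<Longrightarrow> smooth_fun A U f \<Longrightarrow> smooth_fun A U g \<Longrightarrow> smooth_fun A U (\<lambda>x. f x + g x)"
  using smooth_on_add[OF thick_cimg] by (fastforce simp: smooth_fun_def o_def)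

lemma smooth_fun_scale: "open U \<Longrightarrow> smooth_fun A U f \<Longrightarrow> smooth_fun A U (\<lambda>x. r * f x)"
  using smooth_on_bounded_linear[OF thick_cimg bounded_linear_mult_right]
  by (fastforce simp: smooth_fun_def o_def)

lemma smooth_fun_lincomb:
  "open U \<Longrightarrow> smooth_fun A U f \<Longrightarrow> smooth_fun A U g \<Longrightarrow> smooth_fun A U (\<lambda>x. f x + r * g x)"
  by (intro smooth_fun_add smooth_fun_scale)

lemma smooth_fun_continuous:
  assumes "open U" "smooth_fun A U f"
  shows "continuous_on U f"
  unfolding continuous_on_eq_continuous_at[OF assms(1)]
proof
  fix x assume x: "x \<in> U"
  obtain c where c: "c \<in> A" "x \<in> cdom c" using obtain_chart .
  have op: "open (cdom c \<inter> U)" using assms open_cdom c by blast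
  have "continuous_on (cimg c U) (f \<circ> cinv c)"
    using assms(2) c smooth_on_continuous unfolding smooth_fun_def by blast
  moreover have "continuous_on (cdom c \<inter> U) (cmap c)"
    using continuous_on_cmap[OF c(1)] continuous_on_subset by blast
  ultimately have "continuous_on (cdom c \<inter> U) (\<lambda>x. (f \<circ> cinv c) (cmap c x))"
    by (rule continuous_on_compose2) auto
  then have "continuous_on (cdom c \<inter> U) f"
    by (rule continuous_on_eq) (use c in auto)
  then show "isCont f x" using op x c continuous_on_eq_continuous_at by blast
qed

section \<open>Orbits, velocities and zeros\<close>

lemma Fl_0 [simp]: "Fl (x, 0) = x"
  and Fl_Fl [simp]: "Fl (Fl (x, s), t) = Fl (x, s + t)"
  and continuous_Fl: "continuous_on UNIV Fl"
  and velocity: "c \<in> A \<Longrightarrow> Fl (x, t) \<in> cdom c \<Longrightarrow>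
        ((\<lambda>s. cmap c (Fl (x, s))) has_vector_derivative F c (Fl (x, t))) (at t)"
  using flow unfolding global_flow_def by auto

lemma continuous_on_Fl [continuous_intros]:
  "continuous_on S f \<Longrightarrow> continuous_on S g \<Longrightarrow> continuous_on S (\<lambda>x. Fl (f x, g x))"
  by (rule continuous_on_compose2[OF continuous_Fl]) (auto intro: continuous_on_Pair)

lemma open_Fl_vimage: "open B \<Longrightarrow> open (Fl -` B)"
  using continuous_Fl by (simp add: open_vimage)

lemma open_orbit_times: "open B \<Longrightarrow> open {t. Fl (x, t) \<in> B}"
  using open_vimage[of B "\<lambda>t. Fl (x, t)"] by (simp add: vimage_def continuous_intros)

lemma open_time_map: "open B \<Longrightarrow> open {x. Fl (x, t) \<in> B}"
  using open_vimage[of B "\<lambda>x. Fl (x, t)"] by (simp add: vimage_def continuous_intros)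

definition flow_dom :: "('m, 'e) chart \<Rightarrow> ('m, 'e) chart \<Rightarrow> ('e \<times> real) set" where
  "flow_dom c c' = {(w, t). w \<in> cmap c ` cdom c \<and> Fl (cinv c w, t) \<in> cdom c'}"

definition flow_map :: "('m, 'e) chart \<Rightarrow> ('m, 'e) chart \<Rightarrow> 'e \<times> real \<Rightarrow> 'e" where
  "flow_map c c' = (\<lambda>(w, t). cmap c' (Fl (cinv c w, t)))"

lemma flow_map_smooth:
  assumes "c \<in> A" "c' \<in> A"
  shows "smooth_on (flow_dom c c') (flow_map c c')"
proof -
  have "(\<lambda>(x, t). (cmap c x, t)) ` {(x, t). x \<in> cdom c \<and> Fl (x, t) \<in> cdom c'} = flow_dom c c'"
    using assms by (force simp: flow_dom_def)
  moreover have "smooth_on ((\<lambda>(x, t). (cmap c x, t)) ` {(x, t). x \<in> cdom c \<and> Fl (x, t) \<in> cdom c'}) (flow_map c c')"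
    unfolding flow_map_def
    by (rule flow[unfolded global_flow_def, THEN conjunct2, THEN conjunct2, THEN conjunct2, THEN conjunct1, rule_format, OF assms])
  ultimately show ?thesis by simp
qed

lemma field_smooth: "c \<in> A \<Longrightarrow> smooth_on (cmap c ` cdom c) (F c \<circ> cinv c)"
  using field unfolding smooth_vector_field_def by blast

lemma field_continuous: "c \<in> A \<Longrightarrow> continuous_on (cdom c) (F c)"
proof -
  assume c: "c \<in> A"
  have "continuous_on (cdom c) (\<lambda>x. (F c \<circ> cinv c) (cmap c x))"
    using smooth_on_continuous[OF field_smooth[OF c]] continuous_on_cmap[OF c]
    by (rule continuous_on_compose2) auto
  then show ?thesis by (rule continuous_on_eq) (use c in auto)
qed

text \<open>The transformation law is linear in the vector, so vanishing in one chart forces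
  vanishing in all.\<close>

lemma zeros_iff:
  assumes "c \<in> A" "x \<in> cdom c"
  shows "x \<in> Z \<longleftrightarrow> F c x = 0"
proof
  assume 0: "F c x = 0"
  have "F c' x = 0" if c': "c' \<in> A" "x \<in> cdom c'" for c'
  proof -
    have "linear (frechet_derivative (cmap c' \<circ> cinv c) (at (cmap c x) within cmap c ` (cdom c \<inter> cdom c')))"
      using smooth_on_has_derivative[OF transition_smooth[OF assms(1) c'(1)], of "cmap c x"] assms c'
      by (intro linear_frechet_derivative) (auto simp: differentiable_def)
    then have "frechet_derivative (cmap c' \<circ> cinv c) (at (cmap c x) within cmap c ` (cdom c \<inter> cdom c')) 0 = 0"
      by (rule linear_0)
    moreover have "F c' x = frechet_derivative (cmap c' \<circ> cinv c) (at (cmap c x) within cmap c ` (cdom c \<inter> cdom c')) (F c x)"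
      using field assms c' unfolding smooth_vector_field_def by blast
    ultimately show ?thesis using 0 by simp
  qed
  then show "x \<in> Z" by (auto simp: zeros_def)
qed (use assms in \<open>auto simp: zeros_def\<close>)

lemma closed_zeros: "closed Z"
proof -
  have "\<exists>T. open T \<and> x \<in> T \<and> T \<subseteq> - Z" if "x \<in> - Z" for x
  proof -
    obtain c where c: "c \<in> A" "x \<in> cdom c" using obtain_chart .
    have "open (cdom c \<inter> F c -` (- {0}))"
      by (rule continuous_open_preimage[OF field_continuous[OF c(1)] open_cdom[OF c(1)]]) auto
    with c that show ?thesis
      by (intro exI[of _ "cdom c \<inter> F c -` (- {0})"]) (auto simp: zeros_iff)
  qed
  then have "open (- Z)" by (subst open_subopen) blast
  then show ?thesis by (simp add: closed_def)
qed

text \<open>For times in \<open>?N\<close> the curve stays in the set within which the derivative is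
  taken. As \<open>?N\<close> is open in the line, a two-sided derivative in time results even if
  \<open>x\<close> lies on the boundary.\<close>

lemma flow_chain:
  fixes g :: "'m \<Rightarrow> 'b::real_normed_vector"
  assumes c: "c \<in> A" "x \<in> cdom c" and U: "open U" "x \<in> U"
    and D: "((g \<circ> cinv c) has_derivative D) (at (cmap c x) within cimg c U)"
  shows "((\<lambda>s. g (Fl (x, s))) has_vector_derivative D (F c x)) (at 0)"
proof -
  let ?N = "{s. Fl (x, s) \<in> cdom c \<inter> U}"
  have N: "open ?N" "0 \<in> ?N" 
    using open_orbit_times[OF open_Int[OF open_cdom[OF c(1)] U(1)]] c U by simp_all
  have 1: "((\<lambda>s. cmap c (Fl (x, s))) has_derivative (\<lambda>h. h *\<^sub>R F c x)) (at 0 within ?N)"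
    using velocity[of c x 0] c unfolding has_vector_derivative_def by (simp add: has_derivative_at_withinI)
  have 2: "((g \<circ> cinv c) has_derivative D) (at (cmap c (Fl (x, 0))) within (\<lambda>s. cmap c (Fl (x, s))) ` ?N)"
  proof (rule has_derivative_subset)
    show "((g \<circ> cinv c) has_derivative D) (at (cmap c (Fl (x, 0))) within cimg c U)" using D by simp
  qed auto
  have "((\<lambda>s. (g \<circ> cinv c) (cmap c (Fl (x, s)))) has_derivative (\<lambda>h. D (h *\<^sub>R F c x))) (at 0 within ?N)"
    by (rule has_derivative_in_compose[OF 1 2])
  then have "((\<lambda>s. g (Fl (x, s))) has_derivative (\<lambda>h. D (h *\<^sub>R F c x))) (at 0 within ?N)"
    by (rule has_derivative_transform[OF N(2), rotated]) (use c in auto)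
  then have "((\<lambda>s. g (Fl (x, s))) has_derivative (\<lambda>h. D (h *\<^sub>R F c x))) (at 0)"
    by (simp only: at_within_open[OF N(2) N(1)])
  then show ?thesis
    unfolding has_vector_derivative_def
    using bounded_linear.linear[OF has_derivative_bounded_linear[OF D]] by (simp add: linear_cmul)
qed

lemma flow_has_derivative:
  assumes "c \<in> A" "c' \<in> A" "x \<in> cdom c" "Fl (x, t) \<in> cdom c'"
  shows "(((\<lambda>p. cmap c' (Fl (p, t))) \<circ> cinv c) has_derivative
            (\<lambda>v. frechet_derivative (flow_map c c') (at (cmap c x, t) within flow_dom c c') (v, 0)))
          (at (cmap c x) within cimg c {p. Fl (p, t) \<in> cdom c'})"
proof -
  let ?S = "cimg c {p. Fl (p, t) \<in> cdom c'}"
  have x: "(cmap c x, t) \<in> flow_dom c c'" using assms by (auto simp: flow_dom_def)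
  have 1: "((\<lambda>w. (w, t)) has_derivative (\<lambda>v. (v, 0))) (at (cmap c x) within ?S)"
    by (auto intro!: derivative_eq_intros)
  have "(\<lambda>w. (w, t)) ` ?S \<subseteq> flow_dom c c'"
    using assms by (auto simp: flow_dom_def)
  then have 2: "(flow_map c c' has_derivative frechet_derivative (flow_map c c') (at (cmap c x, t) within flow_dom c c'))
      (at (cmap c x, t) within (\<lambda>w. (w, t)) ` ?S)"
    by (rule has_derivative_subset[OF smooth_on_has_derivative[OF flow_map_smooth[OF assms(1,2)] x]])
  show ?thesis
    using has_derivative_in_compose[OF 1 2] by (simp add: flow_map_def o_def)
qed

text \<open>The two orders of flowing for times \<open>s\<close> and \<open>t\<close> agree.
  Differentiating at \<open>s = 0\<close> shows that the time-\<open>t\<close> map carries the field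
  to the field, hence zeros to zeros.\<close>

lemma Fl_zeros: assumes "x \<in> Z" shows "Fl (x, t) \<in> Z"
proof -
  obtain c where c: "c \<in> A" "x \<in> cdom c" using obtain_chart .
  obtain c' where c': "c' \<in> A" "Fl (x, t) \<in> cdom c'" using obtain_chart .
  note D = flow_has_derivative[OF c(1) c'(1) c(2) c'(2)]
  have "F c x = 0" using assms c zeros_iff by blast
  then have "((\<lambda>s. cmap c' (Fl (Fl (x, s), t))) has_vector_derivative 0) (at 0)"
    using flow_chain[OF c open_time_map[OF open_cdom[OF c'(1)]] _ D] c'
      linear_0[OF bounded_linear.linear[OF has_derivative_bounded_linear[OF D]]] by simp
  moreover have "((\<lambda>s. cmap c' (Fl (Fl (x, t), s))) has_vector_derivative F c' (Fl (x, t))) (at 0)"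
    using velocity[of c' "Fl (x, t)" 0] c' by simp
  ultimately have "F c' (Fl (x, t)) = 0"
    by (auto simp: add.commute intro: vector_derivative_unique_at)
  then show ?thesis using c' zeros_iff by blast
qed

text \<open>The orbit consists of zeros by \<open>Fl_zeros\<close>, so its velocity vanishes in
  charts and it is locally constant; the times spent at \<open>x\<close> form a clopen set.\<close>

lemma zero_fixed: assumes "x \<in> Z" shows "Fl (x, t) = x"
proof -
  let ?E = "{t. Fl (x, t) = x}"
  have "closed ?E" by (intro closed_Collect_eq continuous_intros)
  moreover have "open ?E"
  proof (subst open_subopen, intro ballI)
    fix t0 assume t0: "t0 \<in> ?E"
    obtain c where c: "c \<in> A" "x \<in> cdom c" using obtain_chart .
    obtain r where r: "r > 0" "ball t0 r \<subseteq> {t. Fl (x, t) \<in> cdom c}"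
      using open_orbit_times[OF open_cdom[OF c(1)], of x, unfolded open_contains_ball, rule_format, of t0] t0 c by auto
    have "((\<lambda>t. cmap c (Fl (x, t))) has_vector_derivative 0) (at t within ball t0 r)" if "t \<in> ball t0 r" for t
    proof -
      have "F c (Fl (x, t)) = 0" using Fl_zeros[OF assms] r that c zeros_iff by blast
      moreover have "Fl (x, t) \<in> cdom c" using r that by blast
      ultimately show ?thesis
        using has_vector_derivative_at_within[OF velocity[OF c(1), of x t]] by simp
    qed
    then obtain k where k: "\<And>t. t \<in> ball t0 r \<Longrightarrow> cmap c (Fl (x, t)) = k"
      using has_vector_derivative_zero_constant[of "ball t0 r" "\<lambda>t. cmap c (Fl (x, t))", OF convex_ball] by blast
    have "ball t0 r \<subseteq> ?E"
    proof
      fix t assume "t \<in> ball t0 r"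
      then have "cmap c (Fl (x, t)) = cmap c (Fl (x, t0))" using k r by simp
      then show "t \<in> ?E" using t0 cmap_inj[OF c(1)] c r \<open>t \<in> ball t0 r\<close> by auto
    qed
    with r show "\<exists>T. open T \<and> t0 \<in> T \<and> T \<subseteq> ?E" by (intro exI[of _ "ball t0 r"]) auto
  qed
  ultimately have "?E = UNIV" using clopen[of ?E] Fl_0[of x] by blast
  then show ?thesis by blast
qed

lemma Fl_zeros_iff: "Fl (x, t) \<in> Z \<longleftrightarrow> x \<in> Z"
  using Fl_zeros[of x t] Fl_zeros[of "Fl (x, t)" "- t"] by auto

text \<open>At \<open>x0\<close> and time 0 the inner product is the full squared norm; half of it
  is the margin that continuity preserves nearby. The bound is quantitative because orbits must
  later reach a transversal hyperplane in prescribed time.\<close>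

lemma flow_box:
  assumes "c \<in> A" "x0 \<in> cdom c" "x0 \<notin> Z" "open B" "x0 \<in> B"
  shows "\<exists>N \<epsilon>. open N \<and> x0 \<in> N \<and> \<epsilon> > 0 \<and>
    (\<forall>x\<in>N. \<forall>s. \<bar>s\<bar> < \<epsilon> \<longrightarrow> Fl (x, s) \<in> cdom c \<inter> B \<and> F c (Fl (x, s)) \<bullet> F c x0 > (norm (F c x0))\<^sup>2 / 2)"
proof -
  let ?P = "(cdom c \<inter> B) \<inter> (\<lambda>p. F c p \<bullet> F c x0) -` {(norm (F c x0))\<^sup>2 / 2 <..}"
  have nz: "F c x0 \<noteq> 0" using assms zeros_iff by blast
  have "continuous_on (cdom c \<inter> B) (\<lambda>p. F c p \<bullet> F c x0)"
    by (intro continuous_intros continuous_on_subset[OF field_continuous[OF assms(1)]]) auto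
  then have "open ?P"
    by (rule continuous_open_preimage[OF _ open_Int[OF open_cdom[OF assms(1)] assms(4)]]) auto
  then have "open (Fl -` ?P)" by (rule open_Fl_vimage)
  moreover have "(norm (F c x0))\<^sup>2 > 0" using nz by simp
  then have "(x0, 0) \<in> Fl -` ?P" using assms by (simp add: power2_norm_eq_inner)
  ultimately obtain N M where NM: "open N" "open M" "x0 \<in> N" "0 \<in> M" "N \<times> M \<subseteq> Fl -` ?P"
    by (rule open_prod_elim[of "Fl -` ?P" "(x0, 0)"]) auto
  obtain \<epsilon> where "\<epsilon> > 0" "ball 0 \<epsilon> \<subseteq> M"
    using NM(2,4) by (rule openE)
  then have "s \<in> M" if "\<bar>s\<bar> < \<epsilon>" for s using that by (auto simp: dist_norm)
  then have "Fl (x, s) \<in> ?P" if "x \<in> N" "\<bar>s\<bar> < \<epsilon>" for x s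
    using NM(5) that by blast
  then show ?thesis using NM(1,3) \<open>\<epsilon> > 0\<close> by (intro exI[of _ N] exI[of _ \<epsilon>]) simp
qed

lemma inner_has_real_derivative:
  assumes "c \<in> A" "Fl (x, t) \<in> cdom c"
  shows "((\<lambda>s. cmap c (Fl (x, s)) \<bullet> e) has_real_derivative F c (Fl (x, t)) \<bullet> e) (at t)"
  using bounded_linear.has_vector_derivative[OF bounded_linear_inner_left velocity[OF assms]]
  by (simp add: has_real_derivative_iff_has_vector_derivative)

text \<open>The coordinate in direction \<open>e\<close> strictly increases along the orbit. All
  later contradictions with closed orbits come from here.\<close>

lemma no_return:
  assumes "c \<in> A" "a < b"
    and "\<And>s. s \<in> {a..b} \<Longrightarrow> Fl (x, s) \<in> cdom c \<and> F c (Fl (x, s)) \<bullet> e > 0"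
  shows "Fl (x, a) \<noteq> Fl (x, b)"
proof -
  have "(cmap c (Fl (x, a)) \<bullet> e) < (cmap c (Fl (x, b)) \<bullet> e)"
    using assms inner_has_real_derivative[OF assms(1), of x _ e]
    by (intro DERIV_pos_imp_increasing[OF assms(2)]) (auto intro!: exI)
  then show ?thesis by auto
qed

lemma no_small_periods:
  assumes "x0 \<notin> Z"
  shows "\<exists>N \<epsilon>. open N \<and> x0 \<in> N \<and> \<epsilon> > 0 \<and> (\<forall>x\<in>N. \<forall>t. \<bar>t\<bar> < \<epsilon> \<longrightarrow> Fl (x, t) = x \<longrightarrow> t = 0)"
proof -
  obtain c where c: "c \<in> A" "x0 \<in> cdom c" using obtain_chart .
  obtain N \<epsilon> where N: "open N" "x0 \<in> N" "\<epsilon> > 0"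
    "\<forall>x\<in>N. \<forall>s. \<bar>s\<bar> < \<epsilon> \<longrightarrow> Fl (x, s) \<in> cdom c \<inter> UNIV \<and> F c (Fl (x, s)) \<bullet> F c x0 > (norm (F c x0))\<^sup>2 / 2"
    using flow_box[OF c assms open_UNIV UNIV_I] by blast
  have "t = 0" if "x \<in> N" "\<bar>t\<bar> < \<epsilon>" "Fl (x, t) = x" for x t
  proof (rule ccontr)
    assume "t \<noteq> 0"
    have "Fl (x, min 0 t) \<noteq> Fl (x, max 0 t)"
    proof (rule no_return[OF c(1), where e = "F c x0"])
      show "min 0 t < max 0 t" using \<open>t \<noteq> 0\<close> by auto
      fix s assume "s \<in> {min 0 t..max 0 t}"
      then have "\<bar>s\<bar> < \<epsilon>" using that by (auto simp: min_def max_def split: if_splits)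
      then have "Fl (x, s) \<in> cdom c" "F c (Fl (x, s)) \<bullet> F c x0 > (norm (F c x0))\<^sup>2 / 2" using N that by auto
      moreover have "(norm (F c x0))\<^sup>2 / 2 \<ge> 0" by simp
      ultimately show "Fl (x, s) \<in> cdom c \<and> F c (Fl (x, s)) \<bullet> F c x0 > 0" by linarith
    qed
    then show False using that by (auto simp: min_def max_def split: if_splits)
  qed
  with N show ?thesis by blast
qed

lemma period_int:
  assumes "Fl (x, t) = x"
  shows "Fl (x, of_int n * t) = x"
proof -
  have nat: "Fl (x, of_nat k * s) = x" if "Fl (x, s) = x" for k s
  proof (induction k)
    case (Suc k)
    have "Fl (x, of_nat (Suc k) * s) = Fl (Fl (x, of_nat k * s), s)" by (simp add: algebra_simps)
    then show ?case using Suc that by simp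
  qed simp
  have "Fl (x, - t) = x" using assms Fl_Fl[of x t "- t"] by simp
  then show ?thesis using nat[of t "nat n"] nat[of "- t" "nat (- n)"] assms
    by (cases "n \<ge> 0") auto
qed

text \<open>The periods of \<open>x\<close> form a closed subgroup of the reals in which 0 is
  isolated by \<open>no_small_periods\<close>. Hence a least positive period is attained, and the
  remainder of any period modulo it is a smaller nonnegative period, so 0.\<close>

lemma periods_cyclic:
  assumes "x \<notin> Z" "Fl (x, t) = x" "t \<noteq> 0"
  shows "\<exists>P>0. Fl (x, P) = x \<and> (\<forall>s. Fl (x, s) = x \<longrightarrow> (\<exists>n::int. s = of_int n * P))"
proof -
  obtain N \<epsilon> where "x \<in> N" "\<epsilon> > 0" "\<forall>x\<in>N. \<forall>t. \<bar>t\<bar> < \<epsilon> \<longrightarrow> Fl (x, t) = x \<longrightarrow> t = 0"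
    using no_small_periods[OF assms(1)] by blast
  then have \<epsilon>: "\<epsilon> > 0" "\<And>s. Fl (x, s) = x \<Longrightarrow> \<bar>s\<bar> < \<epsilon> \<Longrightarrow> s = 0" by auto
  let ?S = "{s. \<epsilon> \<le> s \<and> Fl (x, s) = x}"
  have pos: "s \<in> ?S" if "Fl (x, s) = x" "s > 0" for s using \<epsilon>(2)[of s] that by (cases "s < \<epsilon>") auto
  have "Fl (x, - t) = x" using assms Fl_Fl[of x t "- t"] by simp
  then have "\<bar>t\<bar> \<in> ?S" using assms pos[of "\<bar>t\<bar>"] by (auto simp: abs_if)
  then have ne: "?S \<noteq> {}" by blast
  have bdd: "bdd_below ?S" by (auto intro: bdd_belowI[of _ \<epsilon>])
  have "?S = {\<epsilon>..} \<inter> {s. Fl (x, s) = x}" by auto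
  moreover have "closed \<dots>" by (intro closed_Int closed_atLeast closed_Collect_eq continuous_intros)
  ultimately have "closed ?S" by simp
  then have P: "Inf ?S \<in> ?S" using closed_contains_Inf[OF ne bdd] by simp
  let ?P = "Inf ?S"
  have P0: "?P > 0" using P \<epsilon>(1) by auto
  have "\<exists>n::int. s = of_int n * ?P" if s: "Fl (x, s) = x" for s
  proof (intro exI)
    define r where "r = s - of_int \<lfloor>s / ?P\<rfloor> * ?P"
    have r: "0 \<le> r" "r < ?P" using P0 floor_divide_lower[of ?P s] floor_divide_upper[of ?P s]
      by (auto simp: r_def algebra_simps)
    have "Fl (x, of_int (- \<lfloor>s / ?P\<rfloor>) * ?P) = x" using P by (intro period_int) auto
    moreover have "Fl (Fl (x, s), of_int (- \<lfloor>s / ?P\<rfloor>) * ?P) = Fl (x, r)" by (simp add: r_def)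
    ultimately have "Fl (x, r) = x" using s by simp
    then have "r = 0" using cInf_lower[OF pos[of r] bdd] r by linarith
    then show "s = of_int \<lfloor>s / ?P\<rfloor> * ?P" by (simp add: r_def)
  qed
  with P P0 show ?thesis by (intro exI[of _ ?P]) auto
qed

end

section \<open>Period functions\<close>

context flow_manifold begin

definition period_fun :: "'m set \<Rightarrow> ('m \<Rightarrow> real) \<Rightarrow> bool" where
  "period_fun U \<mu> \<longleftrightarrow> continuous_on U \<mu> \<and> (\<forall>x\<in>U. Fl (x, \<mu> x) = x)"

lemma period_fun_subset: "period_fun U \<mu> \<Longrightarrow> W \<subseteq> U \<Longrightarrow> period_fun W \<mu>"
  unfolding period_fun_def using continuous_on_subset by blast

lemma period_fun_lincomb:
  assumes "period_fun U \<mu>" "period_fun U \<nu>"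
  shows "period_fun U (\<lambda>x. of_int a * \<mu> x + of_int b * \<nu> x)"
proof -
  have "Fl (x, of_int a * \<mu> x + of_int b * \<nu> x) = x" if "x \<in> U" for x
  proof -
    have "Fl (Fl (x, of_int a * \<mu> x), of_int b * \<nu> x) = x"
      using period_int[of x "\<mu> x" a] period_int[of x "\<nu> x" b] assms that by (simp add: period_fun_def)
    then show ?thesis by simp
  qed
  then show ?thesis using assms unfolding period_fun_def by (auto intro!: continuous_intros)
qed

lemma period_fun_diff: "period_fun U \<mu> \<Longrightarrow> period_fun U \<nu> \<Longrightarrow> period_fun U (\<lambda>x. \<mu> x - \<nu> x)"
  using period_fun_lincomb[of U \<mu> \<nu> 1 "-1"] by simp

text \<open>Nonzero periods are bounded away from 0 near each point of \<open>U\<close>, so the zero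
  set of \<mu> is open as well as closed.\<close>

lemma period_fun_vanishes:
  assumes "connected U" "U \<inter> Z = {}" "period_fun U \<mu>" "x0 \<in> U" "\<mu> x0 = 0" "x \<in> U"
  shows "\<mu> x = 0"
proof -
  let ?E = "{x \<in> U. \<mu> x = 0}"
  have cont: "continuous_on U \<mu>" using assms by (simp add: period_fun_def)
  have "openin (top_of_set U) ?E"
  proof (subst openin_subopen, intro ballI)
    fix y assume y: "y \<in> ?E"
    then have "y \<notin> Z" using assms by blast
    then obtain N \<epsilon> where N: "open N" "y \<in> N" "\<epsilon> > 0"
      "\<forall>x\<in>N. \<forall>t. \<bar>t\<bar> < \<epsilon> \<longrightarrow> Fl (x, t) = x \<longrightarrow> t = 0"
      using no_small_periods by blast
    let ?T = "(U \<inter> \<mu> -` {-\<epsilon><..<\<epsilon>}) \<inter> N"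
    have "openin (top_of_set U) (U \<inter> \<mu> -` {-\<epsilon><..<\<epsilon>})"
      by (rule continuous_openin_preimage_gen[OF cont]) simp
    then have "openin (top_of_set U) ?T" by (rule openin_Int_open[OF _ N(1)])
    moreover have "?T \<subseteq> ?E"
    proof
      fix p assume p: "p \<in> ?T"
      then have "\<bar>\<mu> p\<bar> < \<epsilon>" "Fl (p, \<mu> p) = p" using assms(3) by (auto simp: period_fun_def)
      with N(4) p show "p \<in> ?E" by blast
    qed
    ultimately show "\<exists>T. openin (top_of_set U) T \<and> y \<in> T \<and> T \<subseteq> ?E"
      using y N by (intro exI[of _ ?T]) auto
  qed
  moreover have "closedin (top_of_set U) ?E"
    using continuous_closedin_preimage_constant[OF cont, of 0] .
  ultimately have "?E = {} \<or> ?E = U" using assms(1) connected_clopen by blast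
  then show ?thesis using assms by blast
qed

text \<open>At \<open>x0\<close> both values are integer multiples of one period \<open>P\<close>;
  the integer combination that cancels there is a period function, hence cancels on all of
  \<open>U\<close>.\<close>

lemma period_funs_commensurable:
  assumes "connected U" "U \<inter> Z = {}" "period_fun U \<mu>" "period_fun U \<theta>"
    and x0: "x0 \<in> U" "\<mu> x0 \<noteq> 0" "\<theta> x0 \<noteq> 0"
  shows "\<exists>q. q \<noteq> 0 \<and> (\<forall>x\<in>U. \<mu> x = q * \<theta> x)"
proof -
  have per: "Fl (x0, \<mu> x0) = x0" "Fl (x0, \<theta> x0) = x0" using assms by (auto simp: period_fun_def)
  have "x0 \<notin> Z" using assms by blast
  then obtain P where P: "P > 0" "\<And>s. Fl (x0, s) = x0 \<Longrightarrow> \<exists>n::int. s = of_int n * P"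
    using periods_cyclic[of x0 "\<mu> x0"] per x0 by blast
  obtain m n :: int where mn: "\<mu> x0 = of_int m * P" "\<theta> x0 = of_int n * P" using P(2) per by blast
  then have nz: "m \<noteq> 0" "n \<noteq> 0" using x0 by auto
  have "of_int n * \<mu> x + of_int (- m) * \<theta> x = 0" if "x \<in> U" for x
    by (rule period_fun_vanishes[OF assms(1,2) period_fun_lincomb[OF assms(3,4)] x0(1) _ that]) (simp add: mn)
  then have "\<mu> x = (of_int m / of_int n) * \<theta> x" if "x \<in> U" for x
    using that nz by (simp add: field_simps)
  then show ?thesis using nz by (intro exI[of _ "of_int m / of_int n"]) auto
qed

text \<open>Implicit differentiation of \<open>Fl (x, \<mu> x) = x\<close>, whose time derivative \<open>F\<close> does not vanish.\<close>
lemma period_fun_smooth: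
  assumes U: "open U" "U \<inter> Z = {}" and \<mu>: "period_fun U \<mu>"
  shows "smooth_fun A U \<mu>"
  unfolding smooth_fun_def
proof
  fix c assume c: "c \<in> A"
  define S where "S = cimg c U"
  define m where "m = \<mu> \<circ> cinv c"
  define X where "X = F c \<circ> cinv c"
  define Q where "Q = flow_dom c c"
  define G where "G = flow_map c c"
  define DG where "DG = (\<lambda>w. frechet_derivative G (at (w, m w) within Q))"
  \<comment> \<open>Formally differentiating \<open>G (w, m w) = w\<close> gives
    \<open>DG w (h, 0) + Dm w h *\<^sub>R X w = h\<close>; pairing with \<open>X w\<close> solves
    for the scalar.\<close>
  define Dm where "Dm = (\<lambda>w h. ((h - DG w (h, 0)) \<bullet> X w) * inverse (X w \<bullet> X w))"
  have S: "thick S" unfolding S_def using thick_cimg c U by blast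
  have SC: "S \<subseteq> cmap c ` cdom c" unfolding S_def by blast
  have in_Q: "(w, m w) \<in> Q" and G_eq: "G (w, m w) = w" and X_nz: "X w \<noteq> 0" and X_vel: "F c (Fl (cinv c w, m w)) = X w"
    and cw: "cinv c w \<in> cdom c" and fix_w: "Fl (cinv c w, m w) = cinv c w"
    if "w \<in> S" for w
  proof -
    obtain x where x: "x \<in> cdom c" "x \<in> U" "w = cmap c x"
      using \<open>w \<in> S\<close> unfolding S_def by blast
    then have "Fl (x, \<mu> x) = x" using \<mu> by (simp add: period_fun_def)
    moreover have "x \<notin> Z" using x U by blast
    ultimately show "(w, m w) \<in> Q" "G (w, m w) = w" "X w \<noteq> 0" "F c (Fl (cinv c w, m w)) = X w"
      "cinv c w \<in> cdom c" "Fl (cinv c w, m w) = cinv c w"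
      using x c zeros_iff by (auto simp: Q_def G_def m_def X_def flow_dom_def flow_map_def)
  qed
  have G_smooth: "smooth_on Q G" unfolding Q_def G_def by (rule flow_map_smooth[OF c c])
  have m_cont: "continuous_on S m"
  proof -
    have "continuous_on S (cinv c)" using continuous_on_cinv[OF c] SC continuous_on_subset by blast
    moreover have "cinv c ` S \<subseteq> U" using c by (auto simp: S_def)
    moreover have "continuous_on U \<mu>" using \<mu> by (simp add: period_fun_def)
    ultimately show ?thesis unfolding m_def using continuous_on_compose continuous_on_subset by blast
  qed
  have DG: "(G has_derivative DG w) (at (w, m w) within Q)" if "w \<in> S" for w
    unfolding DG_def by (rule smooth_on_has_derivative[OF G_smooth in_Q[OF that]])
  have DG_time: "DG w (0, 1) = X w" if w: "w \<in> S" for w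
  proof -
    let ?N = "{t. Fl (cinv c w, t) \<in> cdom c}"
    have N: "open ?N" "m w \<in> ?N" using open_orbit_times[OF open_cdom[OF c]] fix_w[OF w] cw[OF w] by auto
    have wc: "w \<in> cmap c ` cdom c" using w SC by blast
    have 1: "((\<lambda>t. (w, t)) has_derivative (\<lambda>h. (0, h))) (at (m w) within ?N)"
      by (auto intro!: derivative_eq_intros)
    have sub: "(\<lambda>t. (w, t)) ` ?N \<subseteq> Q" using wc by (auto simp: Q_def flow_dom_def)
    have "((\<lambda>t. G (w, t)) has_derivative (\<lambda>h. DG w (0, h))) (at (m w) within ?N)"
      by (rule has_derivative_in_compose[OF 1 has_derivative_subset[OF DG[OF w] sub]])
    then have "((\<lambda>t. G (w, t)) has_derivative (\<lambda>h. DG w (0, h))) (at (m w))"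
      by (simp only: at_within_open[OF N(2) N(1)])
    moreover have "((\<lambda>t. G (w, t)) has_derivative (\<lambda>h. h *\<^sub>R X w)) (at (m w))"
      using velocity[OF c, of "cinv c w" "m w"] N(2) X_vel[OF w]
      unfolding G_def flow_map_def has_vector_derivative_def by simp
    ultimately have "(\<lambda>h. DG w (0, h)) = (\<lambda>h. h *\<^sub>R X w)" by (rule has_derivative_unique)
    from fun_cong[OF this, of 1] show ?thesis by simp
  qed
  have m_deriv: "(m has_derivative Dm w) (at w within S)" if w: "w \<in> S" for w
    unfolding has_derivative_within_alt
  proof (intro conjI allI impI)
    interpret DG: bounded_linear "DG w" by (rule has_derivative_bounded_linear[OF DG[OF w]])
    have bl1: "bounded_linear (\<lambda>h. DG w (h, 0))"
      by (rule bounded_linear_compose[OF DG.bounded_linear_axioms bounded_linear_Pair[OF bounded_linear_ident bounded_linear_zero]])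
    show bl: "bounded_linear (Dm w)"
      unfolding Dm_def
      by (intro bounded_linear_mult_const bounded_linear_inner_left_comp bounded_linear_sub bounded_linear_ident bl1)
    obtain C where C: "C > 0" "\<And>h. norm (Dm w h) \<le> norm h * C"
      using bounded_linear.pos_bounded[OF bl] by blast
    fix e :: real assume e: "e > 0"
    let ?k = "inverse (norm (X w))"
    have k: "?k > 0" using X_nz[OF w] by simp
    \<comment> \<open>The first bound makes the error at most half of
      \<open>norm h + \<bar>\<Delta>\<bar>\<close>, so \<Delta> can be absorbed and is at most
      \<open>(2 * C + 1) * norm h\<close>; the second turns the resulting factor
      \<open>2 * C + 2\<close> into \<open>e\<close>.\<close>
    define d where "d = min (1 / (2 * ?k)) (e / (?k * (2 * C + 2)))"
    have d: "d > 0" "d * ?k \<le> 1/2" "d * ?k * (2 * C + 2) \<le> e"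
    proof -
      show "d > 0" using k e C by (simp add: d_def)
      have "d \<le> 1 / (2 * ?k)" by (simp add: d_def)
      then show "d * ?k \<le> 1/2" using k by (simp add: field_simps)
      have "d \<le> e / (?k * (2 * C + 2))" by (simp add: d_def)
      moreover have "?k * (2 * C + 2) > 0" using k C by simp
      ultimately show "d * ?k * (2 * C + 2) \<le> e" by (simp add: pos_le_divide_eq mult.assoc)
    qed
    obtain r where r: "r > 0" "\<And>p. p \<in> Q \<Longrightarrow> norm (p - (w, m w)) < r \<Longrightarrow>
        norm (G p - G (w, m w) - DG w (p - (w, m w))) \<le> d * norm (p - (w, m w))"
      using DG[OF w] d(1) unfolding has_derivative_within_alt by blast
    have "continuous_on S (\<lambda>w. (w, m w))" by (intro continuous_intros m_cont)
    then obtain s where s: "s > 0" "\<And>y. y \<in> S \<Longrightarrow> dist y w < s \<Longrightarrow> dist (y, m y) (w, m w) < r"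
      using w r(1) unfolding continuous_on_iff by blast
    show "\<exists>d>0. \<forall>y\<in>S. norm (y - w) < d \<longrightarrow> norm (m y - m w - Dm w (y - w)) \<le> e * norm (y - w)"
    proof (intro exI[of _ s] conjI ballI impI)
      fix y assume y: "y \<in> S" "norm (y - w) < s"
      define h where "h = y - w"
      define \<Delta> where "\<Delta> = m y - m w"
      define R where "R = h - DG w (h, 0) - \<Delta> *\<^sub>R X w"
      have "DG w (h, \<Delta>) = DG w (h, 0) + \<Delta> *\<^sub>R DG w (0, 1)"
        using DG.add[of "(h, 0)" "(0, \<Delta>)"] DG.scaleR[of \<Delta> "(0, 1)"] by simp
      then have R: "R = G (y, m y) - G (w, m w) - DG w ((y, m y) - (w, m w))"
        using G_eq[OF w] G_eq[OF y(1)] DG_time[OF w] by (simp add: R_def h_def \<Delta>_def)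
      have "norm ((y, m y) - (w, m w)) < r" using s(2)[OF y(1)] y(2) by (simp add: dist_norm)
      then have "norm R \<le> d * norm ((y, m y) - (w, m w))" unfolding R using r(2) in_Q[OF y(1)] by blast
      also have "norm ((y, m y) - (w, m w)) \<le> norm h + \<bar>\<Delta>\<bar>"
        using norm_Pair_le[of h \<Delta>] by (simp add: h_def \<Delta>_def)
      finally have nR: "norm R \<le> d * (norm h + \<bar>\<Delta>\<bar>)" using d(1) by simp
      have "\<Delta> - Dm w h = - (R \<bullet> X w) * inverse (X w \<bullet> X w)"
        using X_nz[OF w] by (simp add: Dm_def R_def inner_diff_left inner_add_left field_simps)
      then have "\<bar>\<Delta> - Dm w h\<bar> = \<bar>R \<bullet> X w\<bar> * (?k * ?k)"
        by (simp add: abs_mult power2_norm_eq_inner[symmetric] power2_eq_square)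
      also have "\<dots> \<le> (norm R * norm (X w)) * (?k * ?k)"
        by (intro mult_right_mono Cauchy_Schwarz_ineq2) simp
      also have "\<dots> = norm R * ?k" using X_nz[OF w] by simp
      also have "\<dots> \<le> d * (norm h + \<bar>\<Delta>\<bar>) * ?k" using nR k by (intro mult_right_mono) auto
      finally have 1: "\<bar>\<Delta> - Dm w h\<bar> \<le> d * ?k * (norm h + \<bar>\<Delta>\<bar>)" by (simp add: algebra_simps)
      also have "\<dots> \<le> 1/2 * (norm h + \<bar>\<Delta>\<bar>)" using d(2) by (intro mult_right_mono) auto
      finally have "\<bar>\<Delta> - Dm w h\<bar> \<le> 1/2 * (norm h + \<bar>\<Delta>\<bar>)" .
      then have "\<bar>\<Delta>\<bar> \<le> norm h + 2 * \<bar>Dm w h\<bar>"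
        using abs_triangle_ineq2[of \<Delta> "Dm w h"] by simp
      then have \<Delta>: "\<bar>\<Delta>\<bar> \<le> norm h + 2 * (norm h * C)" using C(2)[of h] by simp
      have "\<bar>\<Delta> - Dm w h\<bar> \<le> d * ?k * (norm h + (norm h + 2 * (norm h * C)))"
        by (rule order_trans[OF 1]) (use \<Delta> d(1) k in \<open>intro mult_left_mono, auto\<close>)
      also have "\<dots> = d * ?k * (2 * C + 2) * norm h" by (simp add: algebra_simps)
      also have "\<dots> \<le> e * norm h" using d(3) by (intro mult_right_mono) auto
      finally show "norm (m y - m w - Dm w (y - w)) \<le> e * norm (y - w)" by (simp add: h_def \<Delta>_def)
    qed (rule s(1))
  qed
  \<comment> \<open>Bootstrapping: \<open>Dm\<close> depends on \<open>m\<close> only through the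
    point \<open>(w, m w)\<close>, so it is as regular as \<open>m\<close>, which makes
    \<open>m\<close> one order better.\<close>
  have "ck n S m" for n
  proof (induction n)
    case 0
    have "m differentiable at w within S" if "w \<in> S" for w
      using m_deriv[OF that] by (rule differentiableI)
    then show ?case unfolding ck_0 differentiable_on_def by blast
  next
    case (Suc n)
    have X: "ck n S X"
      using smooth_on_openin[OF cimg_openin_cimg[OF c U(1)] field_smooth[OF c]]
      unfolding X_def S_def smooth_on_ck by blast
    have "ck n S (\<lambda>w. (w, m w))"
    proof -
      have "ck n S (\<lambda>w. (w, 0) + (0, m w))"
        by (intro ck_add[OF S] ck_bounded_linear[OF S _ ck_id[OF S]] ck_bounded_linear[OF S _ Suc.IH]
            bounded_linear_Pair bounded_linear_ident bounded_linear_zero)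
      then show ?thesis by simp
    qed
    moreover have "ck n Q (ddir Q (v, 0) G)" for v
      using smooth_on_Suc[THEN iffD1, OF G_smooth] unfolding smooth_on_ck by blast
    moreover have "(\<lambda>w. (w, m w)) ` S \<subseteq> Q" using in_Q by blast
    ultimately have DGv: "ck n S (\<lambda>w. DG w (v, 0))" for v
      unfolding DG_def using ck_compose[OF S, of "\<lambda>w. (w, m w)" Q n "ddir Q (v, 0) G"] by simp
    have "ck n S (\<lambda>w. Dm w v)" for v
    proof -
      have "ck n S (\<lambda>w. v + - DG w (v, 0))"
        by (intro ck_add[OF S] ck_const[OF S] ck_bounded_linear[OF S bounded_linear_minus[OF bounded_linear_ident] DGv])
      then have "ck n S (\<lambda>w. (v + - DG w (v, 0)) \<bullet> X w)"
        by (rule ck_bilinear[OF S bounded_bilinear_inner _ X])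
      moreover have "ck n S (\<lambda>w. inverse (X w \<bullet> X w))"
        by (rule ck_inverse[OF S _ ck_bilinear[OF S bounded_bilinear_inner X X]]) (use X_nz in simp)
      ultimately show ?thesis
        using ck_bilinear[OF S bounded_bilinear_mult] unfolding Dm_def by simp
    qed
    then show ?case using ck_SucI[of S m Dm, OF S m_deriv] by blast
  qed
  then show "smooth_on (cimg c U) (\<mu> \<circ> cinv c)" by (simp add: smooth_on_ck S_def m_def)
qed

section \<open>Shift kernels and their positive generators\<close>

lemma shift_ker_period_fun:
  assumes "open U" "\<mu> \<in> shift_ker A Fl U" shows "period_fun U \<mu>"
  using assms smooth_fun_continuous by (auto simp: shift_ker_def shift_map_def period_fun_def)

lemma positive_generator_period_fun:
  assumes "open U" "positive_generator A Fl U \<theta>" shows "period_fun U \<theta>"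
proof (rule shift_ker_period_fun[OF assms(1)])
  have "\<forall>x\<in>U. \<theta> x = of_int 1 * \<theta> x" by simp
  then have "\<theta> \<in> {\<mu>. \<exists>n::int. \<forall>x\<in>U. \<mu> x = of_int n * \<theta> x}" by blast
  then show "\<theta> \<in> shift_ker A Fl U" using assms(2) unfolding positive_generator_def by simp
qed

lemma shift_ker_iff_period_fun:
  assumes "open U" "U \<inter> Z = {}"
  shows "\<mu> \<in> shift_ker A Fl U \<longleftrightarrow> period_fun U \<mu>"
  using assms shift_ker_period_fun period_fun_smooth
  by (auto simp: shift_ker_def shift_map_def period_fun_def)

text \<open>Evaluation at \<open>x0\<close> embeds the period functions into the multiples of the
  least period \<open>P\<close> of \<open>x0\<close>, injectively by
  \<open>period_fun_vanishes\<close>. The generator is the function with the least positive value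
  there. That value may be a proper multiple of \<open>P\<close>, since \<open>P\<close> need not
  continue to a period function on \<open>U\<close>.\<close>

lemma positive_generator_exists:
  assumes U: "open U" "connected U" "U \<inter> Z = {}" and \<mu>: "period_fun U \<mu>" and x0: "x0 \<in> U" "\<mu> x0 \<noteq> 0"
  shows "\<exists>\<theta>. positive_generator A Fl U \<theta>"
proof -
  have "x0 \<notin> Z" "Fl (x0, \<mu> x0) = x0" using U \<mu> x0 by (auto simp: period_fun_def)
  then obtain P where P: "P > 0" "\<And>s. Fl (x0, s) = x0 \<Longrightarrow> \<exists>n::int. s = of_int n * P"
    using periods_cyclic[of x0 "\<mu> x0"] x0 by blast
  define I where "I = (\<lambda>n::nat. n > 0 \<and> (\<exists>\<nu>. period_fun U \<nu> \<and> \<nu> x0 = of_nat n * P))"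
  have lin: "period_fun U (\<lambda>x. of_int a * \<nu> x)" if "period_fun U \<nu>" for a \<nu>
    using period_fun_lincomb[OF that that, of a 0] by simp
  have "\<exists>n. I n"
  proof -
    obtain n :: int where n: "\<mu> x0 = of_int n * P" using P \<open>Fl (x0, \<mu> x0) = x0\<close> by blast
    then have "n \<noteq> 0" using x0 by auto
    have "of_int (sgn n) * \<mu> x0 = of_nat (nat \<bar>n\<bar>) * P"
      using n by (cases "n \<ge> 0") (auto simp: sgn_if)
    then show ?thesis using \<open>n \<noteq> 0\<close> lin[OF \<mu>, of "sgn n"] unfolding I_def
      by (intro exI[of _ "nat \<bar>n\<bar>"]) auto
  qed
  then obtain N where N: "I N" "\<And>n. n < N \<Longrightarrow> \<not> I n" using exists_least_iff[of I] by blast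
  then obtain \<theta> where \<theta>: "period_fun U \<theta>" "\<theta> x0 = of_nat N * P" and N0: "N > 0" unfolding I_def by blast
  have \<theta>0: "\<theta> x0 > 0" using \<theta>(2) N0 P by simp
  have nz: "\<theta> x \<noteq> 0" if "x \<in> U" for x
    using period_fun_vanishes[OF U(2,3) \<theta>(1) that _ x0(1)] \<theta>0 by auto
  have pos: "\<theta> x > 0" if "x \<in> U" for x
  proof (rule ccontr)
    assume "\<not> \<theta> x > 0"
    moreover have "connected (\<theta> ` U)"
      using \<theta>(1) U(2) connected_continuous_image by (auto simp: period_fun_def)
    ultimately have "0 \<in> \<theta> ` U"
      using connectedD_interval[of "\<theta> ` U" "\<theta> x" "\<theta> x0" 0] that x0 \<theta>0 by auto
    then show False using nz by auto
  qed
  have multiple: "\<exists>n::int. \<forall>x\<in>U. \<nu> x = of_int n * \<theta> x" if \<nu>: "period_fun U \<nu>" for \<nu>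
  proof -
    have "Fl (x0, \<nu> x0) = x0" using \<nu> x0 by (simp add: period_fun_def)
    then obtain m :: int where m: "\<nu> x0 = of_int m * P" using P by blast
    define k where "k = m div int N"
    define \<rho> where "\<rho> = (\<lambda>x. of_int 1 * \<nu> x + of_int (- k) * \<theta> x)"
    have \<rho>: "period_fun U \<rho>" unfolding \<rho>_def by (rule period_fun_lincomb[OF \<nu> \<theta>(1)])
    have r: "0 \<le> m mod int N" "m mod int N < int N" using N0 by auto
    have "m mod int N = m - k * int N" by (simp add: k_def minus_div_mult_eq_mod)
    then have "real_of_int (m mod int N) = of_int m - of_int k * of_nat N" by simp
    then have \<rho>0: "\<rho> x0 = of_nat (nat (m mod int N)) * P"
      using r by (simp add: \<rho>_def m \<theta>(2) left_diff_distrib mult.assoc)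
    have "\<not> I (nat (m mod int N))" using N(2) r by (simp add: nat_less_iff)
    then have "nat (m mod int N) = 0" using \<rho> \<rho>0 unfolding I_def by (metis neq0_conv)
    then have "\<rho> x0 = 0" using \<rho>0 by simp
    then have "\<rho> x = 0" if "x \<in> U" for x using period_fun_vanishes[OF U(2,3) \<rho> x0(1)] that by blast
    then show ?thesis by (intro exI[of _ k]) (auto simp: \<rho>_def)
  qed
  have "shift_ker A Fl U = {\<nu>. \<exists>n::int. \<forall>x\<in>U. \<nu> x = of_int n * \<theta> x}"
  proof (intro set_eqI iffI)
    fix \<nu> assume "\<nu> \<in> shift_ker A Fl U"
    then show "\<nu> \<in> {\<nu>. \<exists>n::int. \<forall>x\<in>U. \<nu> x = of_int n * \<theta> x}"
      using multiple shift_ker_iff_period_fun[OF U(1,3)] by blast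
  next
    fix \<nu> assume "\<nu> \<in> {\<nu>. \<exists>n::int. \<forall>x\<in>U. \<nu> x = of_int n * \<theta> x}"
    then obtain n :: int where n: "\<And>x. x \<in> U \<Longrightarrow> \<nu> x = of_int n * \<theta> x" by blast
    have "continuous_on U \<nu> \<longleftrightarrow> continuous_on U (\<lambda>x. of_int n * \<theta> x)"
      by (rule continuous_on_cong) (use n in auto)
    then have "period_fun U \<nu>" using lin[OF \<theta>(1), of n] n by (simp add: period_fun_def)
    then show "\<nu> \<in> shift_ker A Fl U" using shift_ker_iff_period_fun[OF U(1,3)] by blast
  qed
  then show ?thesis
    using period_fun_smooth[OF U(1,3) \<theta>(1)] pos unfolding positive_generator_def by blast
qed

end

section \<open>Shrinking orbits\<close>

text \<open>A point \<open>w\<close> of \<open>U\<close> near 0 missed by \<open>a\<close> would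
  yield, by Brouwer, a point \<open>x\<close> of the sphere at which \<open>a x - w\<close> is a
  negative multiple of \<open>x\<close>. Off \<open>U\<close> this makes \<open>w\<close> longer
  than \<delta>; in \<open>U\<close> it makes the \<open>e\<close>-component of \<open>w\<close> at
  least \<epsilon>. So \<open>a\<close> covers \<open>U\<close> near 0, and only points of
  \<open>U\<close> can do so because \<open>a\<close> is the identity elsewhere; but their image is
  null.\<close>

lemma newman_core:
  fixes a :: "'a::euclidean_space \<Rightarrow> 'a"
  assumes \<delta>: "\<delta> > 0" and \<epsilon>: "\<epsilon> > 0" and e: "norm e = 1"
    and cont: "continuous_on (cball 0 \<delta>) a"
    and id: "\<And>v. v \<in> cball 0 \<delta> \<Longrightarrow> v \<notin> U \<Longrightarrow> a v = v"
    and sph: "\<And>v. v \<in> U \<Longrightarrow> norm v = \<delta> \<Longrightarrow> v \<bullet> e \<ge> 0 \<and> a v \<bullet> e \<ge> \<epsilon>"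
    and U: "open U" "0 \<in> closure U"
    and neg: "negligible (a ` (U \<inter> cball 0 \<delta>))"
  shows False
proof -
  let ?r = "min \<delta> \<epsilon>"
  have "U \<inter> ball 0 ?r \<subseteq> a ` (U \<inter> cball 0 \<delta>)"
  proof
    fix w assume w: "w \<in> U \<inter> ball 0 ?r"
    have "\<exists>x\<in>cball 0 \<delta>. a x = w"
    proof (rule ccontr)
      assume "\<not> ?thesis"
      then have nz: "\<And>x. x \<in> cball 0 \<delta> \<Longrightarrow> a x - w \<noteq> 0" by auto
      \<comment> \<open>The antipode of the radial projection of \<open>a x\<close> from
        \<open>w\<close>. It maps into the sphere, so its fixed points lie there.\<close>
      define h where "h = (\<lambda>x. - (\<delta> / norm (a x - w)) *\<^sub>R (a x - w))"
      have "continuous_on (cball 0 \<delta>) h"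
        unfolding h_def using nz by (intro continuous_intros cont) auto
      moreover have nh: "norm (h x) = \<delta>" if "x \<in> cball 0 \<delta>" for x
        using nz[OF that] \<delta> by (simp add: h_def)
      then have "h \<in> cball 0 \<delta> \<rightarrow> cball 0 \<delta>" by auto
      ultimately obtain x where x: "x \<in> cball 0 \<delta>" "h x = x"
        using brouwer[OF compact_cball convex_cball, of 0 \<delta> h] \<delta> by auto
      then have nx: "norm x = \<delta>" using nh by metis
      define k where "k = norm (a x - w) / \<delta>"
      have k: "k > 0" using nz[OF x(1)] \<delta> by (simp add: k_def)
      have eq: "a x - w = - k *\<^sub>R x"
      proof -
        have "- k *\<^sub>R x = - k *\<^sub>R h x" using x by simp
        also have "\<dots> = a x - w" using nz[OF x(1)] \<delta> by (simp add: h_def k_def)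
        finally show ?thesis by simp
      qed
      show False
      proof (cases "x \<in> U")
        case True
        have "a x \<bullet> e - w \<bullet> e = - k * (x \<bullet> e)" using arg_cong[OF eq, of "\<lambda>u. u \<bullet> e"] by (simp add: inner_diff_left)
        also have "\<dots> \<le> 0" using sph[OF True nx] k by simp
        finally have "w \<bullet> e \<ge> \<epsilon>" using sph[OF True nx] by linarith
        moreover have "w \<bullet> e \<le> norm w" using norm_cauchy_schwarz[of w e] e by simp
        ultimately show False using w by simp
      next
        case False
        then have "w = (1 + k) *\<^sub>R x" using id[OF x(1)] eq by (simp add: algebra_simps)
        then have "norm w = (1 + k) * \<delta>" using k nx by simp
        moreover have "(1 + k) * \<delta> > 1 * \<delta>" using k \<delta> by (intro mult_strict_right_mono) auto
        ultimately have "norm w > \<delta>" by simp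
        then show False using w by simp
      qed
    qed
    then obtain x where x: "x \<in> cball 0 \<delta>" "a x = w" by blast
    have "x \<in> U"
    proof (rule ccontr)
      assume "x \<notin> U"
      then have "x = w" using id[OF x(1)] x(2) by simp
      with w \<open>x \<notin> U\<close> show False by blast
    qed
    with x show "w \<in> a ` (U \<inter> cball 0 \<delta>)" by blast
  qed
  then have "negligible (U \<inter> ball 0 ?r)" using neg negligible_subset by blast
  moreover have "open (U \<inter> ball 0 ?r)" using U by blast
  moreover have "U \<inter> ball 0 ?r \<noteq> {}"
    using U(2) \<delta> \<epsilon> unfolding closure_approachable by (metis IntI dist_commute emptyE mem_ball min_less_iff_conj)
  ultimately show False using open_not_negligible by blast
qed

text \<open>A polynomial change of coordinates that turns the complement of a ball into a set lying
  strictly on one side of the tangent hyperplane at the contact point.\<close>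
definition shear :: "real \<Rightarrow> 'a::euclidean_space \<Rightarrow> 'a \<Rightarrow> 'a" where
  "shear C e x = x + (C * (x \<bullet> x - (x \<bullet> e)\<^sup>2)) *\<^sub>R e"

text \<open>The quadratic term is the squared distance from the axis through \<open>e\<close>, which
  translation along \<open>e\<close> does not change.\<close>

lemma shear_shear:
  assumes "norm e = 1"
  shows "shear (- C) e (shear C e x) = x"
proof -
  define k where "k = C * (x \<bullet> x - (x \<bullet> e)\<^sup>2)"
  have e: "e \<bullet> e = 1" using assms by (simp add: norm_eq_1)
  have "(x + k *\<^sub>R e) \<bullet> (x + k *\<^sub>R e) - ((x + k *\<^sub>R e) \<bullet> e)\<^sup>2 = x \<bullet> x - (x \<bullet> e)\<^sup>2"
    using e by (simp add: inner_add_left inner_add_right inner_commute power2_eq_square algebra_simps)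
  then show ?thesis unfolding shear_def k_def[symmetric] by (simp add: k_def)
qed

lemma continuous_on_shear: "continuous_on S (shear C e)"
  unfolding shear_def by (intro continuous_intros)

lemma shear_0 [simp]: "shear C e 0 = 0"
  by (simp add: shear_def)

lemma shear_Lipschitz:
  assumes "norm e = 1" "norm x \<le> r" "norm y \<le> r"
  shows "norm (shear C e x - shear C e y) \<le> (1 + 4 * \<bar>C\<bar> * r) * norm (x - y)"
proof -
  have 1: "\<bar>x \<bullet> x - y \<bullet> y\<bar> \<le> norm (x - y) * (2 * r)"
  proof -
    have "x \<bullet> x - y \<bullet> y = (x - y) \<bullet> (x + y)" by (simp add: inner_diff_left inner_diff_right inner_add_right inner_commute)
    also have "\<bar>\<dots>\<bar> \<le> norm (x - y) * norm (x + y)" by (rule Cauchy_Schwarz_ineq2)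
    also have "\<dots> \<le> norm (x - y) * (2 * r)"
      using norm_triangle_ineq[of x y] assms by (intro mult_left_mono) auto
    finally show ?thesis by simp
  qed
  have 2: "\<bar>(x \<bullet> e)\<^sup>2 - (y \<bullet> e)\<^sup>2\<bar> \<le> norm (x - y) * (2 * r)"
  proof -
    have b: "\<bar>u \<bullet> e\<bar> \<le> norm u" for u using Cauchy_Schwarz_ineq2[of u e] assms by simp
    have "(x \<bullet> e)\<^sup>2 - (y \<bullet> e)\<^sup>2 = ((x - y) \<bullet> e) * ((x + y) \<bullet> e)"
      by (simp add: inner_diff_left inner_add_left power2_eq_square algebra_simps)
    also have "\<bar>\<dots>\<bar> \<le> norm (x - y) * norm (x + y)" unfolding abs_mult by (intro mult_mono b) auto
    also have "\<dots> \<le> norm (x - y) * (2 * r)"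
      using norm_triangle_ineq[of x y] assms by (intro mult_left_mono) auto
    finally show ?thesis by simp
  qed
  have "shear C e x - shear C e y = (x - y) + (C * ((x \<bullet> x - y \<bullet> y) - ((x \<bullet> e)\<^sup>2 - (y \<bullet> e)\<^sup>2))) *\<^sub>R e"
    by (simp add: shear_def algebra_simps)
  also have "norm \<dots> \<le> norm (x - y) + \<bar>C\<bar> * \<bar>(x \<bullet> x - y \<bullet> y) - ((x \<bullet> e)\<^sup>2 - (y \<bullet> e)\<^sup>2)\<bar>"
    by (rule norm_triangle_le) (simp add: assms abs_mult)
  also have "\<dots> \<le> norm (x - y) + \<bar>C\<bar> * (norm (x - y) * (2 * r) + norm (x - y) * (2 * r))"
    by (intro add_left_mono mult_left_mono order_trans[OF abs_triangle_ineq4] add_mono 1 2) auto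
  finally show ?thesis by (simp add: algebra_simps)
qed

text \<open>Being outside the ball about \<open>- R *\<^sub>R e\<close>, a point of height
  \<open>s < 0\<close> satisfies \<open>n \<ge> - 2 * R * s - s\<^sup>2\<close>, and this is at
  least \<open>- s * R\<close> because \<open>\<bar>s\<bar> < R\<close>. The coefficient
  \<open>1 / R\<close> would just lift it to height 0; \<open>2 / R\<close> gives
  strictness.\<close>

lemma shear_pos:
  assumes e: "norm e = 1" and R: "R > 0" and x: "x \<noteq> 0" "norm x < R" "norm (x + R *\<^sub>R e) \<ge> R"
  shows "shear (2 / R) e x \<bullet> e > 0"
proof -
  have ee: "e \<bullet> e = 1" using e by (simp add: norm_eq_1)
  define s where "s = x \<bullet> e"
  define n where "n = x \<bullet> x - s\<^sup>2"
  have s: "\<bar>s\<bar> \<le> norm x" using Cauchy_Schwarz_ineq2[of x e] e by (simp add: s_def)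
  then have n0: "n \<ge> 0" using power_mono[of "\<bar>s\<bar>" "norm x" 2] by (simp add: n_def power2_norm_eq_inner)
  have "R\<^sup>2 \<le> (norm (x + R *\<^sub>R e))\<^sup>2" using x R by (intro power_mono) auto
  also have "\<dots> = x \<bullet> x + 2 * R * s + R\<^sup>2"
    unfolding power2_norm_eq_inner
    using ee by (simp add: inner_add_left inner_add_right inner_commute s_def power2_eq_square algebra_simps)
  finally have c: "n + s\<^sup>2 + 2 * R * s \<ge> 0" by (simp add: n_def)
  have eq: "shear (2 / R) e x \<bullet> e = s + 2 / R * n"
    using ee by (simp add: shear_def inner_add_left s_def n_def)
  show ?thesis
  proof (cases "s < 0")
    case True
    have "(- s) * (- s) \<le> (- s) * R" using True s x by (intro mult_left_mono) auto
    then have "s\<^sup>2 \<le> - s * R" by (simp add: power2_eq_square)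
    then have "n \<ge> - s * R" using c by (simp add: algebra_simps)
    then have "2 * n > - s * R" using True R mult_neg_pos[of s R] by simp
    then have "2 / R * n > - s" using R by (simp add: field_simps)
    then show ?thesis using eq by simp
  next
    case False
    show ?thesis
    proof (cases "s = 0")
      case True
      then have "n > 0" using x by (simp add: n_def)
      then show ?thesis using eq True R by simp
    next
      case f: False
      have "2 / R * n \<ge> 0" using n0 R by simp
      then show ?thesis using eq f False by simp
    qed
  qed
qed

section \<open>Passing from the half-space to its interior\<close>

lemma half_space_openin_interior:
  fixes S :: "'e::euclidean_space set"
  assumes "openin (top_of_set half_space) S"
  shows "open (S \<inter> {p. p \<bullet> normal_dir > 0})"
proof -
  obtain O' where O': "open O'" "S = half_space \<inter> O'" using assms openin_open by blast
  have "S \<inter> {p. p \<bullet> normal_dir > 0} = O' \<inter> {p. p \<bullet> normal_dir > 0}"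
    using O' by (auto simp: half_space_def)
  moreover have "open {p::'e. p \<bullet> normal_dir > 0}"
    by (intro open_Collect_less continuous_intros)
  ultimately show ?thesis using O' by (metis open_Int)
qed

lemma half_space_openin_nonempty_interior:
  fixes S :: "'e::euclidean_space set"
  assumes "openin (top_of_set half_space) S" "S \<noteq> {}"
  shows "S \<inter> {p. p \<bullet> normal_dir > 0} \<noteq> {}"
proof -
  obtain O' where O': "open O'" "S = half_space \<inter> O'" using assms openin_open by blast
  obtain p where p: "p \<in> O'" "p \<in> half_space" using assms O' by blast
  obtain r where r: "r > 0" "ball p r \<subseteq> O'" using O'(1) p(1) by (rule openE)
  define q where "q = p + (r / 2) *\<^sub>R normal_dir"
  have nd: "norm (normal_dir::'e) = 1" "(normal_dir::'e) \<bullet> normal_dir = 1"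
    using normal_dir_in_Basis[where 'e='e] by (auto simp: inner_Basis)
  have "q \<in> ball p r" using r nd by (simp add: q_def dist_norm)
  moreover have "q \<bullet> normal_dir > 0" using p r nd by (simp add: q_def half_space_def inner_add_left)
  ultimately have "q \<in> O'" "q \<in> half_space" "q \<in> {p. p \<bullet> normal_dir > 0}"
    using r by (auto simp: half_space_def)
  then show ?thesis using O' by blast
qed

context flow_manifold begin

lemma orbit_reduce:
  assumes "Fl (x, p) = x" "p \<noteq> 0"
  shows "\<exists>s\<in>closed_segment 0 p. Fl (x, t) = Fl (x, s)"
proof -
  define s where "s = t - of_int \<lfloor>t / p\<rfloor> * p"
  have "Fl (x, t) = Fl (Fl (x, of_int \<lfloor>t / p\<rfloor> * p), s)" by (simp add: s_def)
  also have "\<dots> = Fl (x, s)" using period_int[OF assms(1)] by simp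
  finally have "Fl (x, t) = Fl (x, s)" .
  moreover have "s = frac (t / p) * p" using assms(2) by (simp add: s_def frac_def algebra_simps)
  then have "s \<in> closed_segment 0 p"
    using frac_ge_0[of "t / p"] frac_lt_1[of "t / p"] by (auto simp: closed_segment_def intro!: exI[of _ "frac (t / p)"])
  ultimately show ?thesis by blast
qed

text \<open>Equicontinuity of the flow at \<open>y\<close>, for all times at once. At a zero
  \<open>y\<close> bounded times are harmless by \<open>bounded_time_tube\<close>; the content
  concerns long orbits. The point \<open>y\<close> is typically outside \<open>U\<close>, on its
  boundary.\<close>

definition orbits_shrink :: "'m set \<Rightarrow> 'm \<Rightarrow> bool" where
  "orbits_shrink U y \<longleftrightarrow>
     (\<forall>B. open B \<and> y \<in> B \<longrightarrow> (\<exists>B'. open B' \<and> y \<in> B' \<and> (\<forall>x\<in>U \<inter> B'. \<forall>t. Fl (x, t) \<in> B)))"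

lemma orbits_shrinkD:
  assumes "orbits_shrink U y" "open B" "y \<in> B"
  obtains B' where "open B'" "y \<in> B'" "\<And>x t. x \<in> U \<Longrightarrow> x \<in> B' \<Longrightarrow> Fl (x, t) \<in> B"
  using assms unfolding orbits_shrink_def by (metis IntI)

lemma orbits_shrink_subset:
  assumes "orbits_shrink U y" "U' \<subseteq> U"
  shows "orbits_shrink U' y"
  unfolding orbits_shrink_def
proof (intro allI impI)
  fix B assume "open B \<and> y \<in> B"
  then obtain B' where "open B'" "y \<in> B'" "\<And>x t. x \<in> U \<Longrightarrow> x \<in> B' \<Longrightarrow> Fl (x, t) \<in> B"
    using orbits_shrinkD[OF assms(1)] by metis
  with assms(2) show "\<exists>B'. open B' \<and> y \<in> B' \<and> (\<forall>x\<in>U' \<inter> B'. \<forall>t. Fl (x, t) \<in> B)"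
    by (intro exI[of _ B']) (simp add: subset_eq)
qed

lemma bounded_time_tube:
  assumes "y \<in> Z" "open B" "y \<in> B"
  shows "\<exists>B'. open B' \<and> y \<in> B' \<and> (\<forall>x\<in>B'. \<forall>t. \<bar>t\<bar> \<le> M \<longrightarrow> Fl (x, t) \<in> B)"
proof -
  have "{y} \<times> {-M..M} \<subseteq> Fl -` B" using zero_fixed[OF assms(1)] assms(3) by auto
  then have "\<exists>X. y \<in> X \<and> open X \<and> X \<times> {-M..M} \<subseteq> Fl -` B"
    by (rule Elementary_Topology.tube_lemma[OF compact_Icc open_Fl_vimage[OF assms(2)]])
  then obtain X where X: "y \<in> X" "open X" "X \<times> {-M..M} \<subseteq> Fl -` B"
    by blast
  have "Fl (x, t) \<in> B" if "x \<in> X" "\<bar>t\<bar> \<le> M" for x t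
  proof -
    have "(x, t) \<in> X \<times> {-M..M}" using that by (simp add: abs_le_iff)
    with X(3) show ?thesis by blast
  qed
  with X show ?thesis by (intro exI[of _ X]) simp
qed

text \<open>Since \<theta> is continuous at the zero \<open>y\<close>, it bounds the periods nearby,
  and a bounded time interval already covers the whole orbit.\<close>

lemma orbits_shrink_periodic:
  assumes "open W" "y \<in> W" "y \<in> Z" "period_fun W \<theta>" "\<And>x. x \<in> W \<Longrightarrow> \<theta> x \<noteq> 0"
  shows "orbits_shrink W y"
  unfolding orbits_shrink_def
proof (intro allI impI)
  fix B assume B: "open B \<and> y \<in> B"
  define M where "M = \<bar>\<theta> y\<bar> + 1"
  obtain B1 where B1: "open B1" "y \<in> B1" "\<forall>x\<in>B1. \<forall>t. \<bar>t\<bar> \<le> M \<longrightarrow> Fl (x, t) \<in> B"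
    using bounded_time_tube[OF assms(3)] B by blast
  let ?B2 = "W \<inter> (\<lambda>x. \<bar>\<theta> x\<bar>) -` {..<M}"
  have "continuous_on W (\<lambda>x. \<bar>\<theta> x\<bar>)" using assms(4) by (auto simp: period_fun_def intro!: continuous_intros)
  then have "open ?B2" by (rule continuous_open_preimage[OF _ assms(1)]) simp
  moreover have "y \<in> ?B2" using assms(2) by (simp add: M_def)
  moreover have "Fl (x, t) \<in> B" if x: "x \<in> W \<inter> (B1 \<inter> ?B2)" for x t
  proof -
    have "Fl (x, \<theta> x) = x" "\<theta> x \<noteq> 0" using x assms by (auto simp: period_fun_def)
    then obtain s where s: "s \<in> closed_segment 0 (\<theta> x)" "Fl (x, t) = Fl (x, s)" using orbit_reduce by blast
    have "\<bar>s\<bar> \<le> \<bar>\<theta> x\<bar>" using s(1) by (auto simp: closed_segment_eq_real_ivl split: if_splits)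
    then have "\<bar>s\<bar> \<le> M" using x by simp
    then show ?thesis using B1 x s by auto
  qed
  ultimately show "\<exists>B'. open B' \<and> y \<in> B' \<and> (\<forall>x\<in>W \<inter> B'. \<forall>t. Fl (x, t) \<in> B)"
    using B1 by (intro exI[of _ "B1 \<inter> ?B2"]) auto
qed

text \<open>Constant on orbits, and defined without choosing a period. It stands in for the average
  over the group in arguments of Newman's kind.\<close>

definition orbit_sup :: "('m, 'e) chart \<Rightarrow> ('e \<Rightarrow> real) \<Rightarrow> 'e \<Rightarrow> real" where
  "orbit_sup c f u = (SUP t. f (cmap c (Fl (cinv c u, t))))"

text \<open>Near \<open>u0\<close> every orbit is traversed within times bounded by
  \<open>N\<close>, and on the compact set of these times and initial points the flow is Lipschitz
  in the initial point.\<close>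

lemma orbit_sup_Lipschitz:
  assumes c: "c \<in> A" and O': "open O'" "O' \<subseteq> cmap c ` cdom c"
    and orb: "\<And>u t. u \<in> O' \<Longrightarrow> Fl (cinv c u, t) \<in> cdom c"
    and inP: "\<And>u t. u \<in> O' \<Longrightarrow> cmap c (Fl (cinv c u, t)) \<in> P"
    and f: "\<And>p p'. p \<in> P \<Longrightarrow> p' \<in> P \<Longrightarrow> \<bar>f p - f p'\<bar> \<le> K * norm (p - p')" "K \<ge> 0"
    and bdd: "\<And>p. p \<in> P \<Longrightarrow> f p \<le> M"
    and m: "continuous_on O' m" "\<And>u. u \<in> O' \<Longrightarrow> Fl (cinv c u, m u) = cinv c u" "\<And>u. u \<in> O' \<Longrightarrow> m u \<noteq> 0"
    and u0: "u0 \<in> O'"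
  shows "\<exists>\<rho>>0. \<exists>L. ball u0 \<rho> \<subseteq> O' \<and>
    (\<forall>u\<in>ball u0 \<rho>. \<forall>u'\<in>ball u0 \<rho>. \<bar>orbit_sup c f u - orbit_sup c f u'\<bar> \<le> L * norm (u - u'))"
proof -
  define N where "N = \<bar>m u0\<bar> + 1"
  have "open (O' \<inter> (\<lambda>u. \<bar>m u\<bar>) -` {..<N})"
    by (rule continuous_open_preimage[OF _ O'(1)]) (auto intro!: continuous_intros m(1))
  moreover have "u0 \<in> O' \<inter> (\<lambda>u. \<bar>m u\<bar>) -` {..<N}" using u0 by (simp add: N_def)
  ultimately obtain \<rho> where \<rho>: "\<rho> > 0" "cball u0 \<rho> \<subseteq> O' \<inter> (\<lambda>u. \<bar>m u\<bar>) -` {..<N}"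
    using open_contains_cball by blast
  have \<rho>O: "cball u0 \<rho> \<subseteq> O'" and \<rho>N: "\<And>u. u \<in> cball u0 \<rho> \<Longrightarrow> \<bar>m u\<bar> < N" using \<rho>(2) by auto
  define Q where "Q = O' \<times> (UNIV :: real set)"
  define G where "G = flow_map c c"
  have Q: "open Q" "Q \<subseteq> flow_dom c c"
    using O' orb by (auto simp: Q_def flow_dom_def intro!: open_Times)
  have "openin (top_of_set (flow_dom c c)) Q"
    using open_subset[OF Q(2) Q(1)] .
  then have G: "smooth_on Q G"
    unfolding G_def using smooth_on_openin flow_map_smooth[OF c c] by blast
  have "\<exists>C\<ge>0. \<forall>p\<in>cball u0 \<rho> \<times> {-N..N}. norm (ddir Q (b, 0) G p) \<le> C" for b :: 'e
  proof -
    have "compact ((ddir Q (b, 0) G) ` (cball u0 \<rho> \<times> {-N..N}))"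
    proof (rule compact_continuous_image)
      show "continuous_on (cball u0 \<rho> \<times> {-N..N}) (ddir Q (b, 0) G)"
        by (rule continuous_on_subset[OF smooth_on_continuous_ddir[OF G]]) (use \<rho>O in \<open>auto simp: Q_def\<close>)
    qed (intro compact_Times compact_cball compact_Icc)
    then have "bounded ((ddir Q (b, 0) G) ` (cball u0 \<rho> \<times> {-N..N}))" by (rule compact_imp_bounded)
    then obtain C where C: "C > 0" "\<forall>q\<in>(ddir Q (b, 0) G) ` (cball u0 \<rho> \<times> {-N..N}). norm q \<le> C"
      unfolding bounded_pos by blast
    then show ?thesis by (intro exI[of _ C]) auto
  qed
  then obtain C where C: "\<And>b. C b \<ge> 0" "\<And>b p. p \<in> cball u0 \<rho> \<times> {-N..N} \<Longrightarrow> norm (ddir Q (b, 0) G p) \<le> C b"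
    by metis
  define LG where "LG = (\<Sum>b\<in>(Basis::'e set). C b)"
  have G_Lip: "norm (G (u, t) - G (u', t)) \<le> LG * norm (u - u')"
    if u: "u \<in> ball u0 \<rho>" "u' \<in> ball u0 \<rho>" and t: "t \<in> {-N..N}" for u u' t
  proof (rule differentiable_bound[OF convex_ball _ _ u])
    fix w assume w: "w \<in> ball u0 \<rho>"
    then have wQ: "(w, t) \<in> Q" using \<rho>O by (auto simp: Q_def)
    let ?D = "frechet_derivative G (at (w, t) within Q)"
    have D: "(G has_derivative ?D) (at (w, t))"
      using smooth_on_has_derivative[OF G wQ] at_within_open[OF wQ Q(1)] by simp
    have 1: "((\<lambda>w. (w, t)) has_derivative (\<lambda>h. (h, 0))) (at w within ball u0 \<rho>)"
      by (auto intro!: derivative_eq_intros)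
    show "((\<lambda>w. G (w, t)) has_derivative (\<lambda>h. ?D (h, 0))) (at w within ball u0 \<rho>)"
      by (rule has_derivative_compose[OF 1 D])
    interpret D: bounded_linear ?D by (rule has_derivative_bounded_linear[OF D])
    show "onorm (\<lambda>h. ?D (h, 0)) \<le> LG"
    proof (rule onorm_le)
      fix h :: 'e
      have "(h, 0::real) = (\<Sum>b\<in>Basis. (h \<bullet> b) *\<^sub>R (b, 0))"
        by (simp add: sum_prod euclidean_representation)
      then have "?D (h, 0) = (\<Sum>b\<in>Basis. (h \<bullet> b) *\<^sub>R ?D (b, 0))"
        by (simp add: D.sum D.scaleR del: scaleR_Pair)
      also have "norm \<dots> \<le> (\<Sum>b\<in>Basis. norm h * C b)"
      proof (rule sum_norm_le)
        fix b :: 'e assume b: "b \<in> Basis"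
        have "(w, t) \<in> cball u0 \<rho> \<times> {-N..N}" using w t by auto
        then have "norm (?D (b, 0)) \<le> C b" by (rule C(2))
        then show "norm ((h \<bullet> b) *\<^sub>R ?D (b, 0)) \<le> norm h * C b"
          using Basis_le_norm[OF b, of h] by (auto intro!: mult_mono)
      qed
      finally show "norm (?D (h, 0)) \<le> LG * norm h"
        by (simp add: LG_def sum_distrib_left mult.commute)
    qed
  qed
  \<comment> \<open>Both orbits are compared at the same time \<open>s\<close>. It runs through a
    period of \<open>u\<close> only, but the supremum for \<open>u'\<close> is over all times, so
    this is enough.\<close>
  have one_side: "orbit_sup c f u \<le> orbit_sup c f u' + K * LG * norm (u - u')"
    if u: "u \<in> ball u0 \<rho>" "u' \<in> ball u0 \<rho>" for u u'
    unfolding orbit_sup_def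
  proof (rule cSUP_least)
    fix t :: real
    have uO: "u \<in> O'" "u' \<in> O'" using u \<rho>O by auto
    obtain s where s: "s \<in> closed_segment 0 (m u)" "Fl (cinv c u, t) = Fl (cinv c u, s)"
      using orbit_reduce m(2,3) uO by metis
    have "\<bar>s\<bar> \<le> \<bar>m u\<bar>" using s(1) by (auto simp: closed_segment_eq_real_ivl split: if_splits)
    then have "s \<in> {-N..N}" using \<rho>N[of u] u by auto
    have "f (cmap c (Fl (cinv c u, t))) = f (G (u, s))" by (simp add: s(2) G_def flow_map_def)
    also have "\<dots> \<le> f (G (u', s)) + K * norm (G (u, s) - G (u', s))"
      using f(1)[of "G (u, s)" "G (u', s)"] inP[OF uO(1), of s] inP[OF uO(2), of s]
      by (simp add: G_def flow_map_def abs_le_iff)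
    also have "\<dots> \<le> f (G (u', s)) + K * (LG * norm (u - u'))"
      using G_Lip[OF u \<open>s \<in> {-N..N}\<close>] f(2) by (intro add_left_mono mult_left_mono) auto
    also have "f (G (u', s)) \<le> (SUP t. f (cmap c (Fl (cinv c u', t))))"
      unfolding G_def flow_map_def prod.case
      by (rule cSUP_upper) (use bdd inP[OF uO(2)] in \<open>auto intro!: bdd_aboveI[of _ M]\<close>)
    finally show "f (cmap c (Fl (cinv c u, t))) \<le> (SUP t. f (cmap c (Fl (cinv c u', t)))) + K * LG * norm (u - u')"
      by (simp add: mult.assoc)
  qed simp
  have "\<bar>orbit_sup c f u - orbit_sup c f u'\<bar> \<le> K * LG * norm (u - u')"
    if "u \<in> ball u0 \<rho>" "u' \<in> ball u0 \<rho>" for u u'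
    using one_side[OF that] one_side[OF that(2,1)] by (simp add: abs_le_iff norm_minus_commute)
  then show ?thesis using \<rho>O ball_subset_cball \<rho>(1) by (metis (no_types, lifting) subset_trans)
qed

lemma orbit_sup_Fl:
  assumes "c \<in> A" "Fl (cinv c u, t) \<in> cdom c"
  shows "orbit_sup c f (cmap c (Fl (cinv c u, t))) = orbit_sup c f u"
proof -
  have "range (\<lambda>s. f (cmap c (Fl (cinv c u, t + s)))) = range (\<lambda>s. f (cmap c (Fl (cinv c u, s))))"
  proof (intro set_eqI iffI)
    fix r assume "r \<in> range (\<lambda>s. f (cmap c (Fl (cinv c u, s))))"
    then obtain s where "r = f (cmap c (Fl (cinv c u, s)))" by blast
    then have "r = f (cmap c (Fl (cinv c u, t + (s - t))))" by simp
    then show "r \<in> range (\<lambda>s. f (cmap c (Fl (cinv c u, t + s))))" by blast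
  qed blast
  then show ?thesis unfolding orbit_sup_def using assms by simp
qed

text \<open>Locally the image is that of a hyperplane transversal to the orbits.\<close>
lemma negligible_orbit_image:
  fixes g :: "'e \<Rightarrow> 'e"
  assumes c: "c \<in> A" and O': "open O'" "O' \<subseteq> cmap c ` cdom c"
    and nz: "\<And>u. u \<in> O' \<Longrightarrow> cinv c u \<notin> Z"
    and inv: "\<And>u t. u \<in> O' \<Longrightarrow> Fl (cinv c u, t) \<in> cdom c \<Longrightarrow> cmap c (Fl (cinv c u, t)) \<in> O' \<Longrightarrow>
                g (cmap c (Fl (cinv c u, t))) = g u"
    and lip: "\<And>u0. u0 \<in> O' \<Longrightarrow> \<exists>\<rho>>0. \<exists>L. ball u0 \<rho> \<subseteq> O' \<and>
                (\<forall>u\<in>ball u0 \<rho>. \<forall>u'\<in>ball u0 \<rho>. norm (g u - g u') \<le> L * norm (u - u'))"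
  shows "negligible (g ` O')"
proof -
  have loc: "\<exists>S. open S \<and> u0 \<in> S \<and> negligible (g ` (S \<inter> O'))" if u0: "u0 \<in> O'" for u0
  proof -
    define x0 where "x0 = cinv c u0"
    have x0: "x0 \<in> cdom c" "cmap c x0 = u0" "x0 \<notin> Z" using u0 O'(2) c nz by (auto simp: x0_def)
    define X where "X = F c x0"
    have X: "X \<noteq> 0" using x0 zeros_iff[OF c x0(1)] by (simp add: X_def)
    define \<kappa> where "\<kappa> = (norm X)\<^sup>2 / 2"
    have \<kappa>: "\<kappa> > 0" using X by (simp add: \<kappa>_def)
    define B where "B = {x \<in> cdom c. cmap c x \<in> O'}"
    have B: "open B" "x0 \<in> B" using open_chart_preimage[OF c O'(1)] x0 u0 by (auto simp: B_def)
    obtain N \<epsilon> where N: "open N" "x0 \<in> N" and \<epsilon>: "\<epsilon> > 0" and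
      box: "\<And>x s. x \<in> N \<Longrightarrow> \<bar>s\<bar> < \<epsilon> \<Longrightarrow> Fl (x, s) \<in> cdom c \<inter> B \<and> F c (Fl (x, s)) \<bullet> X > \<kappa>"
      using flow_box[OF c x0(1,3) B] unfolding X_def \<kappa>_def by blast
    define H where "H = O' \<inter> {u. X \<bullet> u = X \<bullet> u0}"
    have "negligible {u. X \<bullet> u = X \<bullet> u0}" using X by (intro negligible_hyperplane) auto
    then have "negligible H" unfolding H_def by (rule negligible_subset) auto
    then have gH: "negligible (g ` H)"
    proof (rule negligible_locally_Lipschitz_image[OF order_refl])
      fix u assume "u \<in> H"
      then obtain \<rho> L where "\<rho> > 0" "\<forall>u'\<in>ball u \<rho>. \<forall>u''\<in>ball u \<rho>. norm (g u' - g u'') \<le> L * norm (u' - u'')"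
        using lip[of u] unfolding H_def by blast
      then show "\<exists>T B. open T \<and> u \<in> T \<and> (\<forall>y\<in>H \<inter> T. norm (g y - g u) \<le> B * norm (y - u))"
        by (intro exI[of _ "ball u \<rho>"] exI[of _ L]) auto
    qed
    \<comment> \<open>The height over the hyperplane grows at rate at least \<kappa>. Within time
      \<open>\<epsilon> / 2\<close> in either direction it therefore changes by at least \<eta>, and
      every orbit starting closer than that crosses.\<close>
    define \<eta> where "\<eta> = \<kappa> * \<epsilon> / 2"
    have \<eta>: "\<eta> > 0" using \<kappa> \<epsilon> by (simp add: \<eta>_def)
    have "openin (top_of_set (cmap c ` cdom c)) (cimg c N)" by (rule cimg_openin_cimg[OF c N(1)])
    then obtain S1 where S1: "open S1" "cimg c N = cmap c ` cdom c \<inter> S1" unfolding openin_open by blast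
    define S where "S = S1 \<inter> {u. \<bar>(u - u0) \<bullet> X\<bar> < \<eta>}"
    have "open S" unfolding S_def by (intro open_Int S1 open_Collect_less continuous_intros)
    moreover have "u0 \<in> S"
    proof -
      have "u0 \<in> cimg c N" using x0 N by blast
      then show ?thesis using S1 \<eta> by (auto simp: S_def)
    qed
    moreover have "g ` (S \<inter> O') \<subseteq> g ` H"
    proof
      fix v assume "v \<in> g ` (S \<inter> O')"
      then obtain u where u: "u \<in> S" "u \<in> O'" "v = g u" by blast
      have "u \<in> cimg c N" using u S1 O' by (auto simp: S_def)
      then have xN: "cinv c u \<in> N" "cinv c u \<in> cdom c" "cmap c (cinv c u) = u" using c by auto
      define h where "h = (\<lambda>s. (cmap c (Fl (cinv c u, s)) - u0) \<bullet> X)"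
      have dh: "(h has_real_derivative F c (Fl (cinv c u, s)) \<bullet> X) (at s)" if "\<bar>s\<bar> < \<epsilon>" for s
        using DERIV_diff[OF inner_has_real_derivative[OF c, of "cinv c u" s X] DERIV_const[of "u0 \<bullet> X"]] box[OF xN(1) that]
        unfolding h_def inner_diff_left by simp
      have h0: "\<bar>h 0\<bar> < \<eta>" using u xN by (simp add: h_def S_def)
      have mono: "h b - h a \<ge> (b - a) * \<kappa>" if ab: "a < b" "\<bar>a\<bar> < \<epsilon>" "\<bar>b\<bar> < \<epsilon>" for a b
      proof -
        obtain z where z: "a < z" "z < b" "h b - h a = (b - a) * (F c (Fl (cinv c u, z)) \<bullet> X)"
        proof -
          have "(h has_real_derivative F c (Fl (cinv c u, s)) \<bullet> X) (at s)" if "a \<le> s" "s \<le> b" for s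
            using dh[of s] ab that by auto
          then show ?thesis using MVT2[OF ab(1), of h "\<lambda>s. F c (Fl (cinv c u, s)) \<bullet> X"] that by blast
        qed
        have "\<bar>z\<bar> < \<epsilon>" using z ab by auto
        then show ?thesis using z box[OF xN(1)] ab by (simp add: less_imp_le)
      qed
      have "h (\<epsilon> / 2) \<ge> 0" using mono[of 0 "\<epsilon>/2"] h0 \<epsilon> by (simp add: \<eta>_def mult.commute)
      moreover have "h (- \<epsilon> / 2) \<le> 0" using mono[of "- \<epsilon>/2" 0] h0 \<epsilon> by (simp add: \<eta>_def mult.commute)
      moreover have "isCont h s" if "- \<epsilon> / 2 \<le> s \<and> s \<le> \<epsilon> / 2" for s
        by (rule DERIV_isCont[OF dh]) (use that \<epsilon> in auto)
      ultimately obtain s where s: "- \<epsilon> / 2 \<le> s" "s \<le> \<epsilon> / 2" "h s = 0"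
        using IVT[of h "- \<epsilon> / 2" 0 "\<epsilon> / 2"] \<epsilon> by auto
      then have "\<bar>s\<bar> < \<epsilon>" using \<epsilon> by auto
      with box[OF xN(1)] have b: "Fl (cinv c u, s) \<in> cdom c \<inter> B" by blast
      let ?u = "cmap c (Fl (cinv c u, s))"
      have "?u \<in> O'" using b by (auto simp: B_def)
      moreover have "X \<bullet> ?u = X \<bullet> u0" using s(3) by (simp add: h_def inner_diff_right inner_commute)
      ultimately have "?u \<in> H" by (simp add: H_def)
      moreover have "g ?u = g u" using inv[OF u(2)] b \<open>?u \<in> O'\<close> by blast
      ultimately show "v \<in> g ` H" using u by (metis imageI)
    qed
    ultimately show ?thesis using gH negligible_subset by blast
  qed
  \<comment> \<open>Countably many of these neighbourhoods cover \<open>O'\<close>, and null sets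
    are closed under countable unions.\<close>
  then obtain S where S: "\<And>u. u \<in> O' \<Longrightarrow> open (S u) \<and> u \<in> S u \<and> negligible (g ` (S u \<inter> O'))" by metis
  obtain \<F> where \<F>: "\<F> \<subseteq> S ` O'" "countable \<F>" "\<Union>\<F> = \<Union>(S ` O')"
    using Lindelof[of "S ` O'"] S by (metis (no_types, lifting) imageE)
  have "negligible (\<Union>R\<in>\<F>. g ` (R \<inter> O'))"
    using \<F> S by (intro negligible_countable_Union[of "(\<lambda>R. g ` (R \<inter> O')) ` \<F>"]) auto
  moreover have "g ` O' \<subseteq> (\<Union>R\<in>\<F>. g ` (R \<inter> O'))"
  proof
    fix v assume "v \<in> g ` O'"
    then obtain u where u: "u \<in> O'" "v = g u" by blast
    then have "u \<in> \<Union>\<F>" using \<F>(3) S by blast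
    then show "v \<in> (\<Union>R\<in>\<F>. g ` (R \<inter> O'))" using u by blast
  qed
  ultimately show ?thesis by (rule negligible_subset)
qed

end

section \<open>Locally Lipschitz maps\<close>

lemma isCont_Lipschitz:
  fixes g :: "'a::real_normed_vector \<Rightarrow> 'b::real_normed_vector"
  assumes "\<rho> > 0" "\<And>u. u \<in> ball u0 \<rho> \<Longrightarrow> norm (g u - g u0) \<le> L * norm (u - u0)"
  shows "isCont g u0"
  unfolding continuous_at
proof (rule LIM_zero_cancel, rule Lim_null_comparison)
  show "\<forall>\<^sub>F u in at u0. norm (g u - g u0) \<le> L * norm (u - u0)"
    unfolding eventually_at using assms by (intro exI[of _ \<rho>]) (auto simp: dist_commute)
  have "((\<lambda>u. L * norm (u - u0)) \<longlongrightarrow> L * norm (u0 - u0)) (at u0)" by (intro tendsto_intros)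
  then show "((\<lambda>u. L * norm (u - u0)) \<longlongrightarrow> 0) (at u0)" by simp
qed

definition loc_Lip :: "'a::real_normed_vector set \<Rightarrow> ('a \<Rightarrow> 'b::real_normed_vector) \<Rightarrow> 'a \<Rightarrow> bool" where
  "loc_Lip S g u0 \<longleftrightarrow> (\<exists>\<rho>>0. \<exists>L. ball u0 \<rho> \<subseteq> S \<and>
     (\<forall>u\<in>ball u0 \<rho>. \<forall>u'\<in>ball u0 \<rho>. norm (g u - g u') \<le> L * norm (u - u')))"

lemma loc_LipI:
  assumes "\<rho> > 0" "ball u0 \<rho> \<subseteq> S"
    and "\<And>u u'. u \<in> ball u0 \<rho> \<Longrightarrow> u' \<in> ball u0 \<rho> \<Longrightarrow> norm (g u - g u') \<le> L * norm (u - u')"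
  shows "loc_Lip S g u0"
  using assms unfolding loc_Lip_def by blast

lemma loc_Lip_add:
  assumes "loc_Lip S f u" "loc_Lip S g u"
  shows "loc_Lip S (\<lambda>x. f x + g x) u"
proof -
  obtain \<rho> L where f: "\<rho> > 0" "ball u \<rho> \<subseteq> S"
    "\<And>x y. x \<in> ball u \<rho> \<Longrightarrow> y \<in> ball u \<rho> \<Longrightarrow> norm (f x - f y) \<le> L * norm (x - y)"
    using assms(1) unfolding loc_Lip_def by blast
  obtain \<rho>' L' where g: "\<rho>' > 0"
    "\<And>x y. x \<in> ball u \<rho>' \<Longrightarrow> y \<in> ball u \<rho>' \<Longrightarrow> norm (g x - g y) \<le> L' * norm (x - y)"
    using assms(2) unfolding loc_Lip_def by blast
  have "norm (f x + g x - (f y + g y)) \<le> (L + L') * norm (x - y)"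
    if "x \<in> ball u (min \<rho> \<rho>')" "y \<in> ball u (min \<rho> \<rho>')" for x y
  proof -
    have "f x + g x - (f y + g y) = (f x - f y) + (g x - g y)" by simp
    also have "norm \<dots> \<le> L * norm (x - y) + L' * norm (x - y)"
      using that by (intro norm_triangle_le add_mono f(3) g(2)) auto
    finally show ?thesis by (simp add: distrib_right)
  qed
  then show ?thesis
    using f(1,2) g(1) by (intro loc_LipI[of "min \<rho> \<rho>'" _ _ _ "L + L'"]) auto
qed

lemma loc_Lip_linear:
  assumes "bounded_linear T" "loc_Lip S f u"
  shows "loc_Lip S (\<lambda>x. T (f x)) u"
proof -
  interpret T: bounded_linear T by fact
  obtain \<rho> L where f: "\<rho> > 0" "ball u \<rho> \<subseteq> S"
    "\<And>x y. x \<in> ball u \<rho> \<Longrightarrow> y \<in> ball u \<rho> \<Longrightarrow> norm (f x - f y) \<le> L * norm (x - y)"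
    using assms(2) unfolding loc_Lip_def by blast
  obtain K where K: "K > 0" "\<And>x. norm (T x) \<le> norm x * K" using T.pos_bounded by blast
  have "norm (T (f x) - T (f y)) \<le> (K * L) * norm (x - y)"
    if "x \<in> ball u \<rho>" "y \<in> ball u \<rho>" for x y
  proof -
    have "norm (T (f x) - T (f y)) \<le> norm (f x - f y) * K" using K(2)[of "f x - f y"] by (simp add: T.diff)
    also have "\<dots> \<le> (L * norm (x - y)) * K" using f(3)[OF that] K(1) by (intro mult_right_mono) auto
    finally show ?thesis by (simp add: algebra_simps)
  qed
  then show ?thesis by (rule loc_LipI[OF f(1,2)])
qed

lemma loc_Lip_sum:
  assumes "finite I" "I \<noteq> {}" "\<And>i. i \<in> I \<Longrightarrow> loc_Lip S (f i) u"
  shows "loc_Lip S (\<lambda>x. \<Sum>i\<in>I. f i x) u"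
  using assms by (induction I rule: finite_ne_induct) (auto intro: loc_Lip_add)

context flow_manifold begin

text \<open>Where orbits shrink to a zero, this makes the supremum tend to the value at the zero:
  the source of continuity at the boundary of \<open>U\<close>.\<close>

lemma orbit_sup_close:
  assumes "\<And>t. \<bar>f (cmap c (Fl (cinv c u, t))) - k\<bar> \<le> \<epsilon>"
  shows "\<bar>orbit_sup c f u - k\<bar> \<le> \<epsilon>"
proof -
  have up: "f (cmap c (Fl (cinv c u, t))) \<le> k + \<epsilon>" and lo: "k - \<epsilon> \<le> f (cmap c (Fl (cinv c u, t)))" for t
    using assms[of t] by (auto simp: abs_le_iff)
  have "orbit_sup c f u \<le> k + \<epsilon>" unfolding orbit_sup_def by (rule cSUP_least) (use up in auto)
  moreover have "k - \<epsilon> \<le> orbit_sup c f u"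
    unfolding orbit_sup_def by (rule cSUP_upper2[of _ _ 0]) (use up lo[of 0] in \<open>auto intro!: bdd_aboveI[of _ "k + \<epsilon>"]\<close>)
  ultimately show ?thesis by (simp add: abs_le_iff)
qed

lemma cimg_open_trace:
  assumes "c \<in> A" "open B"
  obtains S where "open S" "\<And>u. u \<in> cmap c ` cdom c \<Longrightarrow> u \<in> S \<longleftrightarrow> cinv c u \<in> B"
proof -
  obtain S where S: "open S" "cimg c B = cmap c ` cdom c \<inter> S"
    using cimg_openin_cimg[OF assms] unfolding openin_open by blast
  have "u \<in> S \<longleftrightarrow> cinv c u \<in> B" if u: "u \<in> cmap c ` cdom c" for u
  proof -
    obtain x where x: "x \<in> cdom c" "u = cmap c x" using u by blast
    then have "cinv c u = x" using assms by simp
    moreover have "u \<in> cimg c B \<longleftrightarrow> x \<in> B"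
    proof
      assume "u \<in> cimg c B"
      then obtain x' where "x' \<in> cdom c" "x' \<in> B" "u = cmap c x'" by blast
      then show "x \<in> B" using cmap_inj[OF assms(1), of x x'] x by simp
    qed (use x in blast)
    ultimately show ?thesis using S u by simp
  qed
  with S(1) that show ?thesis by blast
qed

text \<open>A circle action that moves points only a little cannot fix an open set. If \<open>U\<close> were a proper
  part of \<open>W0 - Z\<close>, choose a point of \<open>closure U\<close> nearest to a point outside and bend the chart such
  that near it \<open>U\<close> lies in the open half-space determined by \<open>e\<close>. The map taking the coordinatewise
  supremum over orbits in \<open>U\<close> and the identity elsewhere covers a neighbourhood of the contact point
  by Brouwer's theorem, but it maps \<open>U\<close> to a null set.\<close>
lemma no_separation:
  assumes c: "c \<in> A" and wr: "half_space \<inter> ball w r \<subseteq> cmap c ` cdom c"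
    and W0: "W0 = {x \<in> cdom c. cmap c x \<in> ball w r}"
    and U: "open U" "U \<subseteq> W0 - Z" "U \<noteq> {}" "W0 \<inter> closure U \<subseteq> U \<union> Z"
    and \<mu>: "period_fun U \<mu>" "\<And>x. x \<in> U \<Longrightarrow> \<mu> x \<noteq> 0"
    and shrink: "\<And>y. y \<in> W0 \<Longrightarrow> y \<in> Z \<Longrightarrow> orbits_shrink U y"
  shows "W0 - Z \<subseteq> U"
proof (rule ccontr)
  assume "\<not> W0 - Z \<subseteq> U"
  then obtain x1 where x1: "x1 \<in> W0" "x1 \<notin> Z" "x1 \<notin> U" by blast
  have "open W0" unfolding W0 by (rule open_chart_preimage[OF c open_ball])
  \<comment> \<open>The contact point is sought in the open half-ball \<open>H\<close>: it is
    convex, and small Euclidean balls inside it lie in the chart image. Both \<open>U\<close> and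
    its exterior in \<open>W0\<close> have points there, so \<open>H\<close> meets the
    frontier.\<close>
  define I where "I = {p::'e. p \<bullet> normal_dir > 0}"
  define H where "H = ball w r \<inter> I"
  have openH: "open H" unfolding H_def I_def by (intro open_Int open_ball open_Collect_less continuous_intros)
  have convH: "convex H"
    unfolding H_def I_def using convex_halfspace_gt[of 0 normal_dir] by (auto intro!: convex_Int simp: inner_commute)
  have H_chart: "H \<subseteq> cmap c ` cdom c" using wr by (auto simp: H_def I_def half_space_def)
  have HW: "cinv c u \<in> W0" "cmap c (cinv c u) = u" "cinv c u \<in> cdom c" if u: "u \<in> H" for u
  proof -
    obtain x where x: "x \<in> cdom c" "u = cmap c x" using u H_chart by blast
    then show "cinv c u \<in> W0" "cmap c (cinv c u) = u" "cinv c u \<in> cdom c"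
      using u c by (simp_all add: W0 H_def)
  qed
  define UE where "UE = cimg c U \<inter> I"
  define VE where "VE = cimg c (W0 - closure U) \<inter> I"
  have opV: "open (W0 - closure U)" using \<open>open W0\<close> by blast
  have UE: "open UE" "UE \<noteq> {}"
    unfolding UE_def I_def
    using half_space_openin_interior[OF cimg_openin[OF c U(1)]]
      half_space_openin_nonempty_interior[OF cimg_openin[OF c U(1)]] U(2,3) W0 by blast+
  have "x1 \<in> W0 - closure U" using x1 U(4) by blast
  then have "cimg c (W0 - closure U) \<noteq> {}" using W0 by blast
  then have VE: "open VE" "VE \<noteq> {}"
    unfolding VE_def I_def
    using half_space_openin_interior[OF cimg_openin[OF c opV]]
      half_space_openin_nonempty_interior[OF cimg_openin[OF c opV]] by blast+
  have UEI: "u \<in> UE \<longleftrightarrow> cinv c u \<in> U" if "u \<in> H" for u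
  proof
    assume "u \<in> UE"
    then obtain x where "x \<in> cdom c" "x \<in> U" "u = cmap c x" by (auto simp: UE_def)
    then show "cinv c u \<in> U" using c by simp
  next
    assume "cinv c u \<in> U"
    then have "cmap c (cinv c u) \<in> cimg c U" using HW(3)[OF that] by (intro imageI IntI)
    then show "u \<in> UE" using HW(2)[OF that] that by (simp add: UE_def H_def)
  qed
  have UEH: "UE \<subseteq> H" using U(2) by (auto simp: UE_def H_def W0)
  have VEH: "VE \<subseteq> H" by (auto simp: VE_def H_def W0)
  have "VE \<inter> UE = {}"
  proof -
    have "cinv c u \<in> W0 - closure U" if uV: "u \<in> VE" for u
    proof -
      obtain x where "x \<in> cdom c" "x \<in> W0 - closure U" "u = cmap c x" using uV unfolding VE_def by blast
      then show ?thesis using c by simp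
    qed
    then show ?thesis using UEI UEH closure_subset by blast
  qed
  then have VEU: "VE \<inter> closure UE = {}" using open_Int_closure_eq_empty[OF VE(1)] by blast
  have bdry: "cinv c u \<in> W0 \<and> cinv c u \<in> Z" if u: "u \<in> H" "u \<in> closure UE" "u \<notin> UE" for u
  proof -
    have "cinv c u \<in> closure U"
    proof (rule ccontr)
      assume "cinv c u \<notin> closure U"
      then have "cmap c (cinv c u) \<in> cimg c (W0 - closure U)"
        using HW(1,3)[OF u(1)] by (intro imageI IntI DiffI)
      then have "u \<in> VE" using HW(2)[OF u(1)] u(1) by (simp add: VE_def H_def)
      then show False using VEU u by blast
    qed
    then show ?thesis using U(4) HW[OF u(1)] UEI[OF u(1)] u(3) by blast
  qed
  have "H \<inter> frontier (closure UE) \<noteq> {}"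
  proof (rule connected_Int_frontier)
    show "connected H" using convH by (rule convex_connected)
    show "H \<inter> closure UE \<noteq> {}" using UE UEH closure_subset by blast
    show "H - closure UE \<noteq> {}" using VE VEH VEU by blast
  qed
  then obtain y0 where y0: "y0 \<in> H" "y0 \<in> frontier (closure UE)" by blast
  obtain \<rho> where \<rho>: "\<rho> > 0" "ball y0 \<rho> \<subseteq> H" using openH y0(1) by (rule openE)
  have y0c: "y0 \<in> closure UE" "y0 \<notin> interior (closure UE)" using y0(2) by (auto simp: frontier_def)
  have "\<not> ball y0 (\<rho> / 2) \<subseteq> closure UE"
    using y0c(2) \<rho>(1) interiorI[OF open_ball, of y0 y0 "\<rho> / 2" "closure UE"] by auto
  then obtain q where q: "q \<in> ball y0 (\<rho> / 2)" "q \<notin> closure UE" by blast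
  \<comment> \<open>The open ball of radius \<open>R\<close> about \<open>q\<close> misses
    \<open>closure UE\<close>, so \<open>y\<close> is a contact point with a ball on the outside.
    Taking \<open>q\<close> within \<open>\<rho> / 2\<close> of \<open>y0\<close> keeps
    \<open>y\<close> in \<open>H\<close>.\<close>
  define y where "y = closest_point (closure UE) q"
  have clUE: "closure UE \<noteq> {}" using UE(2) by simp
  have yc: "y \<in> closure UE" unfolding y_def using closest_point_in_set[OF closed_closure clUE] .
  have ymin: "dist q y \<le> dist q u" if "u \<in> closure UE" for u
    unfolding y_def using closest_point_le[OF closed_closure that] .
  have "dist q y < \<rho> / 2" using ymin[OF y0c(1)] q(1) by (simp add: dist_commute)
  then have "dist y0 y < \<rho>" using q(1) dist_triangle[of y0 y q] by (simp add: dist_commute)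
  then have yH: "y \<in> H" using \<rho>(2) by auto
  define R where "R = dist q y"
  have R: "R > 0" using q(2) yc by (auto simp: R_def)
  \<comment> \<open>An interior point of \<open>UE\<close> could be moved towards \<open>q\<close>.
    Hence \<open>y\<close> is the image of a zero, and orbits in \<open>U\<close> shrink to
    it.\<close>
  have yU: "y \<notin> UE"
  proof
    assume "y \<in> UE"
    then obtain d where d: "d > 0" "ball y d \<subseteq> UE" using UE(1) by (meson openE)
    define k where "k = min (1/2) (d / (2 * R))"
    have k: "k > 0" "k < 1" "k * R < d" using d R by (auto simp: k_def min_def field_simps)
    let ?u = "y + k *\<^sub>R (q - y)"
    have "?u \<in> ball y d" using k R by (simp add: dist_norm norm_minus_commute R_def)
    then have "?u \<in> closure UE" using d closure_subset by blast
    then have "R \<le> dist q ?u" using ymin by (simp add: R_def)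
    also have "q - ?u = (1 - k) *\<^sub>R (q - y)" by (simp add: algebra_simps)
    then have "dist q ?u = (1 - k) * R" using k by (simp add: dist_norm R_def)
    finally have "R \<le> (1 - k) * R" .
    then show False using mult_pos_pos[OF k(1) R] by (simp add: algebra_simps)
  qed
  define e where "e = (1 / R) *\<^sub>R (y - q)"
  have e: "norm e = 1" using R by (simp add: e_def R_def dist_norm norm_minus_commute)
  have Re: "y - q = R *\<^sub>R e" using R by (simp add: e_def)
  have outer: "norm ((u - y) + R *\<^sub>R e) \<ge> R" if "u \<in> closure UE" for u
  proof -
    have "(u - y) + R *\<^sub>R e = u - q" by (simp add: Re[symmetric])
    moreover have "norm (u - q) \<ge> R"
      using ymin[OF that] by (simp add: R_def dist_norm norm_minus_commute)
    ultimately show ?thesis by (simp only:)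
  qed
  define C where "C = 2 / R"
  define \<psi> where "\<psi> = (\<lambda>u. shear C e (u - y))"
  define \<psi>i where "\<psi>i = (\<lambda>v. y + shear (- C) e v)"
  have \<psi>i\<psi>: "\<psi>i (\<psi> u) = u" for u using shear_shear[OF e, of C] by (simp add: \<psi>i_def \<psi>_def)
  have \<psi>\<psi>i: "\<psi> (\<psi>i v) = v" for v using shear_shear[OF e, of "- C"] by (simp add: \<psi>i_def \<psi>_def)
  have \<psi>y [simp]: "\<psi> y = 0" by (simp add: \<psi>_def)
  have \<psi>i0 [simp]: "\<psi>i 0 = y" by (simp add: \<psi>i_def)
  have cont_\<psi>: "continuous_on S \<psi>" for S
    unfolding \<psi>_def by (rule continuous_on_compose2[OF continuous_on_shear[of UNIV]]) (auto intro!: continuous_intros)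
  have cont_\<psi>i: "continuous_on S \<psi>i" for S
    unfolding \<psi>i_def by (intro continuous_intros continuous_on_shear)
  obtain d1 where d1: "d1 > 0" "ball y d1 \<subseteq> H" using openH yH by (rule openE)
  \<comment> \<open>The bound \<open>d1\<close> keeps the ball inside the chart image, the bound
    \<open>R\<close> is needed for \<open>shear_pos\<close>.\<close>
  define \<delta>0 where "\<delta>0 = min d1 R"
  have \<delta>0: "\<delta>0 > 0" "\<delta>0 \<le> R" "ball y \<delta>0 \<subseteq> H" using d1 R by (auto simp: \<delta>0_def)
  define P where "P = ball y \<delta>0"
  define B where "B = {x \<in> cdom c. cmap c x \<in> P}"
  have openB: "open B" unfolding B_def P_def by (rule open_chart_preimage[OF c open_ball])
  have pB: "cinv c y \<in> B" using HW[OF yH] \<delta>0 by (simp add: B_def P_def)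
  have pZ: "cinv c y \<in> W0" "cinv c y \<in> Z" using bdry[OF yH yc yU] by auto
  obtain B' where B': "open B'" "cinv c y \<in> B'" "\<And>x t. x \<in> U \<Longrightarrow> x \<in> B' \<Longrightarrow> Fl (x, t) \<in> B"
    using orbits_shrinkD[OF shrink[OF pZ] openB pB] by metis
  obtain S1 where S1: "open S1" "\<And>u. u \<in> cmap c ` cdom c \<Longrightarrow> u \<in> S1 \<longleftrightarrow> cinv c u \<in> B'"
    using cimg_open_trace[OF c B'(1)] by metis
  have "y \<in> S1 \<inter> ball y \<delta>0" using S1(2) B'(2) yH H_chart \<delta>0 by auto
  then obtain \<delta>1 where \<delta>1: "\<delta>1 > 0" "ball y \<delta>1 \<subseteq> S1 \<inter> ball y \<delta>0"
    using S1(1) by (meson openE open_Int open_ball)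
  have b1H: "ball y \<delta>1 \<subseteq> H" using \<delta>1 \<delta>0 by blast
  define O' where "O' = UE \<inter> ball y \<delta>1"
  have O': "open O'" "O' \<subseteq> H" "O' \<subseteq> UE" "O' \<subseteq> ball y \<delta>1" using UE b1H by (auto simp: O'_def)
  have O'U: "cinv c u \<in> U" if "u \<in> O'" for u using that UEI O' by blast
  have O'B: "Fl (cinv c u, t) \<in> B" if "u \<in> O'" for u t
  proof (rule B'(3))
    show "cinv c u \<in> U" using O'U that .
    show "cinv c u \<in> B'" using S1(2)[of u] that O' \<delta>1(2) H_chart by blast
  qed
  have O'P: "cmap c (Fl (cinv c u, t)) \<in> P" "Fl (cinv c u, t) \<in> cdom c" if "u \<in> O'" for u t
    using O'B[OF that, of t] by (simp_all add: B_def)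
  define K where "K = 1 + 4 * \<bar>C\<bar> * \<delta>0"
  have K: "K \<ge> 0" using \<delta>0 by (simp add: K_def)
  have Pn: "norm (p - y) \<le> \<delta>0" if "p \<in> P" for p
    using that by (simp add: P_def dist_norm norm_minus_commute)
  have f_Lip: "\<bar>\<psi> p \<bullet> d - \<psi> p' \<bullet> d\<bar> \<le> K * norm (p - p')" if "p \<in> P" "p' \<in> P" "norm d = 1" for p p' d
  proof -
    have "\<bar>\<psi> p \<bullet> d - \<psi> p' \<bullet> d\<bar> \<le> norm (\<psi> p - \<psi> p') * norm d"
      unfolding inner_diff_left[symmetric] by (rule Cauchy_Schwarz_ineq2)
    also have "\<dots> \<le> K * norm ((p - y) - (p' - y))"
      using shear_Lipschitz[OF e Pn[OF that(1)] Pn[OF that(2)], of C] that(3) by (simp add: \<psi>_def K_def)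
    finally show ?thesis by simp
  qed
  have yP: "y \<in> P" using \<delta>0 by (simp add: P_def)
  have f_bdd: "\<psi> p \<bullet> d \<le> K * \<delta>0" if "p \<in> P" "norm d = 1" for p d
  proof -
    have "\<psi> p \<bullet> d \<le> K * norm (p - y)" using f_Lip[OF that(1) yP that(2)] by simp
    also have "\<dots> \<le> K * \<delta>0" using Pn[OF that(1)] K by (intro mult_left_mono)
    finally show ?thesis .
  qed
  define Ms where "Ms = (\<lambda>d. orbit_sup c (\<lambda>p. \<psi> p \<bullet> d))"
  define M where "M = (\<lambda>d u. if u \<in> UE then Ms d u else \<psi> u \<bullet> d)"
  have cinv_cont: "continuous_on O' (cinv c)"
    using continuous_on_cinv[OF c] continuous_on_subset O'(2) H_chart by (metis subset_trans)
  have m: "continuous_on O' (\<mu> \<circ> cinv c)"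
    by (rule continuous_on_compose[OF cinv_cont])
       (use \<mu>(1) O'U in \<open>auto simp: period_fun_def intro: continuous_on_subset\<close>)
  have M_Lip: "loc_Lip O' (M d) u0" if d: "norm d = 1" and u0: "u0 \<in> O'" for d u0
  proof -
    have "\<exists>\<rho>>0. \<exists>L. ball u0 \<rho> \<subseteq> O' \<and>
      (\<forall>u\<in>ball u0 \<rho>. \<forall>u'\<in>ball u0 \<rho>. \<bar>Ms d u - Ms d u'\<bar> \<le> L * norm (u - u'))"
      unfolding Ms_def
    proof (rule orbit_sup_Lipschitz[OF c O'(1) _ O'P(2) O'P(1) f_Lip[OF _ _ d] K f_bdd[OF _ d] m _ _ u0])
      show "O' \<subseteq> cmap c ` cdom c" using O'(2) H_chart by blast
      fix u assume "u \<in> O'"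
      then have "cinv c u \<in> U" by (rule O'U)
      then show "Fl (cinv c u, (\<mu> \<circ> cinv c) u) = cinv c u" "(\<mu> \<circ> cinv c) u \<noteq> 0"
        using \<mu> by (simp_all add: period_fun_def)
    qed
    then obtain \<rho> L where L: "\<rho> > 0" "ball u0 \<rho> \<subseteq> O'"
      "\<And>u u'. u \<in> ball u0 \<rho> \<Longrightarrow> u' \<in> ball u0 \<rho> \<Longrightarrow> \<bar>Ms d u - Ms d u'\<bar> \<le> L * norm (u - u')" by blast
    have "M d u = Ms d u" if "u \<in> ball u0 \<rho>" for u using that L(2) O'(3) by (auto simp: M_def)
    then have "norm (M d u - M d u') \<le> L * norm (u - u')" if "u \<in> ball u0 \<rho>" "u' \<in> ball u0 \<rho>" for u u'
      using L(3)[OF that] that by simp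
    then show ?thesis unfolding loc_Lip_def using L(1,2) by blast
  qed
  have M_cont: "continuous_on (ball y \<delta>1) (M d)" if d: "norm d = 1" for d
    unfolding continuous_on_eq_continuous_at[OF open_ball]
  proof
    fix u0 assume u0: "u0 \<in> ball y \<delta>1"
    show "isCont (M d) u0"
    proof (cases "u0 \<in> UE")
      case True
      then have "u0 \<in> O'" using u0 by (simp add: O'_def)
      from M_Lip[OF d this] obtain \<rho> L where L: "\<rho> > 0"
        "\<And>u u'. u \<in> ball u0 \<rho> \<Longrightarrow> u' \<in> ball u0 \<rho> \<Longrightarrow> norm (M d u - M d u') \<le> L * norm (u - u')"
        unfolding loc_Lip_def by blast
      have "u0 \<in> ball u0 \<rho>" using L by simp
      then show ?thesis using isCont_Lipschitz[of \<rho> u0 "M d" L] L by blast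
    next
      case False
      have "\<exists>N. open N \<and> u0 \<in> N \<and> (\<forall>u\<in>N. dist (M d u) (M d u0) < \<epsilon>)" if \<epsilon>: "\<epsilon> > 0" for \<epsilon>
      proof -
        define S2 where "S2 = {u. \<bar>\<psi> u \<bullet> d - \<psi> u0 \<bullet> d\<bar> < \<epsilon> / 2}"
        have S2: "open S2" "u0 \<in> S2"
          unfolding S2_def using \<epsilon> by (auto intro!: open_Collect_less continuous_intros cont_\<psi>)
        \<comment> \<open>Points outside \<open>UE\<close> but in its closure are zeros, so whole
          nearby orbits stay where \<psi> is close to its value at \<open>u0\<close>; away from the
          closure the claim is vacuous.\<close>
        have "\<exists>N. open N \<and> u0 \<in> N \<and> (\<forall>u\<in>N \<inter> UE. \<forall>t. cmap c (Fl (cinv c u, t)) \<in> S2)"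
        proof (cases "u0 \<in> closure UE")
          case True
          have u0H: "u0 \<in> H" using u0 b1H by blast
          define B2 where "B2 = {x \<in> cdom c. cmap c x \<in> S2}"
          have B2: "open B2" "cinv c u0 \<in> B2"
            using open_chart_preimage[OF c S2(1)] HW[OF u0H] S2 by (simp_all add: B2_def)
          have z: "cinv c u0 \<in> W0" "cinv c u0 \<in> Z" using bdry[OF u0H True False] by auto
          obtain B3 where B3: "open B3" "cinv c u0 \<in> B3" "\<And>x t. x \<in> U \<Longrightarrow> x \<in> B3 \<Longrightarrow> Fl (x, t) \<in> B2"
            using orbits_shrinkD[OF shrink[OF z] B2] by metis
          obtain S3 where S3: "open S3" "\<And>u. u \<in> cmap c ` cdom c \<Longrightarrow> u \<in> S3 \<longleftrightarrow> cinv c u \<in> B3"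
            using cimg_open_trace[OF c B3(1)] by metis
          have "cmap c (Fl (cinv c u, t)) \<in> S2" if "u \<in> S3" "u \<in> UE" for u t
          proof -
            have "u \<in> H" using that UEH by blast
            then have "cinv c u \<in> U" "cinv c u \<in> B3" using that UEI S3 H_chart by blast+
            then show ?thesis using B3(3) by (simp add: B2_def)
          qed
          moreover have "u0 \<in> S3" using S3(2) B3(2) u0H H_chart by blast
          ultimately show ?thesis using S3(1) by blast
        next
          case False
          then show ?thesis using closure_subset by (intro exI[of _ "- closure UE"]) auto
        qed
        then obtain N where N: "open N" "u0 \<in> N" "\<And>u t. u \<in> N \<Longrightarrow> u \<in> UE \<Longrightarrow> cmap c (Fl (cinv c u, t)) \<in> S2"
          by blast
        have "dist (M d u) (M d u0) < \<epsilon>" if u: "u \<in> N \<inter> S2" for u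
        proof (cases "u \<in> UE")
          case True
          have "\<bar>Ms d u - \<psi> u0 \<bullet> d\<bar> \<le> \<epsilon> / 2"
            unfolding Ms_def
          proof (rule orbit_sup_close)
            fix t show "\<bar>\<psi> (cmap c (Fl (cinv c u, t))) \<bullet> d - \<psi> u0 \<bullet> d\<bar> \<le> \<epsilon> / 2"
              using N(3)[of u t] u True by (simp add: S2_def)
          qed
          then show ?thesis using True False \<epsilon> by (simp add: M_def dist_real_def)
        next
          case f: False
          then show ?thesis using u False \<epsilon> by (simp add: M_def dist_real_def S2_def)
        qed
        then show ?thesis using N S2 by (intro exI[of _ "N \<inter> S2"]) auto
      qed
      then show ?thesis unfolding continuous_at_open
        by (metis (no_types, lifting) dist_commute mem_ball openE subset_iff)
    qed
  qed
  \<comment> \<open>The direction \<open>e\<close> need not be a basis vector, so the coordinatewise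
    supremum alone would not control the height along \<open>e\<close>. The correction makes the
    \<open>e\<close>-component equal to \<open>M e\<close>, which dominates the original
    height.\<close>
  define A' where "A' = (\<lambda>u. (\<Sum>b\<in>Basis. M b u *\<^sub>R b) + (M e u - (\<Sum>b\<in>Basis. M b u *\<^sub>R b) \<bullet> e) *\<^sub>R e)"
  have A'_off: "A' u = \<psi> u" if "u \<notin> UE" for u
    using that by (simp add: A'_def M_def euclidean_representation)
  have "e \<bullet> e = 1" using e by (simp add: norm_eq_1)
  then have A'e: "A' u \<bullet> e = M e u" for u by (simp add: A'_def inner_add_left)
  have A'_cont: "continuous_on (ball y \<delta>1) A'"
    unfolding A'_def by (intro continuous_intros M_cont e norm_Basis)
  have neg: "negligible (A' ` O')"
  proof (rule negligible_orbit_image[OF c O'(1)])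
    show "O' \<subseteq> cmap c ` cdom c" using O'(2) H_chart by blast
    show "cinv c u \<notin> Z" if "u \<in> O'" for u using O'U[OF that] U(2) by blast
    show "A' (cmap c (Fl (cinv c u, t))) = A' u"
      if "u \<in> O'" "Fl (cinv c u, t) \<in> cdom c" "cmap c (Fl (cinv c u, t)) \<in> O'" for u t
    proof -
      have "u \<in> UE" "cmap c (Fl (cinv c u, t)) \<in> UE" using that O'(3) by auto
      then have "M d (cmap c (Fl (cinv c u, t))) = M d u" for d
        using orbit_sup_Fl[OF c that(2)] by (simp add: M_def Ms_def)
      then show ?thesis by (simp add: A'_def)
    qed
    fix u0 assume u0: "u0 \<in> O'"
    have s: "loc_Lip O' (\<lambda>u. \<Sum>b\<in>Basis. M b u *\<^sub>R b) u0"
      by (intro loc_Lip_sum finite_Basis nonempty_Basis loc_Lip_linear[OF bounded_linear_scaleR_left] M_Lip u0 norm_Basis)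
    have "bounded_linear (\<lambda>z. - ((z \<bullet> e) *\<^sub>R e))"
      by (intro bounded_linear_minus bounded_linear_scaleR_const bounded_linear_inner_left)
    from loc_Lip_linear[OF this s] loc_Lip_linear[OF bounded_linear_scaleR_left M_Lip[OF e u0]] s
    have "loc_Lip O' (\<lambda>u. (\<Sum>b\<in>Basis. M b u *\<^sub>R b) + (M e u *\<^sub>R e + - (((\<Sum>b\<in>Basis. M b u *\<^sub>R b) \<bullet> e) *\<^sub>R e))) u0"
      by (intro loc_Lip_add)
    then have "loc_Lip O' A' u0" by (simp add: A'_def scaleR_diff_left)
    then show "\<exists>\<rho>>0. \<exists>L. ball u0 \<rho> \<subseteq> O' \<and> (\<forall>u\<in>ball u0 \<rho>. \<forall>u'\<in>ball u0 \<rho>. norm (A' u - A' u') \<le> L * norm (u - u'))"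
      by (simp add: loc_Lip_def)
  qed
  have "open (\<psi>i -` ball y \<delta>1)" by (rule open_vimage[OF open_ball cont_\<psi>i])
  moreover have "0 \<in> \<psi>i -` ball y \<delta>1" using \<delta>1 by simp
  ultimately obtain \<delta> where \<delta>: "\<delta> > 0" "cball 0 \<delta> \<subseteq> \<psi>i -` ball y \<delta>1"
    using open_contains_cball by blast
  define Us where "Us = \<psi>i -` UE"
  \<comment> \<open>The closure of \<open>UE\<close> makes \<open>K1\<close> compact, which turns
    the strict positivity of \<open>shear_pos\<close> into a uniform bound \<epsilon>.\<close>
  define K1 where "K1 = sphere 0 \<delta> \<inter> \<psi>i -` closure UE"
  have pos: "v \<bullet> e > 0" if v: "v \<in> K1" for v
  proof -
    have nv: "norm v = \<delta>" and uc: "\<psi>i v \<in> closure UE" using v by (auto simp: K1_def)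
    have "\<psi>i v \<in> ball y \<delta>1" using \<delta>(2) nv by auto
    then have "norm (\<psi>i v - y) < R" using \<delta>1(2) \<delta>0(2) by (auto simp: dist_norm norm_minus_commute)
    moreover have "\<psi>i v \<noteq> y"
    proof
      assume "\<psi>i v = y"
      then have "v = 0" using \<psi>\<psi>i[of v] by simp
      then show False using nv \<delta>(1) by simp
    qed
    ultimately have "shear (2 / R) e (\<psi>i v - y) \<bullet> e > 0"
      using outer[OF uc] by (intro shear_pos e R) auto
    then show ?thesis using \<psi>\<psi>i[of v] by (simp add: \<psi>_def C_def)
  qed
  have "\<exists>\<epsilon>>0. \<forall>v\<in>K1. \<epsilon> \<le> v \<bullet> e"
  proof (cases "K1 = {}")
    case False
    have "compact K1" unfolding K1_def
      by (intro compact_Int_closed compact_sphere closed_vimage closed_closure cont_\<psi>i)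
    moreover have "continuous_on K1 (\<lambda>v. v \<bullet> e)" by (intro continuous_intros)
    ultimately obtain v where "v \<in> K1" "\<forall>v'\<in>K1. v \<bullet> e \<le> v' \<bullet> e"
      using continuous_attains_inf[of K1 "\<lambda>v. v \<bullet> e"] False by blast
    then show ?thesis using pos by blast
  qed (auto intro: exI[of _ 1])
  then obtain \<epsilon> where \<epsilon>: "\<epsilon> > 0" "\<And>v. v \<in> K1 \<Longrightarrow> \<epsilon> \<le> v \<bullet> e" by blast
  show False
  proof (rule newman_core[OF \<delta>(1) \<epsilon>(1) e, where a = "A' \<circ> \<psi>i" and U = Us])
    show "continuous_on (cball 0 \<delta>) (A' \<circ> \<psi>i)"
      by (rule continuous_on_compose[OF cont_\<psi>i continuous_on_subset[OF A'_cont]]) (use \<delta>(2) in auto)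
    show "(A' \<circ> \<psi>i) v = v" if "v \<notin> Us" for v
      using that A'_off[of "\<psi>i v"] \<psi>\<psi>i by (simp add: Us_def)
    show "open Us" unfolding Us_def by (rule open_vimage[OF UE(1) cont_\<psi>i])
    show "0 \<in> closure Us"
    proof -
      have "\<psi> ` UE \<subseteq> closure Us" using \<psi>i\<psi> closure_subset by (fastforce simp: Us_def)
      then have "\<psi> ` closure UE \<subseteq> closure Us" by (rule image_closure_subset[OF cont_\<psi> closed_closure])
      then show ?thesis using yc \<psi>y by (metis image_subset_iff)
    qed
    show "negligible ((A' \<circ> \<psi>i) ` (Us \<inter> cball 0 \<delta>))"
      by (rule negligible_subset[OF neg]) (use \<delta>(2) in \<open>auto simp: Us_def O'_def\<close>)
    fix v assume v: "v \<in> Us" "norm v = \<delta>"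
    let ?u = "\<psi>i v"
    have "v \<in> K1" using v closure_subset by (auto simp: K1_def Us_def)
    then have 1: "\<epsilon> \<le> v \<bullet> e" by (rule \<epsilon>(2))
    have uO: "?u \<in> O'" using v \<delta>(2) by (auto simp: O'_def Us_def)
    have "\<psi> ?u \<bullet> e \<le> Ms e ?u"
      unfolding Ms_def orbit_sup_def
    proof (rule cSUP_upper2[of _ _ 0])
      show "bdd_above (range (\<lambda>t. \<psi> (cmap c (Fl (cinv c ?u, t))) \<bullet> e))"
        using f_bdd[OF O'P(1)[OF uO] e] by (auto intro!: bdd_aboveI[of _ "K * \<delta>0"])
      show "\<psi> ?u \<bullet> e \<le> \<psi> (cmap c (Fl (cinv c ?u, 0))) \<bullet> e"
        using HW(2)[of ?u] uO O'(2) by auto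
    qed simp
    then have "(A' \<circ> \<psi>i) v \<bullet> e \<ge> v \<bullet> e" using A'e[of ?u] uO O'(3) \<psi>\<psi>i[of v] by (auto simp: M_def)
    with 1 \<epsilon>(1) show "v \<bullet> e \<ge> 0 \<and> (A' \<circ> \<psi>i) v \<bullet> e \<ge> \<epsilon>" by linarith
  qed
qed

end

section \<open>Chart balls and the components of their complements of \<open>Z\<close>\<close>

lemma linear_diff_le_Basis:
  fixes D D' :: "'a::euclidean_space \<Rightarrow> 'b::real_normed_vector"
  assumes "linear D" "linear D'" "\<And>b. b \<in> Basis \<Longrightarrow> norm (D b - D' b) \<le> \<epsilon> / DIM('a)"
  shows "norm (D h - D' h) \<le> \<epsilon> * norm h"
proof -
  interpret L: linear "\<lambda>h. D h - D' h" using linear_compose_sub[OF assms(1,2)] .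
  have "D h - D' h = (\<lambda>h. D h - D' h) (\<Sum>b\<in>Basis. (h \<bullet> b) *\<^sub>R b)" by (simp add: euclidean_representation)
  also have "\<dots> = (\<Sum>b\<in>Basis. (h \<bullet> b) *\<^sub>R (D b - D' b))" by (subst L.sum) (simp add: L.scale)
  also have "norm \<dots> \<le> (\<Sum>b\<in>(Basis::'a set). norm h * (\<epsilon> / DIM('a)))"
  proof (rule sum_norm_le)
    fix b :: 'a assume b: "b \<in> Basis"
    show "norm ((h \<bullet> b) *\<^sub>R (D b - D' b)) \<le> norm h * (\<epsilon> / DIM('a))"
      unfolding norm_scaleR using Basis_le_norm[OF b, of h] assms(3)[OF b] by (intro mult_mono) auto
  qed
  also have "\<dots> = \<epsilon> * norm h" by simp
  finally show ?thesis .
qed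

context flow_manifold begin

lemma chart_ball:
  assumes "c \<in> A" "x \<in> cdom c" "open B" "x \<in> B"
  obtains r where "r > 0" "half_space \<inter> ball (cmap c x) r \<subseteq> cmap c ` cdom c"
    "{x' \<in> cdom c. cmap c x' \<in> ball (cmap c x) r} \<subseteq> B"
proof -
  have "openin (top_of_set half_space) (cimg c B)" by (rule cimg_openin[OF assms(1,3)])
  moreover have "cmap c x \<in> cimg c B" using assms by blast
  ultimately obtain r where r: "r > 0" "ball (cmap c x) r \<inter> half_space \<subseteq> cimg c B"
    unfolding openin_contains_ball by blast
  have hs: "cmap c ` cdom c \<subseteq> half_space" using openin_subset[OF cimg_UNIV_openin[OF assms(1)]] by simp
  show ?thesis
  proof (rule that[OF r(1)])
    show "half_space \<inter> ball (cmap c x) r \<subseteq> cmap c ` cdom c" using r(2) by blast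
    show "{x' \<in> cdom c. cmap c x' \<in> ball (cmap c x) r} \<subseteq> B"
    proof
      fix x' assume x': "x' \<in> {x' \<in> cdom c. cmap c x' \<in> ball (cmap c x) r}"
      then have "cmap c x' \<in> cimg c B" using r(2) hs by blast
      then obtain x'' where x'': "x'' \<in> cdom c" "x'' \<in> B" "cmap c x' = cmap c x''" by blast
      have "x' \<in> cdom c" using x' by blast
      from cmap_inj[OF assms(1) this x''(1,3)] x''(2) show "x' \<in> B" by simp
    qed
  qed
qed

lemma chart_ball_connected:
  assumes c: "c \<in> A" and "half_space \<inter> ball w r \<subseteq> cmap c ` cdom c"
  shows "connected {x \<in> cdom c. cmap c x \<in> ball w r}"
proof -
  have hs: "cmap c ` cdom c \<subseteq> half_space" using openin_subset[OF cimg_UNIV_openin[OF assms(1)]] by simp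
  have eq: "{x \<in> cdom c. cmap c x \<in> ball w r} = cinv c ` (half_space \<inter> ball w r)"
  proof (intro set_eqI iffI)
    fix x assume x: "x \<in> {x \<in> cdom c. cmap c x \<in> ball w r}"
    then have "cmap c x \<in> half_space \<inter> ball w r" "x = cinv c (cmap c x)" using hs c by auto
    then show "x \<in> cinv c ` (half_space \<inter> ball w r)" by blast
  next
    fix x assume "x \<in> cinv c ` (half_space \<inter> ball w r)"
    then obtain u where u: "u \<in> half_space \<inter> ball w r" "x = cinv c u" by blast
    then obtain x' where "x' \<in> cdom c" "u = cmap c x'" using assms(2) by blast
    then show "x \<in> {x \<in> cdom c. cmap c x \<in> ball w r}" using u c by auto
  qed
  have "convex (half_space :: 'e set)"
    unfolding half_space_def inner_commute[of _ normal_dir] by (rule convex_halfspace_ge)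
  then have "convex (half_space \<inter> ball w r)" by (rule convex_Int[OF _ convex_ball])
  then show ?thesis unfolding eq
    using connected_continuous_image[OF continuous_on_subset[OF continuous_on_cinv[OF c] assms(2)] convex_connected] by blast
qed

text \<open>Charts provide arbitrarily small connected (half-)balls, so the manifold is locally
  connected.\<close>

lemma open_connected_component:
  fixes S :: "'m set"
  assumes "open S" shows "open (connected_component_set S x1)"
proof (subst open_subopen, intro ballI)
  fix x assume x: "x \<in> connected_component_set S x1"
  then have xS: "x \<in> S" using connected_component_subset by blast
  obtain c where c: "c \<in> A" "x \<in> cdom c" using obtain_chart .
  obtain r where r: "r > 0" "half_space \<inter> ball (cmap c x) r \<subseteq> cmap c ` cdom c"
    "{x' \<in> cdom c. cmap c x' \<in> ball (cmap c x) r} \<subseteq> S"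
    using chart_ball[OF c assms xS] .
  let ?N = "{x' \<in> cdom c. cmap c x' \<in> ball (cmap c x) r}"
  have "?N \<subseteq> connected_component_set S x"
    by (rule connected_component_maximal[OF _ chart_ball_connected[OF c(1) r(2)] r(3)]) (use c r in auto)
  also have "connected_component_set S x = connected_component_set S x1"
    using connected_component_eq[OF x] .
  finally show "\<exists>T. open T \<and> x \<in> T \<and> T \<subseteq> connected_component_set S x1"
    using open_chart_preimage[OF c(1) open_ball] c r by (intro exI[of _ ?N]) auto
qed

lemma closure_connected_component:
  fixes S :: "'m set"
  assumes "open S" shows "S \<inter> closure (connected_component_set S x1) \<subseteq> connected_component_set S x1"
proof
  fix x assume x: "x \<in> S \<inter> closure (connected_component_set S x1)"
  have "open (connected_component_set S x)" by (rule open_connected_component[OF assms])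
  moreover have "x \<in> connected_component_set S x" using x by (simp add: connected_component_refl)
  ultimately have "connected_component_set S x \<inter> connected_component_set S x1 \<noteq> {}"
    using x open_Int_closure_eq_empty by blast
  then have "connected_component_set S x = connected_component_set S x1"
    using connected_component_nonoverlap[of S x x1] by blast
  then show "x \<in> connected_component_set S x1" using \<open>x \<in> connected_component_set S x\<close> by simp
qed

text \<open>Inside \<open>W0\<close> a component of \<open>W0 - Z\<close> can have boundary points
  only in \<open>Z\<close>, which is the form \<open>no_separation\<close> requires.\<close>

lemma connected_minus_zeros:
  assumes c: "c \<in> A" and wr: "half_space \<inter> ball w r \<subseteq> cmap c ` cdom c"
    and W0: "W0 = {x \<in> cdom c. cmap c x \<in> ball w r}" and x1: "x1 \<in> W0 - Z"
    and U: "U = connected_component_set (W0 - Z) x1"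
    and \<mu>: "period_fun U \<mu>" "\<And>x. x \<in> U \<Longrightarrow> \<mu> x \<noteq> 0"
    and shrink: "\<And>y. y \<in> W0 \<Longrightarrow> y \<in> Z \<Longrightarrow> orbits_shrink U y"
  shows "U = W0 - Z" "connected (W0 - Z)"
proof -
  have op: "open (W0 - Z)" unfolding W0
    using open_Diff[OF open_chart_preimage[OF c open_ball] closed_zeros] .
  have sub: "U \<subseteq> W0 - Z" unfolding U by (rule connected_component_subset)
  have "W0 - Z \<subseteq> U"
  proof (rule no_separation[OF c wr W0 _ sub _ _ \<mu> shrink])
    show "open U" unfolding U by (rule open_connected_component[OF op])
    have "x1 \<in> U" unfolding U using connected_component_refl[OF x1] by simp
    then show "U \<noteq> {}" by blast
    show "W0 \<inter> closure U \<subseteq> U \<union> Z" using closure_connected_component[OF op, of x1] unfolding U by blast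
  qed
  with sub show "U = W0 - Z" by blast
  then show "connected (W0 - Z)" using U connected_connected_component by metis
qed

text \<open>The number \<open>\<nu> x\<close> is a period of every point of the orbit of
  \<open>x\<close>. So \<open>\<nu> y - \<nu> x\<close> is a period function along the connected
  orbit, and it vanishes at \<open>x\<close>.\<close>

lemma period_fun_const_on_orbit:
  assumes "period_fun U \<nu>" "U \<inter> Z = {}" "\<And>t. Fl (x, t) \<in> U"
  shows "\<nu> (Fl (x, t)) = \<nu> x"
proof -
  let ?O = "range (\<lambda>t. Fl (x, t))"
  have sub: "?O \<subseteq> U" using assms(3) by blast
  have conn: "connected ?O" by (intro connected_continuous_image continuous_intros connected_UNIV)
  have x: "x \<in> ?O" using Fl_0[of x] by (metis rangeI)
  have "Fl (x, \<nu> x) = x" using assms(1) sub x by (auto simp: period_fun_def)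
  have "period_fun ?O (\<lambda>y. \<nu> y - \<nu> x)"
    unfolding period_fun_def
  proof (intro conjI ballI)
    show "continuous_on ?O (\<lambda>y. \<nu> y - \<nu> x)"
      using assms(1) sub by (auto simp: period_fun_def intro!: continuous_intros intro: continuous_on_subset)
    fix y assume y: "y \<in> ?O"
    then obtain t where t: "y = Fl (x, t)" by blast
    have "Fl (y, - \<nu> x) = Fl (Fl (x, - \<nu> x), t)" using t by (simp add: add.commute)
    also have "Fl (x, - \<nu> x) = x" using \<open>Fl (x, \<nu> x) = x\<close> Fl_Fl[of x "\<nu> x" "- \<nu> x"] by simp
    finally have "Fl (y, - \<nu> x) = y" using t by simp
    moreover have "Fl (y, \<nu> y) = y" using assms(1) sub y by (auto simp: period_fun_def)
    ultimately show "Fl (y, \<nu> y - \<nu> x) = y" using Fl_Fl[of y "\<nu> y" "- \<nu> x"] by simp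
  qed
  from period_fun_vanishes[OF conn _ this x, of "Fl (x, t)"] sub assms(2) show ?thesis by auto
qed

section \<open>Speed and periods near a zero of the field\<close>

lemma flow_chain_at:
  fixes g :: "'m \<Rightarrow> 'b::real_normed_vector"
  assumes "c \<in> A" "Fl (x, t) \<in> cdom c" "open U" "Fl (x, t) \<in> U"
    and "((g \<circ> cinv c) has_derivative D) (at (cmap c (Fl (x, t))) within cimg c U)"
  shows "((\<lambda>s. g (Fl (x, s))) has_vector_derivative D (F c (Fl (x, t)))) (at t)"
proof -
  have "((\<lambda>s. g (Fl (Fl (x, t), s))) has_vector_derivative D (F c (Fl (x, t)))) (at (t - t))"
    using flow_chain[OF assms] by simp
  moreover have "((\<lambda>s. s - t) has_vector_derivative 1) (at t)"
    by (auto intro!: derivative_eq_intros)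
  ultimately have "((\<lambda>s. g (Fl (Fl (x, t), s))) \<circ> (\<lambda>s. s - t) has_vector_derivative 1 *\<^sub>R D (F c (Fl (x, t)))) (at t)"
    by (intro vector_diff_chain_at) auto
  then show ?thesis by (simp add: o_def)
qed

lemma derivative_near:
  fixes g :: "'e \<Rightarrow> 'b::real_normed_vector"
  assumes c: "c \<in> A" and V: "open V" "z \<in> cdom c \<inter> V" and g: "smooth_on (cimg c V) g" and \<epsilon>: "\<epsilon> > 0"
  obtains N where "open N" "z \<in> N" "N \<subseteq> cdom c \<inter> V"
    "\<And>x h. x \<in> N \<Longrightarrow> norm (ddir (cimg c V) h g (cmap c x) - ddir (cimg c V) h g (cmap c z)) \<le> \<epsilon> * norm h"
proof -
  let ?W = "cdom c \<inter> V"
  have opW: "open ?W" using open_cdom[OF c] V by blast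
  let ?N = "\<lambda>b. ?W \<inter> (\<lambda>x. norm (ddir (cimg c V) b g (cmap c x) - ddir (cimg c V) b g (cmap c z))) -` {..< \<epsilon> / DIM('e)}"
  have opN: "open (?N b)" for b
  proof (rule continuous_open_preimage[OF _ opW])
    have "continuous_on ?W (\<lambda>x. ddir (cimg c V) b g (cmap c x))"
      by (rule continuous_on_compose2[OF smooth_on_continuous_ddir[OF g]
            continuous_on_subset[OF continuous_on_cmap[OF c]]]) auto
    then show "continuous_on ?W (\<lambda>x. norm (ddir (cimg c V) b g (cmap c x) - ddir (cimg c V) b g (cmap c z)))"
      by (intro continuous_intros)
  qed simp
  have "z \<in> ?N b" for b using V \<epsilon> by simp
  then have N: "open (\<Inter>b\<in>Basis. ?N b)" "z \<in> (\<Inter>b\<in>Basis. ?N b)"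
    by (simp only: open_INT[OF finite_Basis ballI, OF opN], blast)
  have sub: "(\<Inter>b\<in>Basis. ?N b) \<subseteq> ?W" using nonempty_Basis by blast
  have lin: "linear (frechet_derivative g (at (cmap c x) within cimg c V))" if "x \<in> ?W" for x
    using bounded_linear.linear[OF has_derivative_bounded_linear[OF smooth_on_has_derivative[OF g]]] that by blast
  have "norm (ddir (cimg c V) h g (cmap c x) - ddir (cimg c V) h g (cmap c z)) \<le> \<epsilon> * norm h"
    if x: "x \<in> (\<Inter>b\<in>Basis. ?N b)" for x h
  proof (rule linear_diff_le_Basis[OF lin lin])
    show "x \<in> ?W" "z \<in> ?W" using x sub V by auto
    fix b :: 'e assume "b \<in> Basis"
    then have "x \<in> ?N b" using x by blast
    then show "norm (ddir (cimg c V) b g (cmap c x) - ddir (cimg c V) b g (cmap c z)) \<le> \<epsilon> / DIM('e)" by simp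
  qed
  then show ?thesis by (intro that[OF N sub])
qed

definition field_deriv :: "('m, 'e) chart \<Rightarrow> 'm \<Rightarrow> 'e \<Rightarrow> 'e" where
  "field_deriv c x = frechet_derivative (F c \<circ> cinv c) (at (cmap c x) within cmap c ` cdom c)"

lemma field_deriv_orbit:
  assumes "c \<in> A" "Fl (x, s) \<in> cdom c"
  shows "((\<lambda>s. F c (Fl (x, s))) has_vector_derivative field_deriv c (Fl (x, s)) (F c (Fl (x, s)))) (at s)"
  using flow_chain_at[OF assms(1,2) open_UNIV UNIV_I, of "F c" "field_deriv c (Fl (x, s))"]
    smooth_on_has_derivative[OF field_smooth[OF assms(1)], of "cmap c (Fl (x, s))"] assms
  unfolding field_deriv_def by simp

text \<open>Gronwall's inequality for the squared speed, whose logarithmic derivative is at most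
  \<open>2 * K\<close> in absolute value. Multiplying by the matching exponential gives a monotone
  function; the sign of \<open>s\<close> decides which one.\<close>

lemma speed_growth:
  assumes c: "c \<in> A" and orb: "\<And>s. Fl (x, s) \<in> cdom c"
    and K: "\<And>s h. norm (field_deriv c (Fl (x, s)) h) \<le> K * norm h"
  shows "norm (F c (Fl (x, s))) \<le> exp (K * \<bar>s\<bar>) * norm (F c x)"
proof -
  define X where "X = (\<lambda>s. F c (Fl (x, s)))"
  define X' where "X' = (\<lambda>s. field_deriv c (Fl (x, s)) (X s))"
  have dX: "(X has_vector_derivative X' s) (at s)" for s
    unfolding X_def X'_def by (rule field_deriv_orbit[OF c orb])
  have dX2: "((\<lambda>s. X s \<bullet> X s) has_real_derivative 2 * (X s \<bullet> X' s)) (at s)" for s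
    using bounded_bilinear.has_vector_derivative[OF bounded_bilinear_inner dX dX, of s]
    by (simp add: has_real_derivative_iff_has_vector_derivative inner_commute)
  have bound: "\<bar>X s \<bullet> X' s\<bar> \<le> K * (X s \<bullet> X s)" for s
  proof -
    have "\<bar>X s \<bullet> X' s\<bar> \<le> norm (X s) * norm (X' s)" by (rule Cauchy_Schwarz_ineq2)
    also have "\<dots> \<le> norm (X s) * (K * norm (X s))" unfolding X'_def by (intro mult_left_mono K) simp
    finally show ?thesis by (simp add: power2_norm_eq_inner[symmetric] power2_eq_square algebra_simps)
  qed
  have D: "((\<lambda>s. (X s \<bullet> X s) * exp (k * s)) has_real_derivative (2 * (X s \<bullet> X' s) + k * (X s \<bullet> X s)) * exp (k * s)) (at s)" for s k
    by (rule derivative_eq_intros dX2 refl)+ (simp add: algebra_simps)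
  have "X s \<bullet> X s \<le> exp (2 * K * \<bar>s\<bar>) * (X 0 \<bullet> X 0)"
  proof (cases "s \<ge> 0")
    case True
    have "(X s \<bullet> X s) * exp (- (2 * K) * s) \<le> (X 0 \<bullet> X 0) * exp (- (2 * K) * 0)"
    proof (rule DERIV_nonpos_imp_nonincreasing[OF True])
      fix u :: real
      have "(2 * (X u \<bullet> X' u) + - (2 * K) * (X u \<bullet> X u)) * exp (- (2 * K) * u) \<le> 0"
        using bound[of u] by (intro mult_nonpos_nonneg) auto
      with D[of "- (2 * K)" u] show "\<exists>y. ((\<lambda>s. (X s \<bullet> X s) * exp (- (2 * K) * s)) has_real_derivative y) (at u) \<and> y \<le> 0"
        by blast
    qed
    then show ?thesis using True by (simp add: exp_minus field_simps)
  next
    case False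
    then have s: "s \<le> 0" by simp
    have "(X s \<bullet> X s) * exp (2 * K * s) \<le> (X 0 \<bullet> X 0) * exp (2 * K * 0)"
    proof (rule DERIV_nonneg_imp_nondecreasing[OF s])
      fix u :: real
      have "(2 * (X u \<bullet> X' u) + 2 * K * (X u \<bullet> X u)) * exp (2 * K * u) \<ge> 0"
        using bound[of u] by (intro mult_nonneg_nonneg) auto
      with D[of "2 * K" u] show "\<exists>y. ((\<lambda>s. (X s \<bullet> X s) * exp (2 * K * s)) has_real_derivative y) (at u) \<and> y \<ge> 0"
        by blast
    qed
    then show ?thesis using s by (simp add: exp_minus field_simps)
  qed
  also have "\<dots> = (exp (K * \<bar>s\<bar>) * norm (X 0))\<^sup>2"
    by (simp add: power_mult_distrib power2_norm_eq_inner exp_double[symmetric] mult.assoc)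
  finally have "(norm (X s))\<^sup>2 \<le> (exp (K * \<bar>s\<bar>) * norm (X 0))\<^sup>2" by (simp add: power2_norm_eq_inner)
  then have "norm (X s) \<le> exp (K * \<bar>s\<bar>) * norm (X 0)" by (rule power2_le_imp_le) simp
  then show ?thesis by (simp add: X_def)
qed

lemma field_deriv_near:
  assumes "c \<in> A" "z \<in> cdom c" "\<epsilon> > 0"
  obtains N where "open N" "z \<in> N" "N \<subseteq> cdom c"
    "\<And>x h. x \<in> N \<Longrightarrow> norm (field_deriv c x h - field_deriv c z h) \<le> \<epsilon> * norm h"
proof -
  have 1: "z \<in> cdom c \<inter> UNIV" using assms(2) by simp
  have 2: "smooth_on (cimg c UNIV) (F c \<circ> cinv c)" using field_smooth[OF assms(1)] by simp
  show ?thesis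
  proof (rule derivative_near[OF assms(1) open_UNIV 1 2 assms(3)])
    fix N assume "open N" "z \<in> N" "N \<subseteq> cdom c \<inter> UNIV"
      "\<And>x h. x \<in> N \<Longrightarrow> norm (ddir (cimg c UNIV) h (F c \<circ> cinv c) (cmap c x)
        - ddir (cimg c UNIV) h (F c \<circ> cinv c) (cmap c z)) \<le> \<epsilon> * norm h"
    then show thesis by (intro that[of N]) (simp_all add: field_deriv_def)
  qed
qed

text \<open>If the period stayed bounded, the velocity would keep a nearly constant direction along the
  orbit.\<close>
lemma one_jet_vanishes_periods:
  assumes c: "c \<in> A" "z \<in> cdom c" and jet: "one_jet_vanishes A F z"
    and U: "U \<inter> Z = {}" and shrink: "orbits_shrink U z" and \<nu>: "period_fun U \<nu>" "\<And>x. x \<in> U \<Longrightarrow> \<nu> x \<noteq> 0"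
  obtains N where "open N" "z \<in> N" "\<And>x. x \<in> U \<Longrightarrow> x \<in> N \<Longrightarrow> \<bar>\<nu> x\<bar> > M"
proof -
  define M' where "M' = \<bar>M\<bar> + 1"
  have M': "M' > 0" "M < M'" by (auto simp: M'_def)
  \<comment> \<open>Over a period of at most \<open>M'\<close> the speed grows at most by the factor
    \<open>exp (1/3)\<close>, so the velocity changes at most by \<open>(1/3) * exp (1/3)\<close>
    times its initial norm. This is below that norm because \<open>exp (1/3) < 3\<close>.\<close>
  define K where "K = 1 / (3 * M')"
  have K: "K > 0" using M' by (simp add: K_def)
  have "((F c \<circ> cinv c) has_derivative (\<lambda>_. 0)) (at (cmap c z) within cmap c ` cdom c)"
    using jet c unfolding one_jet_vanishes_def by blast
  then have "field_deriv c z = (\<lambda>_. 0)"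
    unfolding field_deriv_def using thick_cimg[OF c(1) open_UNIV] c(2)
    by (intro thick_frechet_derivative) auto
  then obtain N1 where N1: "open N1" "z \<in> N1" "N1 \<subseteq> cdom c"
    "\<And>x h. x \<in> N1 \<Longrightarrow> norm (field_deriv c x h) \<le> K * norm h"
    using field_deriv_near[OF c K] by (metis diff_zero)
  obtain N where N: "open N" "z \<in> N" "\<And>x t. x \<in> U \<Longrightarrow> x \<in> N \<Longrightarrow> Fl (x, t) \<in> N1"
    using orbits_shrinkD[OF shrink N1(1,2)] by metis
  have "\<bar>\<nu> x\<bar> > M" if x: "x \<in> U" "x \<in> N" for x
  proof (rule ccontr)
    assume "\<not> \<bar>\<nu> x\<bar> > M"
    define p where "p = \<bar>\<nu> x\<bar>"
    have p: "0 < p" "p \<le> M'" using \<open>\<not> \<bar>\<nu> x\<bar> > M\<close> \<nu>(2)[OF x(1)] M' by (auto simp: p_def)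
    have "Fl (x, \<nu> x) = x" using \<nu>(1) x by (simp add: period_fun_def)
    then have per: "Fl (x, p) = x"
      using period_int[of x "\<nu> x" "-1"] by (simp add: p_def abs_if)
    have orb: "Fl (x, s) \<in> cdom c" for s using N(3)[OF x] N1(3) by blast
    have dK: "norm (field_deriv c (Fl (x, s)) h) \<le> K * norm h" for s h using N1(4) N(3)[OF x] by blast
    have nz: "F c x \<noteq> 0" using x U zeros_iff[OF c(1), of x] orb[of 0] by auto
    have KM: "K * M' = 1/3" using M' by (simp add: K_def)
    have speed: "norm (F c (Fl (x, s))) \<le> exp (1/3) * norm (F c x)" if "s \<in> {0..p}" for s
    proof -
      have "K * \<bar>s\<bar> \<le> K * M'" using that p K by (intro mult_left_mono) auto
      then have "exp (K * \<bar>s\<bar>) \<le> exp (1/3)" using KM by simp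
      then have "exp (K * \<bar>s\<bar>) * norm (F c x) \<le> exp (1/3) * norm (F c x)" by (intro mult_right_mono) auto
      then show ?thesis using speed_growth[OF c(1) orb dK, of s] by linarith
    qed
    have diff: "norm (F c (Fl (x, s)) - F c (Fl (x, 0))) \<le> (K * (exp (1/3) * norm (F c x))) * norm (s - 0)"
      if s: "s \<in> {0..p}" for s
    proof (rule differentiable_bound[where S = "{0..p}"])
      show "((\<lambda>s. F c (Fl (x, s))) has_derivative (\<lambda>h. h *\<^sub>R field_deriv c (Fl (x, u)) (F c (Fl (x, u))))) (at u within {0..p})" for u
        using field_deriv_orbit[OF c(1) orb] unfolding has_vector_derivative_def
        by (rule has_derivative_at_withinI)
      show "onorm (\<lambda>h::real. h *\<^sub>R field_deriv c (Fl (x, u)) (F c (Fl (x, u)))) \<le> K * (exp (1/3) * norm (F c x))"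
        if "u \<in> {0..p}" for u
      proof (rule onorm_le)
        fix h :: real
        have "norm (field_deriv c (Fl (x, u)) (F c (Fl (x, u)))) \<le> K * norm (F c (Fl (x, u)))" by (rule dK)
        also have "\<dots> \<le> K * (exp (1/3) * norm (F c x))" using speed[OF that] K by (intro mult_left_mono) auto
        finally show "norm (h *\<^sub>R field_deriv c (Fl (x, u)) (F c (Fl (x, u)))) \<le> K * (exp (1/3) * norm (F c x)) * norm h"
          by (simp add: mult.commute mult_left_mono)
      qed
    qed (use s p in auto)
    have e3: "exp (1/3 :: real) < 3"
    proof -
      have "exp (1/3 :: real) < exp 1" by simp
      then show ?thesis using exp_le by linarith
    qed
    have "F c (Fl (x, s)) \<bullet> F c x > 0" if s: "s \<in> {0..p}" for s
    proof -
      have "norm (F c (Fl (x, s)) - F c x) \<le> (K * s) * exp (1/3) * norm (F c x)"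
        using diff[OF s] s by (simp add: algebra_simps)
      also have "\<dots> \<le> (1/3) * exp (1/3) * norm (F c x)"
        using mult_left_mono[of s M' K] KM s p K by (intro mult_right_mono) auto
      also have "\<dots> < norm (F c x)" using e3 nz by simp
      finally have lt: "norm (F c (Fl (x, s)) - F c x) < norm (F c x)" .
      have "F c (Fl (x, s)) \<bullet> F c x = (F c (Fl (x, s)) - F c x) \<bullet> F c x + F c x \<bullet> F c x"
        by (simp add: inner_diff_left)
      moreover have "\<bar>(F c (Fl (x, s)) - F c x) \<bullet> F c x\<bar> \<le> norm (F c (Fl (x, s)) - F c x) * norm (F c x)"
        by (rule Cauchy_Schwarz_ineq2)
      moreover have "norm (F c (Fl (x, s)) - F c x) * norm (F c x) < norm (F c x) * norm (F c x)"
        using lt nz by (intro mult_strict_right_mono) auto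
      moreover have "F c x \<bullet> F c x = norm (F c x) * norm (F c x)"
        by (simp add: power2_norm_eq_inner[symmetric] power2_eq_square)
      ultimately show ?thesis by linarith
    qed
    then have "Fl (x, 0) \<noteq> Fl (x, p)" using no_return[OF c(1) p(1)] orb by blast
    then show False using per by simp
  qed
  with N that show ?thesis by blast
qed

end

section \<open>Deformations\<close>

text \<open>No continuity in \<open>\<tau>\<close> is required of the shift functions \<open>a \<tau>\<close>.\<close>
locale flow_deformation = flow_manifold A F Fl
  for A :: "('m::{t2_space,second_countable_topology}, 'e::euclidean_space) chart set"
    and F :: "('m, 'e) chart \<Rightarrow> 'm \<Rightarrow> 'e"
    and Fl :: "'m \<times> real \<Rightarrow> 'm" +
  fixes V :: "'m set" and T :: "'t::topological_space set" and \<tau>\<^sub>0 :: 't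
    and \<Omega> :: "'m \<times> 't \<Rightarrow> 'm" and \<alpha> :: "'m \<Rightarrow> real" and \<Lambda> :: "'m \<times> 't \<Rightarrow> real"
    and a :: "'t \<Rightarrow> 'm \<Rightarrow> real"
  assumes open_V: "open V"
    and T: "compact T" "connected T" "\<tau>\<^sub>0 \<in> T"
    and \<Omega>_cont: "continuous_on (V \<times> T) \<Omega>"
    and a_smooth: "\<tau> \<in> T \<Longrightarrow> smooth_fun A V (a \<tau>)"
    and a_shift: "\<tau> \<in> T \<Longrightarrow> x \<in> V \<Longrightarrow> \<Omega> (x, \<tau>) = Fl (x, a \<tau> x)"
    and \<alpha>_smooth: "smooth_fun A V \<alpha>"
    and \<Lambda>_cont: "continuous_on ((V - Z) \<times> T) \<Lambda>"
    and \<Lambda>_shift: "\<tau> \<in> T \<Longrightarrow> x \<in> V - Z \<Longrightarrow> \<Omega> (x, \<tau>) = Fl (x, \<Lambda> (x, \<tau>))"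
    and \<Lambda>_init: "x \<in> V - Z \<Longrightarrow> \<Lambda> (x, \<tau>\<^sub>0) = \<alpha> x"
begin

definition mu :: "'t \<Rightarrow> 'm \<Rightarrow> real" where
  "mu \<tau> x = \<Lambda> (x, \<tau>) - a \<tau> x"

lemma a_cont: "\<tau> \<in> T \<Longrightarrow> continuous_on V (a \<tau>)"
  by (rule smooth_fun_continuous[OF open_V a_smooth])

lemma \<alpha>_cont: "continuous_on V \<alpha>"
  by (rule smooth_fun_continuous[OF open_V \<alpha>_smooth])

lemma period_mu: assumes "\<tau> \<in> T" shows "period_fun (V - Z) (mu \<tau>)"
  unfolding period_fun_def mu_def
proof (intro conjI ballI)
  have "continuous_on (V - Z) (\<lambda>x. \<Lambda> (x, \<tau>))"
    by (rule continuous_on_compose2[OF \<Lambda>_cont]) (use assms in \<open>auto intro!: continuous_intros\<close>)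
  moreover have "continuous_on (V - Z) (a \<tau>)"
    by (rule continuous_on_subset[OF a_cont[OF assms]]) blast
  ultimately show "continuous_on (V - Z) (\<lambda>x. \<Lambda> (x, \<tau>) - a \<tau> x)" by (rule continuous_on_diff)
  fix x assume x: "x \<in> V - Z"
  have "Fl (x, \<Lambda> (x, \<tau>)) = Fl (x, a \<tau> x)" using \<Lambda>_shift[OF assms x] a_shift[OF assms] x by simp
  then have "Fl (Fl (x, \<Lambda> (x, \<tau>)), - a \<tau> x) = Fl (Fl (x, a \<tau> x), - a \<tau> x)" by simp
  then show "Fl (x, \<Lambda> (x, \<tau>) - a \<tau> x) = x" by simp
qed

lemma \<Omega>_fixed: "y \<in> V \<Longrightarrow> y \<in> Z \<Longrightarrow> \<tau> \<in> T \<Longrightarrow> \<Omega> (y, \<tau>) = y"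
  using a_shift zero_fixed by simp

lemma connected_\<Lambda>:
  assumes "S \<subseteq> T" "connected S" "x \<in> V - Z"
  shows "connected ((\<lambda>\<sigma>. \<Lambda> (x, \<sigma>)) ` S)"
proof (rule connected_continuous_image[OF _ assms(2)])
  show "continuous_on S (\<lambda>\<sigma>. \<Lambda> (x, \<sigma>))"
    by (rule continuous_on_compose2[OF \<Lambda>_cont]) (use assms in \<open>auto intro!: continuous_intros\<close>)
qed

text \<open>If \<open>mu \<tau> x \<noteq> 0\<close>, then \<open>\<Lambda> (x, _)\<close> runs through a whole period, so the orbit of \<open>x\<close> is swept out
  by points \<open>\<Omega> (x, \<sigma>)\<close>; these stay close to \<open>y\<close> uniformly in \<open>\<sigma>\<close> because \<open>T\<close> is compact.\<close>
lemma escape: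
  assumes y: "y \<in> V" "y \<in> Z" and B: "open B" "y \<in> B" and \<tau>: "\<tau> \<in> T"
  obtains B' where "open B'" "y \<in> B'" "\<And>x t. x \<in> V - Z \<Longrightarrow> x \<in> B' \<Longrightarrow> mu \<tau> x \<noteq> 0 \<Longrightarrow> Fl (x, t) \<in> B"
proof -
  have "openin (top_of_set (V \<times> T)) ((V \<times> T) \<inter> \<Omega> -` B)"
    by (rule continuous_openin_preimage_gen[OF \<Omega>_cont B(1)])
  then obtain Q where Q: "open Q" "(V \<times> T) \<inter> \<Omega> -` B = (V \<times> T) \<inter> Q" unfolding openin_open by blast
  have "{y} \<times> T \<subseteq> Q"
  proof
    fix q assume "q \<in> {y} \<times> T"
    then have "q \<in> (V \<times> T) \<inter> \<Omega> -` B" using y B \<Omega>_fixed by auto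
    then show "q \<in> Q" using Q by blast
  qed
  then have "\<exists>X. y \<in> X \<and> open X \<and> X \<times> T \<subseteq> Q"
    by (rule Elementary_Topology.tube_lemma[OF T(1) Q(1)])
  then obtain X0 where X0: "y \<in> X0" "open X0" "X0 \<times> T \<subseteq> Q" by blast
  have \<Omega>B: "\<Omega> (x, \<sigma>) \<in> B" if "x \<in> X0" "x \<in> V" "\<sigma> \<in> T" for x \<sigma>
  proof -
    have "(x, \<sigma>) \<in> (V \<times> T) \<inter> Q" using that X0(3) by blast
    then show ?thesis using Q(2) by blast
  qed
  define M where "M = 1 + \<bar>\<alpha> y\<bar> + \<bar>a \<tau> y\<bar>"
  obtain X1 where X1: "open X1" "y \<in> X1" "\<forall>x\<in>X1. \<forall>t. \<bar>t\<bar> \<le> M \<longrightarrow> Fl (x, t) \<in> B"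
    using bounded_time_tube[OF y(2) B] by blast
  define X2 where "X2 = V \<inter> (\<lambda>x. \<bar>\<alpha> x\<bar> + \<bar>a \<tau> x\<bar>) -` {..<M}"
  have X2: "open X2" "y \<in> X2"
  proof -
    show "open X2" unfolding X2_def
      by (rule continuous_open_preimage[OF _ open_V]) (auto intro!: continuous_intros \<alpha>_cont a_cont \<tau>)
    show "y \<in> X2" using y by (simp add: X2_def M_def)
  qed
  have "Fl (x, t) \<in> B" if x: "x \<in> V - Z" "x \<in> X0 \<inter> X1 \<inter> X2" and m: "mu \<tau> x \<noteq> 0" for x t
  proof -
    have bd: "\<bar>\<alpha> x\<bar> \<le> M" "\<bar>a \<tau> x\<bar> \<le> M" using x by (auto simp: X2_def)
    let ?m = "mu \<tau> x"
    have per: "Fl (x, ?m) = x" using period_mu[OF \<tau>] x by (simp add: period_fun_def)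
    define I where "I = (\<lambda>\<sigma>. \<Lambda> (x, \<sigma>)) ` T"
    have I: "connected I" unfolding I_def by (rule connected_\<Lambda>[OF order_refl T(2) x(1)])
    have I0: "\<alpha> x \<in> I" unfolding I_def using T(3) \<Lambda>_init[OF x(1)] by (intro image_eqI[of _ _ \<tau>\<^sub>0]) auto
    have I1: "?m + a \<tau> x \<in> I" unfolding I_def using \<tau> by (intro image_eqI[of _ _ \<tau>]) (auto simp: mu_def)
    \<comment> \<open>\<open>I\<close> joins \<open>\<alpha> x\<close> to
      \<open>?m + a \<tau> x\<close>. Two segments of bounded length complete it to a connected set
      containing 0 and \<open>?m\<close>, hence a whole period; bounded times move \<open>x\<close>
      only a little.\<close>
    have "connected (closed_segment 0 (\<alpha> x) \<union> I)"
      by (rule connected_Un[OF connected_segment(1) I]) (use I0 in auto)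
    then have J: "connected (closed_segment ?m (?m + a \<tau> x) \<union> (closed_segment 0 (\<alpha> x) \<union> I))"
      by (rule connected_Un[OF connected_segment(1)]) (use I1 in auto)
    obtain s where s: "s \<in> closed_segment 0 ?m" "Fl (x, t) = Fl (x, s)" using orbit_reduce[OF per m] by blast
    have "s \<in> closed_segment ?m (?m + a \<tau> x) \<union> (closed_segment 0 (\<alpha> x) \<union> I)"
    proof (cases "?m \<ge> 0")
      case True
      then have "0 \<le> s" "s \<le> ?m" using s(1) by (auto simp: closed_segment_eq_real_ivl)
      then show ?thesis using connectedD_interval[OF J, of 0 ?m s] by simp
    next
      case False
      then have "?m \<le> s" "s \<le> 0" using s(1) by (auto simp: closed_segment_eq_real_ivl)
      then show ?thesis using connectedD_interval[OF J, of ?m 0 s] by simp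
    qed
    then consider "s \<in> closed_segment ?m (?m + a \<tau> x)" | "s \<in> closed_segment 0 (\<alpha> x)" | "s \<in> I" by blast
    then have "Fl (x, s) \<in> B"
    proof cases
      case 1
      then have "\<bar>s - ?m\<bar> \<le> M" using bd by (auto simp: closed_segment_eq_real_ivl split: if_splits)
      moreover have "Fl (x, s) = Fl (Fl (x, ?m), s - ?m)" by simp
      ultimately show ?thesis using X1(3) x per by simp
    next
      case 2
      then have "\<bar>s\<bar> \<le> M" using bd by (auto simp: closed_segment_eq_real_ivl split: if_splits)
      then show ?thesis using X1(3) x by simp
    next
      case 3
      then obtain \<sigma> where "\<sigma> \<in> T" "s = \<Lambda> (x, \<sigma>)" unfolding I_def by blast
      then have "Fl (x, s) = \<Omega> (x, \<sigma>)" using \<Lambda>_shift x by simp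
      then show ?thesis using \<Omega>B x \<open>\<sigma> \<in> T\<close> by simp
    qed
    then show ?thesis using s by simp
  qed
  then show ?thesis using X0 X1 X2 by (intro that[of "X0 \<inter> X1 \<inter> X2"]) auto
qed

text \<open>By rigidity a single nonzero value keeps \<open>mu \<tau>\<close> nonzero on the whole
  component of \<open>x1\<close>. There \<open>escape\<close> gives shrinking orbits at every zero
  of \<open>W0\<close>, and then the component is everything.\<close>

lemma dichotomy:
  assumes c: "c \<in> A" and wr: "half_space \<inter> ball w r \<subseteq> cmap c ` cdom c"
    and W0: "W0 = {x \<in> cdom c. cmap c x \<in> ball w r}" "W0 \<subseteq> V"
    and \<tau>: "\<tau> \<in> T" and x1: "x1 \<in> W0 - Z" "mu \<tau> x1 \<noteq> 0"
  shows "connected (W0 - Z)" "\<And>x. x \<in> W0 - Z \<Longrightarrow> mu \<tau> x \<noteq> 0"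
    "\<And>y. y \<in> W0 \<Longrightarrow> y \<in> Z \<Longrightarrow> orbits_shrink (W0 - Z) y"
proof -
  define U where "U = connected_component_set (W0 - Z) x1"
  have sub: "U \<subseteq> W0 - Z" unfolding U_def by (rule connected_component_subset)
  then have subV: "U \<subseteq> V - Z" using W0(2) by blast
  have per: "period_fun U (mu \<tau>)" by (rule period_fun_subset[OF period_mu[OF \<tau>] subV])
  have x1U: "x1 \<in> U" unfolding U_def using connected_component_refl[OF x1(1)] by simp
  have conn: "connected U" unfolding U_def by (rule connected_connected_component)
  have disj: "U \<inter> Z = {}" using sub by blast
  have nz: "mu \<tau> x \<noteq> 0" if "x \<in> U" for x
    using period_fun_vanishes[OF conn disj per that _ x1U] x1(2) by blast
  have shrink: "orbits_shrink U y" if y: "y \<in> W0" "y \<in> Z" for y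
    unfolding orbits_shrink_def
  proof (intro allI impI)
    fix B assume B: "open B \<and> y \<in> B"
    have yV: "y \<in> V" using y W0(2) by blast
    obtain B' where B': "open B'" "y \<in> B'"
      "\<And>x t. x \<in> V - Z \<Longrightarrow> x \<in> B' \<Longrightarrow> mu \<tau> x \<noteq> 0 \<Longrightarrow> Fl (x, t) \<in> B"
      using escape[OF yV y(2) B[THEN conjunct1] B[THEN conjunct2] \<tau>] by metis
    have "Fl (x, t) \<in> B" if "x \<in> U \<inter> B'" for x t using that B'(3)[of x t] nz[of x] subV by blast
    with B'(1,2) show "\<exists>B'. open B' \<and> y \<in> B' \<and> (\<forall>x\<in>U \<inter> B'. \<forall>t. Fl (x, t) \<in> B)" by blast
  qed
  note U = connected_minus_zeros[OF c wr W0(1) x1(1) U_def per nz shrink]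
  show "connected (W0 - Z)" by (rule U(2))
  show "mu \<tau> x \<noteq> 0" if "x \<in> W0 - Z" for x using nz that U(1) by blast
  show "orbits_shrink (W0 - Z) y" if "y \<in> W0" "y \<in> Z" for y using shrink[OF that] U(1) by simp
qed

text \<open>The extension is \<open>a \<tau> + \<nu>\<close>. At zeros it satisfies the shift
  identity whatever its value, because the flow fixes them.\<close>

lemma extension:
  assumes W: "open W" "W \<subseteq> V" and \<tau>: "\<tau> \<in> T" and \<nu>: "smooth_fun A W \<nu>"
    and eq: "\<And>x. x \<in> W - Z \<Longrightarrow> mu \<tau> x = \<nu> x"
  shows "\<exists>L. smooth_fun A W L \<and> (\<forall>x\<in>W - Z. L x = \<Lambda> (x, \<tau>)) \<and> (\<forall>x\<in>W. \<Omega> (x, \<tau>) = shift_map Fl L x)"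
proof (intro exI conjI ballI)
  let ?L = "\<lambda>x. a \<tau> x + \<nu> x"
  show "smooth_fun A W ?L" by (intro smooth_fun_add W smooth_fun_subset[OF a_smooth[OF \<tau>]] \<nu>)
  show L: "?L x = \<Lambda> (x, \<tau>)" if "x \<in> W - Z" for x using eq[OF that] by (simp add: mu_def)
  show "\<Omega> (x, \<tau>) = shift_map Fl ?L x" if x: "x \<in> W" for x
  proof (cases "x \<in> Z")
    case True
    then show ?thesis using \<Omega>_fixed[OF _ True \<tau>] x W zero_fixed[OF True] by (auto simp: shift_map_def)
  next
    case False
    then have "x \<in> V - Z" using x W by blast
    from \<Lambda>_shift[OF \<tau> this] L[of x] x False show ?thesis by (simp add: shift_map_def)
  qed
qed

section \<open>The derivative of the deformation in a chart\<close>

definition chart_deriv :: "('m, 'e) chart \<Rightarrow> 't \<Rightarrow> 'm \<Rightarrow> 'e \<Rightarrow> 'e" where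
  "chart_deriv c \<tau> x = frechet_derivative (cmap c \<circ> (\<lambda>y. \<Omega> (y, \<tau>)) \<circ> cinv c)
     (at (cmap c x) within cmap c ` (cdom c \<inter> V \<inter> (\<lambda>y. \<Omega> (y, \<tau>)) -` cdom c))"

definition chart_deriv_dom :: "('m, 'e) chart \<Rightarrow> ('m \<times> 't) set" where
  "chart_deriv_dom c = {(x, \<tau>). x \<in> V \<and> \<tau> \<in> T \<and> x \<in> cdom c \<and> \<Omega> (x, \<tau>) \<in> cdom c}"

text \<open>\<open>chart_deriv\<close> applied to \<open>v\<close> is the jet coordinate of the
  one-entry list \<open>[v]\<close>, taken within the same set as in \<open>jet\<close>. Open
  conditions on it are therefore subbasic in the jet topology of any order at least 1. One chart
  serves as source and target because it is used near a fixed point.\<close>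

lemma continuous_chart_deriv:
  assumes "deformation A k V T \<H> \<Omega>" "1 \<le> k" and c: "c \<in> A"
  shows "continuous_on (chart_deriv_dom c) (\<lambda>(x, \<tau>). chart_deriv c \<tau> x v)"
proof -
  define J where "J = (\<lambda>n (x, \<tau>). jet A n V (\<lambda>y. \<Omega> (y, \<tau>)) x)"
  have "\<exists>n\<ge>1. continuous_map (top_of_set (V \<times> T)) (jet_space A n V) (J n)"
  proof (cases k)
    case (enat n)
    then have "n \<ge> 1" using assms(2) by (simp add: one_enat_def)
    then show ?thesis using assms(1) enat unfolding deformation_def J_def by auto
  next
    case infinity
    then show ?thesis using assms(1) unfolding deformation_def J_def by auto
  qed
  then obtain n where n: "n \<ge> 1" "continuous_map (top_of_set (V \<times> T)) (jet_space A n V) (J n)" by blast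
  show ?thesis
    unfolding continuous_openin_preimage_eq
  proof (intro allI impI)
    fix B :: "'e set" assume B: "open B"
    define OB where "OB = {(x::'m, y::'m, p). x \<in> cdom c \<and> y \<in> cdom c \<and> p c c [v] \<in> B}"
    define G where "G = ({{(x, y, p). x \<in> S \<and> y \<in> S'} | S S'. open S \<and> open S'} \<union>
          {{(x::'m, y::'m, p). x \<in> cdom c \<and> y \<in> cdom c' \<and> p c c' vs \<in> B} | c c' vs B.
             c \<in> A \<and> c' \<in> A \<and> length vs \<le> n \<and> open B} :: ('m, 'e) jet_data set set)"
    have "OB \<in> G" unfolding G_def OB_def using c B n(1) by (intro UnI2 CollectI exI[of _ c] exI[of _ "[v]"] exI[of _ B]) auto
    then have "openin (topology_generated_by G) OB" by (rule topology_generated_by_Basis)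
    then have opJ: "openin (jet_space A n V) ({jet A n V h x |h x. smooth_map A V h \<and> x \<in> V} \<inter> OB)"
      unfolding jet_space_def G_def[symmetric] by (subst Int_commute) (auto simp: openin_subtopology)
    have tsp: "topspace (jet_space A n V) \<subseteq> {jet A n V h x |h x. smooth_map A V h \<and> x \<in> V}"
      unfolding jet_space_def by simp
    have 1: "openin (top_of_set (V \<times> T)) {q \<in> V \<times> T. J n q \<in> {jet A n V h x |h x. smooth_map A V h \<and> x \<in> V} \<inter> OB}"
      using openin_continuous_map_preimage[OF n(2) opJ] by (simp only: topspace_euclidean_subtopology)
    have JS: "J n q \<in> {jet A n V h x |h x. smooth_map A V h \<and> x \<in> V}" if "q \<in> V \<times> T" for q
    proof -
      have "J n q \<in> topspace (jet_space A n V)"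
        using continuous_map_image_subset_topspace[OF n(2)] that by auto
      with tsp show ?thesis by blast
    qed
    have JO: "J n q \<in> OB \<longleftrightarrow> q \<in> chart_deriv_dom c \<and> (case q of (x, \<tau>) \<Rightarrow> chart_deriv c \<tau> x v) \<in> B"
      if "q \<in> V \<times> T" for q
      using that c n(1) by (cases q) (auto simp: J_def OB_def jet_def chart_deriv_dom_def chart_deriv_def)
    have "{q \<in> V \<times> T. J n q \<in> {jet A n V h x |h x. smooth_map A V h \<and> x \<in> V} \<inter> OB}
        = chart_deriv_dom c \<inter> (\<lambda>(x, \<tau>). chart_deriv c \<tau> x v) -` B" (is "?l = ?r")
    proof (rule set_eqI)
      fix q
      have "q \<in> V \<times> T" if "q \<in> ?r" using that by (auto simp: chart_deriv_dom_def)
      then show "q \<in> ?l \<longleftrightarrow> q \<in> ?r"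
        using JS[of q] JO[of q] unfolding mem_Collect_eq Int_iff vimage_eq by blast
    qed
    with 1 have "openin (top_of_set (V \<times> T)) (chart_deriv_dom c \<inter> (\<lambda>(x, \<tau>). chart_deriv c \<tau> x v) -` B)" by simp
    then show "openin (top_of_set (chart_deriv_dom c)) (chart_deriv_dom c \<inter> (\<lambda>(x, \<tau>). chart_deriv c \<tau> x v) -` B)"
      by (rule openin_subset_trans) (auto simp: chart_deriv_dom_def)
  qed
qed

text \<open>In coordinates \<Omega> is the flow after the smooth map sending \<open>w\<close> to
  \<open>(w, a \<tau> (cinv c w))\<close>. Only existence of the derivative is kept; its formula is
  discarded.\<close>

lemma chart_deriv_works:
  assumes c: "c \<in> A" and \<tau>: "\<tau> \<in> T" and x: "x \<in> cdom c" "x \<in> V" "\<Omega> (x, \<tau>) \<in> cdom c"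
  shows "((cmap c \<circ> (\<lambda>y. \<Omega> (y, \<tau>)) \<circ> cinv c) has_derivative chart_deriv c \<tau> x)
     (at (cmap c x) within cmap c ` (cdom c \<inter> V \<inter> (\<lambda>y. \<Omega> (y, \<tau>)) -` cdom c))"
proof -
  let ?S = "cmap c ` (cdom c \<inter> V \<inter> (\<lambda>y. \<Omega> (y, \<tau>)) -` cdom c)"
  let ?p = "\<lambda>w. (w, (a \<tau> \<circ> cinv c) w)"
  have "smooth_on (cimg c V) (a \<tau> \<circ> cinv c)" using a_smooth[OF \<tau>] c unfolding smooth_fun_def by blast
  then have "((a \<tau> \<circ> cinv c) has_derivative frechet_derivative (a \<tau> \<circ> cinv c) (at (cmap c x) within cimg c V))
      (at (cmap c x) within cimg c V)"
    by (rule smooth_on_has_derivative) (use x in blast)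
  then have 1: "(?p has_derivative (\<lambda>h. (h, frechet_derivative (a \<tau> \<circ> cinv c) (at (cmap c x) within cimg c V) h)))
      (at (cmap c x) within ?S)"
    by (intro has_derivative_Pair has_derivative_ident) (erule has_derivative_subset, blast)
  have im: "?p w \<in> flow_dom c c \<and> flow_map c c (?p w) = cmap c (\<Omega> (cinv c w, \<tau>))" if "w \<in> ?S" for w
  proof -
    obtain y where "y \<in> cdom c" "y \<in> V" "\<Omega> (y, \<tau>) \<in> cdom c" "w = cmap c y" using \<open>w \<in> ?S\<close> by blast
    then show ?thesis using a_shift[OF \<tau>] c by (simp add: flow_dom_def flow_map_def)
  qed
  have xS: "cmap c x \<in> ?S" using x by blast
  have "(flow_map c c has_derivative frechet_derivative (flow_map c c) (at (?p (cmap c x)) within flow_dom c c))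
      (at (?p (cmap c x)) within flow_dom c c)"
    by (rule smooth_on_has_derivative[OF flow_map_smooth[OF c c]]) (use im[OF xS] in blast)
  then have 2: "(flow_map c c has_derivative frechet_derivative (flow_map c c) (at (?p (cmap c x)) within flow_dom c c))
      (at (?p (cmap c x)) within ?p ` ?S)"
    by (rule has_derivative_subset) (use im in blast)
  have "((\<lambda>w. flow_map c c (?p w)) has_derivative
      (\<lambda>h. frechet_derivative (flow_map c c) (at (?p (cmap c x)) within flow_dom c c)
         (h, frechet_derivative (a \<tau> \<circ> cinv c) (at (cmap c x) within cimg c V) h))) (at (cmap c x) within ?S)"
    by (rule has_derivative_in_compose[OF 1 2])
  then have "((cmap c \<circ> (\<lambda>y. \<Omega> (y, \<tau>)) \<circ> cinv c) has_derivative
      (\<lambda>h. frechet_derivative (flow_map c c) (at (?p (cmap c x)) within flow_dom c c)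
         (h, frechet_derivative (a \<tau> \<circ> cinv c) (at (cmap c x) within cimg c V) h))) (at (cmap c x) within ?S)"
    by (rule has_derivative_transform[OF xS, rotated]) (use im in simp)
  then show ?thesis unfolding chart_deriv_def
    using frechet_derivative_works differentiableI by blast
qed

lemma open_\<Omega>_preimage:
  assumes "open B" "\<tau> \<in> T" shows "open (V \<inter> (\<lambda>y. \<Omega> (y, \<tau>)) -` B)"
proof (rule continuous_open_preimage[OF _ open_V assms(1)])
  show "continuous_on V (\<lambda>y. \<Omega> (y, \<tau>))"
    by (rule continuous_on_compose2[OF \<Omega>_cont]) (use assms in \<open>auto intro!: continuous_intros\<close>)
qed

text \<open>Each \<open>\<Omega> (_, \<tau>)\<close> maps orbits to orbits, so its derivative maps \<open>F\<close> to a multiple of \<open>F\<close>.\<close>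
lemma chart_deriv_field:
  assumes c: "c \<in> A" and \<tau>: "\<tau> \<in> T" and x: "x \<in> cdom c" "x \<in> V" "\<Omega> (x, \<tau>) \<in> cdom c"
  shows "chart_deriv c \<tau> x (F c x) =
    (1 + ddir (cimg c V) (F c x) (a \<tau> \<circ> cinv c) (cmap c x)) *\<^sub>R F c (\<Omega> (x, \<tau>))"
proof -
  let ?U = "V \<inter> (\<lambda>y. \<Omega> (y, \<tau>)) -` cdom c"
  let ?k = "ddir (cimg c V) (F c x) (a \<tau> \<circ> cinv c) (cmap c x)"
  have U: "open ?U" "x \<in> ?U" using open_\<Omega>_preimage[OF open_cdom[OF c] \<tau>] x by auto
  have "((\<lambda>y. cmap c (\<Omega> (y, \<tau>))) \<circ> cinv c has_derivative chart_deriv c \<tau> x) (at (cmap c x) within cimg c ?U)"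
    using chart_deriv_works[OF c \<tau> x] by (simp add: Int_assoc o_def)
  from flow_chain[OF c x(1) U this]
  have 1: "((\<lambda>s. cmap c (\<Omega> (Fl (x, s), \<tau>))) has_vector_derivative chart_deriv c \<tau> x (F c x)) (at 0)" .
  have sm: "smooth_on (cimg c V) (a \<tau> \<circ> cinv c)" using a_smooth[OF \<tau>] c unfolding smooth_fun_def by blast
  have "((a \<tau> \<circ> cinv c) has_derivative frechet_derivative (a \<tau> \<circ> cinv c) (at (cmap c x) within cimg c V))
      (at (cmap c x) within cimg c V)"
    by (rule smooth_on_has_derivative[OF sm]) (use x in blast)
  \<comment> \<open>Along the orbit \<open>\<Omega> (Fl (x, s), \<tau>) = Fl (x, s + a \<tau> (Fl
    (x, s)))\<close>. The factor \<open>1 + ?k\<close> is the rate of this reparametrised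
    time.\<close>
  from flow_chain[OF c x(1) open_V x(2) this]
  have "((\<lambda>s. s + a \<tau> (Fl (x, s))) has_vector_derivative (1 + ?k)) (at 0)"
    by (intro has_vector_derivative_add has_vector_derivative_id)
  moreover have "((\<lambda>t. cmap c (Fl (x, t))) has_vector_derivative F c (\<Omega> (x, \<tau>))) (at (0 + a \<tau> (Fl (x, 0))))"
    using velocity[OF c, of x "a \<tau> x"] a_shift[OF \<tau> x(2)] x(3) by simp
  ultimately have "((\<lambda>t. cmap c (Fl (x, t))) \<circ> (\<lambda>s. s + a \<tau> (Fl (x, s))) has_vector_derivative (1 + ?k) *\<^sub>R F c (\<Omega> (x, \<tau>))) (at 0)"
    by (rule vector_diff_chain_at)
  then have 2: "((\<lambda>s. cmap c (Fl (x, s + a \<tau> (Fl (x, s))))) has_vector_derivative (1 + ?k) *\<^sub>R F c (\<Omega> (x, \<tau>))) (at 0)"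
    by (simp add: o_def)
  have "((\<lambda>s. cmap c (\<Omega> (Fl (x, s), \<tau>))) has_vector_derivative (1 + ?k) *\<^sub>R F c (\<Omega> (x, \<tau>))) (at 0)"
  proof (rule has_vector_derivative_transform_within_open[OF 2 open_orbit_times[OF open_V]])
    show "0 \<in> {t. Fl (x, t) \<in> V}" using x by simp
    fix s assume "s \<in> {t. Fl (x, t) \<in> V}"
    then show "cmap c (Fl (x, s + a \<tau> (Fl (x, s)))) = cmap c (\<Omega> (Fl (x, s), \<tau>))" using a_shift[OF \<tau>] by simp
  qed
  with 1 show ?thesis by (rule vector_derivative_unique_at)
qed

lemma chart_deriv_near:
  assumes c: "c \<in> A" and cont: "\<And>v. continuous_on (chart_deriv_dom c) (\<lambda>(x, \<tau>). chart_deriv c \<tau> x v)"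
    and z: "z \<in> cdom c" "z \<in> V" "z \<in> Z" and \<tau>: "\<tau> \<in> T" and \<epsilon>: "\<epsilon> > 0"
  obtains N S where "open N" "z \<in> N" "open S" "\<tau> \<in> S" "N \<subseteq> cdom c \<inter> V"
    "\<And>x \<sigma>. x \<in> N \<Longrightarrow> \<sigma> \<in> S \<inter> T \<Longrightarrow> \<Omega> (x, \<sigma>) \<in> cdom c"
    "\<And>x \<sigma> h. x \<in> N \<Longrightarrow> \<sigma> \<in> S \<inter> T \<Longrightarrow> norm (chart_deriv c \<sigma> x h - chart_deriv c \<tau> x h) \<le> \<epsilon> * norm h"
proof -
  let ?D = "chart_deriv_dom c"
  let ?f = "\<lambda>v (x, \<tau>). chart_deriv c \<tau> x v"
  \<comment> \<open>Both derivatives at \<open>x\<close> are compared with the one at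
    \<open>(z, \<tau>)\<close>, hence the 2; the dimension comes from expanding in the
    basis.\<close>
  define e where "e = \<epsilon> / DIM('e) / 2"
  have e: "e > 0" using \<epsilon> by (simp add: e_def)
  have zD: "(z, \<tau>) \<in> ?D" using z \<tau> \<Omega>_fixed by (simp add: chart_deriv_dom_def)
  have "\<exists>Q. open Q \<and> (z, \<tau>) \<in> Q \<and> (\<forall>q\<in>Q \<inter> ?D. dist (?f b q) (?f b (z, \<tau>)) < e)" for b
  proof -
    have "openin (top_of_set ?D) (?D \<inter> ?f b -` ball (?f b (z, \<tau>)) e)"
      by (rule continuous_openin_preimage_gen[OF cont open_ball])
    then obtain Q where Q: "open Q" "?D \<inter> ?f b -` ball (?f b (z, \<tau>)) e = ?D \<inter> Q" unfolding openin_open by blast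
    have "(z, \<tau>) \<in> ?D \<inter> ?f b -` ball (?f b (z, \<tau>)) e" using zD e by simp
    then have "(z, \<tau>) \<in> Q" using Q(2) by blast
    moreover have "dist (?f b q) (?f b (z, \<tau>)) < e" if "q \<in> Q \<inter> ?D" for q
    proof -
      have "q \<in> ?D \<inter> ?f b -` ball (?f b (z, \<tau>)) e" using that Q(2) by blast
      then have "?f b q \<in> ball (?f b (z, \<tau>)) e" by blast
      then show ?thesis by (simp add: dist_commute)
    qed
    ultimately show ?thesis using Q(1) by blast
  qed
  then obtain Q where Q: "\<And>b. open (Q b)" "\<And>b. (z, \<tau>) \<in> Q b"
    "\<And>b q. q \<in> Q b \<inter> ?D \<Longrightarrow> dist (?f b q) (?f b (z, \<tau>)) < e" by metis
  have "openin (top_of_set (V \<times> T)) ((V \<times> T) \<inter> \<Omega> -` cdom c)"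
    by (rule continuous_openin_preimage_gen[OF \<Omega>_cont open_cdom[OF c]])
  then obtain P where P: "open P" "(V \<times> T) \<inter> \<Omega> -` cdom c = (V \<times> T) \<inter> P" unfolding openin_open by blast
  have "(z, \<tau>) \<in> (V \<times> T) \<inter> \<Omega> -` cdom c" using z \<tau> \<Omega>_fixed by simp
  then have zP: "(z, \<tau>) \<in> P" using P by blast
  define R where "R = (\<Inter>b\<in>(Basis::'e set). Q b) \<inter> P \<inter> ((cdom c \<inter> V) \<times> UNIV)"
  have "open R" unfolding R_def
    using Q(1) P(1) open_cdom[OF c] open_V by (intro open_Int open_INT open_Times finite_Basis ballI open_UNIV)
  moreover have "(z, \<tau>) \<in> R" using Q(2) zP z by (simp add: R_def)
  ultimately obtain N S where NS: "open N" "open S" "(z, \<tau>) \<in> N \<times> S" "N \<times> S \<subseteq> R"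
    by (rule open_prod_elim)
  have dom: "(x, \<sigma>) \<in> ?D" if "x \<in> N" "\<sigma> \<in> S \<inter> T" for x \<sigma>
  proof -
    have R: "(x, \<sigma>) \<in> R" using that NS(4) by blast
    then have "(x, \<sigma>) \<in> (V \<times> T) \<inter> P" using that by (auto simp: R_def)
    then have "(x, \<sigma>) \<in> (V \<times> T) \<inter> \<Omega> -` cdom c" using P(2) by blast
    with R show ?thesis by (auto simp: chart_deriv_dom_def R_def)
  qed
  show ?thesis
  proof (rule that[OF NS(1) _ NS(2)])
    show "z \<in> N" "\<tau> \<in> S" using NS(3) by auto
    then have zz: "z \<in> N" "\<tau> \<in> S \<inter> T" using \<tau> by auto
    show "N \<subseteq> cdom c \<inter> V" using NS(4) zz by (auto simp: R_def)
    show "\<Omega> (x, \<sigma>) \<in> cdom c" if "x \<in> N" "\<sigma> \<in> S \<inter> T" for x \<sigma>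
      using dom[OF that] by (simp add: chart_deriv_dom_def)
    show "norm (chart_deriv c \<sigma> x h - chart_deriv c \<tau> x h) \<le> \<epsilon> * norm h"
      if x: "x \<in> N" and \<sigma>: "\<sigma> \<in> S \<inter> T" for x \<sigma> h
    proof (rule linear_diff_le_Basis)
      have lin: "linear (chart_deriv c \<rho> x)" if "\<rho> \<in> S \<inter> T" for \<rho>
        using chart_deriv_works[OF c, of \<rho> x] dom[OF x that] that
        by (auto simp: chart_deriv_dom_def intro: bounded_linear.linear has_derivative_bounded_linear)
      show "linear (chart_deriv c \<sigma> x)" "linear (chart_deriv c \<tau> x)" using lin \<sigma> zz by auto
      fix b :: 'e assume b: "b \<in> Basis"
      have "(x, \<rho>) \<in> Q b \<inter> ?D" if "\<rho> \<in> S \<inter> T" for \<rho>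
        using dom[OF x that] NS(4) x that b by (auto simp: R_def)
      then have "dist (chart_deriv c \<rho> x b) (chart_deriv c \<tau> z b) < e" if "\<rho> \<in> S \<inter> T" for \<rho>
        using Q(3)[of "(x, \<rho>)" b] that by simp
      from this[OF \<sigma>] this[OF zz(2)] have "dist (chart_deriv c \<sigma> x b) (chart_deriv c \<tau> x b) < e + e"
        by (rule dist_triangle_less_add)
      then show "norm (chart_deriv c \<sigma> x b - chart_deriv c \<tau> x b) \<le> \<epsilon> / DIM('e)"
        by (simp add: e_def dist_norm)
    qed
  qed
qed

text \<open>Near \<open>z\<close> and for \<open>\<sigma>\<close> in a connected neighbourhood \<open>v\<close> of \<open>\<tau>'\<close>, the velocities at \<open>\<Omega> (x, \<sigma>)\<close> and
  \<open>\<Omega> (x, \<tau>')\<close> are not orthogonal. If \<open>\<nu> = mu \<tau> - mu \<tau>' \<noteq> 0\<close>, then \<open>\<Lambda> (x, _)\<close> runs on \<open>v\<close> through an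
  interval shorter than the period \<open>\<bar>\<nu> x\<bar>\<close> by a bounded amount only. As periods are large, any two
  points of the orbit are joined, in one of the two directions, by an arc contained in such an interval.\<close>
lemma mu_locally_constant:
  assumes c: "c \<in> A" and W0: "open W0" "W0 \<subseteq> V" and z: "z \<in> W0" "z \<in> cdom c" "z \<in> Z" "z \<in> closure (W0 - Z)"
    and conn: "connected (W0 - Z)" and shrink: "orbits_shrink (W0 - Z) z"
    and cont: "\<And>v. continuous_on (chart_deriv_dom c) (\<lambda>(x, \<tau>). chart_deriv c \<tau> x v)"
    and growth: "\<And>\<nu> M. period_fun (W0 - Z) \<nu> \<Longrightarrow> (\<And>x. x \<in> W0 - Z \<Longrightarrow> \<nu> x \<noteq> 0) \<Longrightarrow>
      \<exists>N. open N \<and> z \<in> N \<and> (\<forall>x\<in>(W0 - Z) \<inter> N. \<bar>\<nu> x\<bar> > M)"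
    and lpc: "locally path_connected T" and \<tau>': "\<tau>' \<in> T"
  shows "\<exists>u. openin (top_of_set T) u \<and> \<tau>' \<in> u \<and> (\<forall>\<tau>\<in>u. \<forall>x\<in>W0 - Z. mu \<tau> x = mu \<tau>' x)"
proof -
  define U where "U = W0 - Z"
  have UV: "U \<subseteq> V - Z" and UZ: "U \<inter> Z = {}" using W0 by (auto simp: U_def)
  have zV: "z \<in> V" using z W0 by blast
  have zcV: "z \<in> cdom c \<inter> V" using z zV by blast
  have F0: "F c z = 0" using z zeros_iff[OF c z(2)] by blast
  have sm: "smooth_on (cimg c V) (a \<tau>' \<circ> cinv c)" using a_smooth[OF \<tau>'] c unfolding smooth_fun_def by blast
  \<comment> \<open>Bounds the time by which \<open>\<Omega> (_, \<tau>')\<close> shifts points near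
    \<open>z\<close>, and with \<open>speed_growth\<close> the change of speed under this
    shift.\<close>
  define M0 where "M0 = \<bar>a \<tau>' z\<bar> + 1"
  define N1 where "N1 = V \<inter> (\<lambda>x. \<bar>a \<tau>' x\<bar>) -` {..<M0}"
  have N1: "open N1" "z \<in> N1"
  proof -
    show "open N1" unfolding N1_def
      by (rule continuous_open_preimage[OF _ open_V]) (auto intro!: continuous_intros a_cont \<tau>')
    show "z \<in> N1" using zV by (simp add: N1_def M0_def)
  qed
  obtain N2 where N2: "open N2" "z \<in> N2" "N2 \<subseteq> cdom c"
    "\<And>x h. x \<in> N2 \<Longrightarrow> norm (field_deriv c x h - field_deriv c z h) \<le> 1 * norm h"
    using field_deriv_near[OF c z(2) zero_less_one] by metis
  have "bounded_linear (field_deriv c z)"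
    unfolding field_deriv_def
    by (rule has_derivative_bounded_linear[OF smooth_on_has_derivative[OF field_smooth[OF c]]]) (use z in blast)
  then obtain K0 where K0: "K0 > 0" "\<And>h. norm (field_deriv c z h) \<le> norm h * K0"
    using bounded_linear.pos_bounded by blast
  define K where "K = K0 + 1"
  have K: "norm (field_deriv c x h) \<le> K * norm h" if "x \<in> N2" for x h
  proof -
    have "norm (field_deriv c x h) \<le> norm (field_deriv c x h - field_deriv c z h) + norm (field_deriv c z h)"
      using norm_triangle_ineq[of "field_deriv c x h - field_deriv c z h" "field_deriv c z h"] by simp
    then show ?thesis using N2(4)[OF that, of h] K0(2)[of h] by (simp add: K_def algebra_simps)
  qed
  let ?Da = "\<lambda>x h. ddir (cimg c V) h (a \<tau>' \<circ> cinv c) (cmap c x)"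
  obtain N3 where N3: "open N3" "z \<in> N3" "N3 \<subseteq> cdom c \<inter> V"
    "\<And>x h. x \<in> N3 \<Longrightarrow> norm (?Da x h - ?Da z h) \<le> 1 * norm h"
    using derivative_near[OF c open_V zcV sm zero_less_one] by metis
  have "bounded_linear (?Da z)"
    by (rule has_derivative_bounded_linear[OF smooth_on_has_derivative[OF sm]]) (use zcV in blast)
  then obtain C0 where C0: "C0 > 0" "\<And>h. norm (?Da z h) \<le> norm h * C0"
    using bounded_linear.pos_bounded by blast
  have Da: "\<bar>?Da x h\<bar> \<le> (C0 + 1) * norm h" if "x \<in> N3" for x h
    using N3(4)[OF that, of h] C0(2)[of h] by (simp add: algebra_simps)
  \<comment> \<open>As \<open>F\<close> vanishes at \<open>z\<close>, the derivative of
    \<open>a \<tau>'\<close> along \<open>F\<close> is below \<open>1/2\<close> here, so the factor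
    \<open>k2\<close> below is at least \<open>1/2\<close>.\<close>
  define N4 where "N4 = cdom c \<inter> (\<lambda>x. (C0 + 1) * norm (F c x)) -` {..<1/2}"
  have N4: "open N4" "z \<in> N4"
  proof -
    show "open N4" unfolding N4_def
      by (rule continuous_open_preimage[OF _ open_cdom[OF c]]) (auto intro!: continuous_intros field_continuous[OF c])
    show "z \<in> N4" using z F0 by (simp add: N4_def)
  qed
  \<comment> \<open>The velocity at \<open>\<Omega> (y, \<tau>')\<close> is at least
    \<open>exp (- (K * M0))\<close> times that at \<open>y\<close>, and \<open>k2\<close> costs a
    factor \<open>1/2\<close>. So the derivative at \<tau>' maps \<open>F\<close> to a vector of
    norm at least \<open>mm\<close> times that of \<open>F\<close>, and a perturbation of relative
    size \<open>mm / 2\<close> cannot make it orthogonal to the original.\<close>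
  define mm where "mm = exp (- (K * M0)) / 2"
  have mm: "mm > 0" "mm / 2 > 0" by (simp_all add: mm_def)
  obtain N5 S where N5: "open N5" "z \<in> N5" "open S" "\<tau>' \<in> S" "N5 \<subseteq> cdom c \<inter> V"
    "\<And>x \<sigma>. x \<in> N5 \<Longrightarrow> \<sigma> \<in> S \<inter> T \<Longrightarrow> \<Omega> (x, \<sigma>) \<in> cdom c"
    "\<And>x \<sigma> h. x \<in> N5 \<Longrightarrow> \<sigma> \<in> S \<inter> T \<Longrightarrow> norm (chart_deriv c \<sigma> x h - chart_deriv c \<tau>' x h) \<le> mm / 2 * norm h"
    using chart_deriv_near[OF c cont z(2) zV z(3) \<tau>' mm(2)] by metis
  have "openin (top_of_set T) (T \<inter> S)" using N5(3) by (simp add: openin_open_Int)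
  moreover have "\<tau>' \<in> T \<inter> S" using \<tau>' N5(4) by blast
  ultimately obtain u v where uv: "openin (top_of_set T) u" "path_connected v" "\<tau>' \<in> u" "u \<subseteq> v" "v \<subseteq> T \<inter> S"
    using lpc unfolding locally_def by metis
  have vT: "v \<subseteq> T" and connv: "connected v" and \<tau>'v: "\<tau>' \<in> v" and vST: "\<And>\<sigma>. \<sigma> \<in> v \<Longrightarrow> \<sigma> \<in> S \<inter> T"
    using uv path_connected_imp_connected by blast+
  have "mu \<tau> x0 = mu \<tau>' x0" if \<tau>u: "\<tau> \<in> u" and x0: "x0 \<in> U" for \<tau> x0
  proof (rule ccontr)
    assume ne: "mu \<tau> x0 \<noteq> mu \<tau>' x0"
    have \<tau>v: "\<tau> \<in> v" and \<tau>: "\<tau> \<in> T" using \<tau>u uv vT by blast+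
    define \<nu> where "\<nu> = (\<lambda>x. mu \<tau> x - mu \<tau>' x)"
    have per: "period_fun U \<nu>" "period_fun U (mu \<tau>')"
      unfolding \<nu>_def by (intro period_fun_diff period_fun_subset[OF period_mu UV] \<tau> \<tau>')+
    have nz: "\<nu> x \<noteq> 0" if "x \<in> U" for x
      using period_fun_vanishes[OF conn[folded U_def] UZ per(1) that _ x0] ne by (auto simp: \<nu>_def)
    \<comment> \<open>This bound and the neighbourhoods built on it may depend on \<tau>. Only the
      data behind \<open>nonorth\<close>, fixed before \<tau>, must be uniform over
      \<open>v\<close>.\<close>
    define Bd where "Bd = \<bar>a \<tau> z - a \<tau>' z\<bar> + 1"
    have Bd: "Bd > 0" by (simp add: Bd_def)
    define N6 where "N6 = V \<inter> (\<lambda>x. \<bar>a \<tau> x - a \<tau>' x\<bar>) -` {..<Bd}"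
    have N6: "open N6" "z \<in> N6"
    proof -
      show "open N6" unfolding N6_def
        by (rule continuous_open_preimage[OF _ open_V]) (auto intro!: continuous_intros a_cont \<tau> \<tau>')
      show "z \<in> N6" using zV by (simp add: N6_def Bd_def)
    qed
    \<comment> \<open>With a period \<open>p > 2 * Bd\<close> every arc of length between 0 and
      \<open>p\<close>, or its complementary arc, has length at most \<open>p - Bd\<close>.\<close>
    obtain N7 where N7: "open N7" "z \<in> N7" "\<And>x. x \<in> U \<Longrightarrow> x \<in> N7 \<Longrightarrow> \<bar>\<nu> x\<bar> > 2 * Bd"
      using growth[OF per(1)[unfolded U_def] nz[unfolded U_def], of "2 * Bd"] unfolding U_def by blast
    define NN where "NN = N1 \<inter> N2 \<inter> N3 \<inter> N4 \<inter> N5 \<inter> N6 \<inter> W0"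
    have NN: "open NN" "z \<in> NN"
      unfolding NN_def
      by (intro open_Int IntI N1 N2(1,2) N3(1,2) N4 N5(1,2) N6 W0(1) z(1))+
    obtain B' where B': "open B'" "z \<in> B'" "\<And>x t. x \<in> U \<Longrightarrow> x \<in> B' \<Longrightarrow> Fl (x, t) \<in> NN"
      using orbits_shrinkD[OF shrink[folded U_def] NN] by metis
    have "open (B' \<inter> N7)" "z \<in> B' \<inter> N7" using B' N7 by auto
    then obtain x where x: "x \<in> U" "x \<in> B'" "x \<in> N7"
      using z(4) unfolding U_def[symmetric] closure_iff_nhds_not_empty by blast
    define xt where "xt = (\<lambda>t. Fl (x, t))"
    have NNx: "xt t \<in> NN" for t unfolding xt_def using B'(3) x by blast
    have xtZ: "xt t \<notin> Z" for t using Fl_zeros_iff[of x t] x(1) UZ by (auto simp: xt_def)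
    have xtU: "xt t \<in> U" for t using NNx[of t] xtZ[of t] by (auto simp: NN_def U_def)
    have xtV: "xt t \<in> V - Z" for t using xtU UV by blast
    have xtc: "xt t \<in> cdom c" for t using NNx[of t] N2(3) by (auto simp: NN_def)
    have FlU: "Fl (x, t) \<in> U" for t using xtU[of t] by (simp add: xt_def)
    have \<nu>_const: "\<nu> (xt t) = \<nu> x" for t
      unfolding xt_def by (rule period_fun_const_on_orbit[OF per(1) UZ FlU])
    have mu_const: "mu \<tau>' (xt t) = mu \<tau>' x" for t
      unfolding xt_def by (rule period_fun_const_on_orbit[OF per(2) UZ FlU])
    define X where "X = F c"
    have Xnz: "X (xt t) \<noteq> 0" for t using xtZ[of t] zeros_iff[OF c xtc] by (simp add: X_def)
    have speed: "norm (X (xt (t + s))) \<le> exp (K * \<bar>s\<bar>) * norm (X (xt t))" for t s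
    proof -
      have "norm (F c (Fl (xt t, s))) \<le> exp (K * \<bar>s\<bar>) * norm (F c (xt t))"
      proof (rule speed_growth[OF c])
        fix r
        have eq: "Fl (xt t, r) = xt (t + r)" by (simp add: xt_def)
        show "Fl (xt t, r) \<in> cdom c" unfolding eq by (rule xtc)
        show "norm (field_deriv c (Fl (xt t, r)) h) \<le> K * norm h" for h
          unfolding eq using K NNx by (simp add: NN_def)
      qed
      then show ?thesis by (simp add: X_def xt_def)
    qed
    have \<Omega>eq: "\<Omega> (xt t, \<sigma>) = xt (t + a \<sigma> (xt t))" if "\<sigma> \<in> T" for t \<sigma>
      using a_shift[OF that] xtV[of t] by (simp add: xt_def)
    have nonorth: "X (\<Omega> (xt t, \<sigma>)) \<bullet> X (\<Omega> (xt t, \<tau>')) \<noteq> 0" if \<sigma>: "\<sigma> \<in> v" for t \<sigma>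
    proof -
      let ?y = "xt t"
      have \<sigma>T: "\<sigma> \<in> T" "\<sigma> \<in> S \<inter> T" using \<sigma> vST by auto
      have \<tau>'S: "\<tau>' \<in> S \<inter> T" using \<tau>' N5(4) by blast
      have yN: "?y \<in> N1" "?y \<in> N3" "?y \<in> N4" "?y \<in> N5" using NNx[of t] by (auto simp: NN_def)
      have yV: "?y \<in> V" using xtV by blast
      define D1 where "D1 = chart_deriv c \<sigma> ?y (X ?y)"
      define D2 where "D2 = chart_deriv c \<tau>' ?y (X ?y)"
      obtain k1 where k1: "D1 = k1 *\<^sub>R X (\<Omega> (?y, \<sigma>))"
        using chart_deriv_field[OF c \<sigma>T(1) xtc yV N5(6)[OF yN(4) \<sigma>T(2)]] by (auto simp: D1_def X_def)
      define k2 where "k2 = 1 + ?Da ?y (X ?y)"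
      have k2: "D2 = k2 *\<^sub>R X (\<Omega> (?y, \<tau>'))"
        using chart_deriv_field[OF c \<tau>' xtc yV N5(6)[OF yN(4) \<tau>'S]] by (simp add: D2_def X_def k2_def)
      have "\<bar>?Da ?y (X ?y)\<bar> \<le> (C0 + 1) * norm (X ?y)" by (rule Da[OF yN(2)])
      also have "\<dots> < 1/2" using yN(3) by (simp add: N4_def X_def)
      finally have k2h: "\<bar>k2\<bar> \<ge> 1/2" unfolding k2_def by linarith
      define s where "s = a \<tau>' ?y"
      have s: "\<bar>s\<bar> \<le> M0" using yN(1) by (simp add: N1_def s_def)
      have "norm (X ?y) \<le> exp (K * \<bar>s\<bar>) * norm (X (xt (t + s)))"
        using speed[of "t + s" "- s"] by simp
      also have "\<dots> \<le> exp (K * M0) * norm (X (xt (t + s)))"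
        using s K0 by (intro mult_right_mono) (auto simp: K_def)
      finally have "exp (- (K * M0)) * norm (X ?y) \<le> norm (X (xt (t + s)))"
        by (simp add: exp_minus field_simps)
      then have lower: "2 * mm * norm (X ?y) \<le> norm (X (\<Omega> (?y, \<tau>')))"
        using \<Omega>eq[OF \<tau>', of t] by (simp add: mm_def s_def)
      have "norm D2 = \<bar>k2\<bar> * norm (X (\<Omega> (?y, \<tau>')))" by (simp add: k2)
      also have "\<dots> \<ge> (1/2) * (2 * mm * norm (X ?y))" using k2h lower mm by (intro mult_mono) auto
      finally have D2: "mm * norm (X ?y) \<le> norm D2" by simp
      have "norm (D1 - D2) \<le> mm / 2 * norm (X ?y)"
        unfolding D1_def D2_def by (rule N5(7)[OF yN(4) \<sigma>T(2)])
      also have "\<dots> < mm * norm (X ?y)" using mm Xnz[of t] by simp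
      finally have lt: "norm (D1 - D2) < norm D2" using D2 by linarith
      have "D1 \<bullet> D2 = (D1 - D2) \<bullet> D2 + D2 \<bullet> D2" by (simp add: inner_diff_left)
      moreover have "\<bar>(D1 - D2) \<bullet> D2\<bar> \<le> norm (D1 - D2) * norm D2" by (rule Cauchy_Schwarz_ineq2)
      moreover have "norm (D1 - D2) * norm D2 < norm D2 * norm D2"
        using lt norm_ge_zero[of "D1 - D2"] by (intro mult_strict_right_mono) auto
      moreover have "D2 \<bullet> D2 = norm D2 * norm D2"
        by (simp add: power2_norm_eq_inner[symmetric] power2_eq_square)
      ultimately have "D1 \<bullet> D2 \<noteq> 0" by linarith
      then show ?thesis unfolding k1 k2 by auto
    qed
    define p where "p = \<bar>\<nu> x\<bar>"
    \<comment> \<open>Records in which direction \<Lambda> moves along the orbit, so that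
      \<open>e * p = \<nu> x\<close> and both directions are treated together.\<close>
    define e where "e = sgn (\<nu> x)"
    have p: "p > 2 * Bd" "p > 0" using N7(3)[OF x(1,3)] Bd by (auto simp: p_def)
    have e: "e * p = \<nu> x" "e = 1 \<or> e = -1" using p(2) by (auto simp: e_def p_def sgn_if)
    have perx: "xt (t + e * p) = xt t" for t
    proof -
      have "Fl (x, \<nu> x) = x" using per(1) x(1) by (simp add: period_fun_def)
      then have "Fl (Fl (x, \<nu> x), t) = Fl (x, t)" by simp
      then show ?thesis by (simp add: xt_def e(1) add.commute)
    qed
    \<comment> \<open>The time \<open>t + a \<tau>' (xt t)\<close> differs from \<open>t\<close> by
      less than \<open>M0\<close>, so by continuity it takes every value.\<close>
    have reach: "\<exists>t. \<Omega> (xt t, \<tau>') = xt r" for r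
    proof -
      define g where "g = (\<lambda>t. t + a \<tau>' (xt t))"
      have "continuous_on UNIV xt" unfolding xt_def by (intro continuous_intros)
      then have gc: "continuous_on UNIV g" unfolding g_def
        by (intro continuous_intros continuous_on_compose2[OF a_cont[OF \<tau>']]) (use xtV in auto)
      have bd: "\<bar>a \<tau>' (xt t)\<bar> < M0" for t using NNx[of t] by (auto simp: NN_def N1_def)
      have "g (r - M0) \<le> r" "r \<le> g (r + M0)"
        using bd[of "r - M0"] bd[of "r + M0"] by (auto simp: g_def)
      moreover have "r - M0 \<le> r + M0" by (simp add: M0_def)
      ultimately obtain t where "g t = r"
        using IVT'[of g "r - M0" r "r + M0"] continuous_on_subset[OF gc] by blast
      then show ?thesis using \<Omega>eq[OF \<tau>', of t] by (auto simp: g_def)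
    qed
    have pos: "X (xt (r + e * s)) \<bullet> X (xt r) > 0" if s: "0 \<le> s" "s \<le> p - Bd" for r s
    proof -
      obtain t where t: "\<Omega> (xt t, \<tau>') = xt r" using reach by blast
      define L0 where "L0 = \<Lambda> (xt t, \<tau>')"
      define L1 where "L1 = \<Lambda> (xt t, \<tau>)"
      have L: "L1 - L0 = e * p + (a \<tau> (xt t) - a \<tau>' (xt t))"
        using \<nu>_const[of t] by (simp add: L0_def L1_def e(1) \<nu>_def mu_def)
      have da: "\<bar>a \<tau> (xt t) - a \<tau>' (xt t)\<bar> < Bd" using NNx[of t] by (auto simp: NN_def N6_def)
      have cI: "connected ((\<lambda>\<sigma>. \<Lambda> (xt t, \<sigma>)) ` v)" by (rule connected_\<Lambda>[OF vT connv xtV])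
      have mem: "L0 \<in> (\<lambda>\<sigma>. \<Lambda> (xt t, \<sigma>)) ` v" "L1 \<in> (\<lambda>\<sigma>. \<Lambda> (xt t, \<sigma>)) ` v"
        using \<tau>'v \<tau>v by (auto simp: L0_def L1_def)
      \<comment> \<open>\<open>L0\<close> and \<open>L1\<close> differ by more than
        \<open>p - Bd\<close> in the direction of \<open>e\<close>. By connectedness of
        \<open>v\<close> some \<sigma> realises \<open>L0 + e * s'\<close>, and
        \<open>\<Omega> (xt t, \<sigma>)\<close> is then the point at time \<open>e * s'\<close>
        after \<open>xt r\<close>.\<close>
      have nz: "X (xt (r + e * s')) \<bullet> X (xt r) \<noteq> 0" if s': "0 \<le> s'" "s' \<le> p - Bd" for s'
      proof -
        have "L0 + e * s' \<in> (\<lambda>\<sigma>. \<Lambda> (xt t, \<sigma>)) ` v"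
        proof (cases "e = 1")
          case True
          then have "L0 \<le> L0 + e * s'" "L0 + e * s' \<le> L1" using L da s' by auto
          then show ?thesis using connectedD_interval[OF cI mem] by blast
        next
          case False
          then have "e = -1" using e(2) by blast
          then have "L1 \<le> L0 + e * s'" "L0 + e * s' \<le> L0" using L da s' by auto
          then show ?thesis using connectedD_interval[OF cI mem(2,1)] by blast
        qed
        then obtain \<sigma> where \<sigma>: "\<sigma> \<in> v" "\<Lambda> (xt t, \<sigma>) = L0 + e * s'" by auto
        have "xt r = Fl (xt t, L0)" using t \<Lambda>_shift[OF \<tau>' xtV] by (simp add: L0_def)
        moreover have "\<Omega> (xt t, \<sigma>) = Fl (xt t, L0 + e * s')" using \<Lambda>_shift[OF _ xtV, of \<sigma> t] \<sigma> vT by auto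
        ultimately have "\<Omega> (xt t, \<sigma>) = Fl (xt r, e * s')" by simp
        also have "\<dots> = xt (r + e * s')" by (simp add: xt_def)
        finally show ?thesis using nonorth[OF \<sigma>(1), of t] t by simp
      qed
      \<comment> \<open>At \<open>s = 0\<close> this is a squared norm; since it never vanishes on
        the interval, it stays positive.\<close>
      define g where "g = (\<lambda>s. X (xt (r + e * s)) \<bullet> X (xt r))"
      have "continuous_on UNIV (\<lambda>s. xt (r + e * s))" unfolding xt_def by (intro continuous_intros)
      then have gc: "continuous_on {0..s} g" unfolding g_def X_def
        by (intro continuous_intros continuous_on_compose2[OF field_continuous[OF c]])
           (use xtc in \<open>auto intro: continuous_on_subset\<close>)
      have "g 0 > 0" using Xnz[of r] by (simp add: g_def)
      show ?thesis
      proof (rule ccontr)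
        assume "\<not> ?thesis"
        then have "g s \<le> 0" by (simp add: g_def)
        then obtain s' where "0 \<le> s'" "s' \<le> s" "g s' = 0"
          using IVT2'[of g s 0 0] gc \<open>g 0 > 0\<close> s by auto
        then show False using nz[of s'] s by (simp add: g_def)
      qed
    qed
    have allpos: "X (xt (r + e * s)) \<bullet> X (xt r) > 0" if s: "0 \<le> s" "s \<le> p" for r s
    proof (cases "s \<le> p - Bd")
      case True then show ?thesis using pos s by blast
    next
      case False
      \<comment> \<open>Going on for the remaining \<open>p - s\<close> closes the orbit at
        \<open>xt r\<close>; symmetry of the inner product exchanges the two points.\<close>
      have "0 \<le> p - s" "p - s \<le> p - Bd" using False s p by auto
      from pos[OF this, of "r + e * s"]
      have "X (xt (r + e * s + e * (p - s))) \<bullet> X (xt (r + e * s)) > 0" .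
      moreover have "r + e * s + e * (p - s) = r + e * p" by (simp add: algebra_simps)
      ultimately show ?thesis using perx[of r] by (simp add: inner_commute)
    qed
    have "Fl (x, min 0 (e * p)) \<noteq> Fl (x, max 0 (e * p))"
    proof (rule no_return[OF c, where e = "X (xt 0)"])
      show "min 0 (e * p) < max 0 (e * p)" using e(2) p(2) by auto
      fix s assume s: "s \<in> {min 0 (e * p)..max 0 (e * p)}"
      have es: "e * (e * s) = s" "0 \<le> e * s" "e * s \<le> p" using e(2) s p(2) by auto
      have "X (xt (0 + e * (e * s))) \<bullet> X (xt 0) > 0" by (rule allpos[OF es(2,3)])
      then have "X (xt s) \<bullet> X (xt 0) > 0" by (simp only: es(1) add_0)
      then show "Fl (x, s) \<in> cdom c \<and> F c (Fl (x, s)) \<bullet> X (xt 0) > 0" using xtc[of s] by (simp add: X_def xt_def)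
    qed
    moreover have "Fl (x, e * p) = Fl (x, 0)" using perx[of 0] by (simp add: xt_def)
    ultimately show False by (auto simp: min_def max_def split: if_splits)
  qed
  then show ?thesis using uv(1,3) unfolding U_def by blast
qed

lemma mu_independent:
  assumes loc: "\<And>\<tau>'. \<tau>' \<in> T \<Longrightarrow> \<exists>u. openin (top_of_set T) u \<and> \<tau>' \<in> u \<and> (\<forall>\<tau>\<in>u. \<forall>x\<in>U. mu \<tau> x = mu \<tau>' x)"
    and \<tau>: "\<tau> \<in> T" and x: "x \<in> U"
  shows "mu \<tau> x = mu \<tau>\<^sub>0 x"
proof -
  obtain u where u: "\<And>\<tau>'. \<tau>' \<in> T \<Longrightarrow> openin (top_of_set T) (u \<tau>')" "\<And>\<tau>'. \<tau>' \<in> T \<Longrightarrow> \<tau>' \<in> u \<tau>'"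
    "\<And>\<tau>' \<tau>. \<tau>' \<in> T \<Longrightarrow> \<tau> \<in> u \<tau>' \<Longrightarrow> mu \<tau> x = mu \<tau>' x"
  proof -
    have "\<forall>\<tau>'\<in>T. \<exists>u. openin (top_of_set T) u \<and> \<tau>' \<in> u \<and> (\<forall>\<tau>\<in>u. mu \<tau> x = mu \<tau>' x)"
    proof
      fix \<tau>' assume "\<tau>' \<in> T"
      from loc[OF this] obtain w where "openin (top_of_set T) w" "\<tau>' \<in> w" "\<forall>\<tau>\<in>w. \<forall>x\<in>U. mu \<tau> x = mu \<tau>' x" by blast
      then show "\<exists>u. openin (top_of_set T) u \<and> \<tau>' \<in> u \<and> (\<forall>\<tau>\<in>u. mu \<tau> x = mu \<tau>' x)"
        using x by blast
    qed
    from bchoice[OF this] show ?thesis using that by blast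
  qed
  let ?E = "{\<tau> \<in> T. mu \<tau> x = mu \<tau>\<^sub>0 x}"
  have "openin (top_of_set T) ?E"
  proof (subst openin_subopen, intro ballI)
    fix \<sigma> assume \<sigma>: "\<sigma> \<in> ?E"
    then have \<sigma>T: "\<sigma> \<in> T" by blast
    have "u \<sigma> \<subseteq> ?E"
    proof
      fix \<rho> assume \<rho>: "\<rho> \<in> u \<sigma>"
      have "\<rho> \<in> T" using \<rho> openin_imp_subset[OF u(1)[OF \<sigma>T]] by blast
      moreover have "mu \<rho> x = mu \<tau>\<^sub>0 x" using u(3)[OF \<sigma>T \<rho>] \<sigma> by (metis (mono_tags) mem_Collect_eq)
      ultimately show "\<rho> \<in> ?E" by blast
    qed
    then show "\<exists>S. openin (top_of_set T) S \<and> \<sigma> \<in> S \<and> S \<subseteq> ?E"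
      using u(1,2)[OF \<sigma>T] by (intro exI[of _ "u \<sigma>"] conjI)
  qed
  moreover have "openin (top_of_set T) (T - ?E)"
  proof (subst openin_subopen, intro ballI)
    fix \<sigma> assume \<sigma>: "\<sigma> \<in> T - ?E"
    then have \<sigma>T: "\<sigma> \<in> T" by blast
    have "u \<sigma> \<subseteq> T - ?E"
    proof
      fix \<rho> assume \<rho>: "\<rho> \<in> u \<sigma>"
      have "\<rho> \<in> T" using \<rho> openin_imp_subset[OF u(1)[OF \<sigma>T]] by blast
      moreover have "mu \<rho> x \<noteq> mu \<tau>\<^sub>0 x" using u(3)[OF \<sigma>T \<rho>] \<sigma> by (metis (mono_tags) DiffE mem_Collect_eq)
      ultimately show "\<rho> \<in> T - ?E" by blast
    qed
    then show "\<exists>S. openin (top_of_set T) S \<and> \<sigma> \<in> S \<and> S \<subseteq> T - ?E"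
      using u(1,2)[OF \<sigma>T] by (intro exI[of _ "u \<sigma>"] conjI)
  qed
  then have "closedin (top_of_set T) ?E" by (simp add: closedin_def)
  ultimately have "?E = {} \<or> ?E = T" using T(2) connected_clopen by blast
  then show ?thesis using T(3) \<tau> by blast
qed

end

text \<open>In this formulation any two loops are freely homotopic. A homotopy between the constant
  loops at \<open>p\<close> and \<open>q\<close> moves the base point along a path from
  \<open>p\<close> to \<open>q\<close>.\<close>

lemma simply_connected_connected:
  fixes S :: "'a::topological_space set"
  assumes "simply_connected S"
  shows "connected S"
  unfolding connected_iff_connected_component
proof (intro ballI)
  fix p q assume pq: "p \<in> S" "q \<in> S"
  have "homotopic_loops S (\<lambda>_. p) (\<lambda>_. q)"
    using assms[unfolded simply_connected_def, rule_format, of "\<lambda>_. p" "\<lambda>_. q"] pq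
    by (simp add: path_def pathfinish_def pathstart_def path_image_def image_constant_conv)
  then obtain h :: "real \<times> real \<Rightarrow> 'a" where h: "continuous_on ({0..1} \<times> {0..1}) h" "h ` ({0..1} \<times> {0..1}) \<subseteq> S"
    "h (0, 0) = p" "h (1, 0) = q"
    unfolding homotopic_loops by (auto simp: image_subset_iff_funcset)
  have "continuous_on {0..1} (\<lambda>t. h (t, 0))"
    by (rule continuous_on_compose2[OF h(1)]) (auto intro!: continuous_intros)
  then have "connected ((\<lambda>t. h (t, 0)) ` {0..1})" by (rule connected_continuous_image) simp
  moreover have "(\<lambda>t. h (t, 0)) ` {0..1} \<subseteq> S" using h(2) by auto
  moreover have "p \<in> (\<lambda>t. h (t, 0)) ` {0..1}" "q \<in> (\<lambda>t. h (t, 0)) ` {0..1}"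
    using h(3,4) by (auto intro: rev_image_eqI[of 0] rev_image_eqI[of 1])
  ultimately show "connected_component S p q" unfolding connected_component_def by blast
qed

section \<open>Extension of \<Lambda> under the three conditions on \<open>z\<close>\<close>

context flow_deformation begin

lemma minus_zeros_nonempty:
  assumes "nowhere_dense_in Z V" "open W" "W \<subseteq> V" "W \<noteq> {}"
  shows "W - Z \<noteq> {}"
proof
  assume "W - Z = {}"
  then have "W \<subseteq> closure (Z \<inter> V)" using assms(3) closure_subset[of "Z \<inter> V"] by blast
  then have "W \<subseteq> interior (closure (Z \<inter> V))" using assms(2) by (rule interior_maximal)
  then show False using assms unfolding nowhere_dense_in_def by blast
qed

lemma extension_const:
  assumes W: "open W" "W \<subseteq> V" and \<tau>: "\<tau> \<in> T" and 0: "\<And>x. x \<in> W - Z \<Longrightarrow> mu \<tau> x = 0"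
  shows "\<exists>L. smooth_fun A W L \<and> (\<forall>x\<in>W - Z. L x = \<Lambda> (x, \<tau>)) \<and> (\<forall>x\<in>W. \<Omega> (x, \<tau>) = shift_map Fl L x)"
proof (rule extension[OF W \<tau> _ 0])
  show "smooth_fun A W (\<lambda>x. 0)"
    using smooth_fun_scale[OF W(1) smooth_fun_subset[OF a_smooth[OF \<tau>] W], of 0] by simp
qed

lemma extends_not_pn:
  assumes z: "z \<in> Z" "z \<in> V" and nd: "nowhere_dense_in Z V" and pn: "\<not> pn_point A F Fl z"
  shows "\<exists>W. open W \<and> z \<in> W \<and> W \<subseteq> V \<and>
    (\<forall>\<tau>\<in>T. \<exists>L. smooth_fun A W L \<and> (\<forall>x\<in>W - Z. L x = \<Lambda> (x, \<tau>)) \<and> (\<forall>x\<in>W. \<Omega> (x, \<tau>) = shift_map Fl L x))"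
proof -
  obtain c where c: "c \<in> A" "z \<in> cdom c" using obtain_chart .
  obtain r where r: "r > 0" "half_space \<inter> ball (cmap c z) r \<subseteq> cmap c ` cdom c"
    "{x \<in> cdom c. cmap c x \<in> ball (cmap c z) r} \<subseteq> V"
    using chart_ball[OF c open_V z(2)] .
  define W0 where "W0 = {x \<in> cdom c. cmap c x \<in> ball (cmap c z) r}"
  have W0: "open W0" "z \<in> W0" "W0 \<subseteq> V"
    using open_chart_preimage[OF c(1) open_ball] c r by (auto simp: W0_def)
  show ?thesis
  proof (cases "\<forall>\<tau>\<in>T. \<forall>x\<in>W0 - Z. mu \<tau> x = 0")
    case True
    have "\<exists>L. smooth_fun A W0 L \<and> (\<forall>x\<in>W0 - Z. L x = \<Lambda> (x, \<tau>)) \<and> (\<forall>x\<in>W0. \<Omega> (x, \<tau>) = shift_map Fl L x)"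
      if "\<tau> \<in> T" for \<tau>
      by (rule extension_const[OF W0(1,3) that]) (use True that in blast)
    then show ?thesis using W0 by blast
  next
    case False
    then obtain \<tau>1 x1 where \<tau>1: "\<tau>1 \<in> T" and x1: "x1 \<in> W0 - Z" "mu \<tau>1 x1 \<noteq> 0" by blast
    have opU: "open (W0 - Z)" by (rule open_Diff[OF W0(1) closed_zeros])
    have conn: "connected (W0 - Z)" by (rule dichotomy(1)[OF c(1) r(2) W0_def W0(3) \<tau>1 x1])
    have sub: "W0 - Z \<subseteq> V - Z" using W0(3) by blast
    have "\<exists>\<theta>. positive_generator A Fl (W0 - Z) \<theta>"
      by (rule positive_generator_exists[OF opU conn _ period_fun_subset[OF period_mu[OF \<tau>1] sub] x1]) blast
    moreover have "Z \<inter> (W0 - Z) = {}" by blast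
    ultimately have "periodic_shift A F Fl (W0 - Z)"
      using x1(1) unfolding periodic_shift_def nowhere_dense_in_def by auto
    \<comment> \<open>\<open>W0\<close> meets every clause of \<open>pn_nbhd\<close> except the last
      one, so for \<open>z\<close> not to be a \<open>pn\<close>-point that clause must
      fail.\<close>
    then obtain W where W: "open W" "connected W" "z \<in> W" "W \<subseteq> W0" "periodic_shift A F Fl W"
      using pn z(1) W0(1,2) conn unfolding pn_point_def pn_nbhd_def by blast
    then obtain \<theta> where \<theta>: "positive_generator A Fl W \<theta>" unfolding periodic_shift_def by blast
    then have \<theta>s: "smooth_fun A W \<theta>" and \<theta>pos: "\<And>x. x \<in> W \<Longrightarrow> \<theta> x \<noteq> 0"
      unfolding positive_generator_def by (blast, force)
    have \<theta>per: "period_fun W \<theta>" by (rule positive_generator_period_fun[OF W(1) \<theta>])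
    \<comment> \<open>\<open>W\<close> is arbitrary and may be separated by \<open>Z\<close>. A
      chart ball inside it is not, by the Newman argument for \<theta>, and only there is one
      constant factor \<open>q\<close> guaranteed.\<close>
    obtain r2 where r2: "r2 > 0" "half_space \<inter> ball (cmap c z) r2 \<subseteq> cmap c ` cdom c"
      "{x \<in> cdom c. cmap c x \<in> ball (cmap c z) r2} \<subseteq> W"
      using chart_ball[OF c W(1,3)] .
    define W2 where "W2 = {x \<in> cdom c. cmap c x \<in> ball (cmap c z) r2}"
    have W2: "open W2" "z \<in> W2" "W2 \<subseteq> W"
      using open_chart_preimage[OF c(1) open_ball] c r2 by (auto simp: W2_def)
    have W2V: "W2 \<subseteq> V" using W2 W W0 by blast
    obtain x2 where x2: "x2 \<in> W2 - Z" using minus_zeros_nonempty[OF nd W2(1) W2V] W2(2) by blast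
    define U where "U = connected_component_set (W2 - Z) x2"
    have "U \<subseteq> W2 - Z" unfolding U_def by (rule connected_component_subset)
    then have UW: "U \<subseteq> W" using W2 by blast
    have conn2: "connected (W2 - Z)"
    proof (rule connected_minus_zeros(2)[OF c(1) r2(2) W2_def x2 U_def period_fun_subset[OF \<theta>per UW]])
      show "\<theta> x \<noteq> 0" if "x \<in> U" for x using that \<theta>pos UW by blast
      show "orbits_shrink U y" if "y \<in> W2" "y \<in> Z" for y
      proof (rule orbits_shrink_subset[OF orbits_shrink_periodic[OF W(1) _ that(2) \<theta>per \<theta>pos] UW])
        show "y \<in> W" using that W2 by blast
      qed
    qed
    have "\<exists>L. smooth_fun A W2 L \<and> (\<forall>x\<in>W2 - Z. L x = \<Lambda> (x, \<tau>)) \<and> (\<forall>x\<in>W2. \<Omega> (x, \<tau>) = shift_map Fl L x)"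
      if \<tau>: "\<tau> \<in> T" for \<tau>
    proof -
      have disj: "(W2 - Z) \<inter> Z = {}" by blast
      have pm: "period_fun (W2 - Z) (mu \<tau>)"
        by (rule period_fun_subset[OF period_mu[OF \<tau>]]) (use W2V in blast)
      have pt: "period_fun (W2 - Z) \<theta>" by (rule period_fun_subset[OF \<theta>per]) (use W2 in blast)
      have "\<exists>q. \<forall>x\<in>W2 - Z. mu \<tau> x = q * \<theta> x"
      proof (cases "mu \<tau> x2 = 0")
        case True
        have "mu \<tau> x = 0" if "x \<in> W2 - Z" for x by (rule period_fun_vanishes[OF conn2 disj pm x2 True that])
        then show ?thesis by (intro exI[of _ 0]) simp
      next
        case False
        have "\<theta> x2 \<noteq> 0" using \<theta>pos x2 W2 by blast
        from period_funs_commensurable[OF conn2 disj pm pt x2 False this] show ?thesis by blast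
      qed
      then obtain q where q: "\<And>x. x \<in> W2 - Z \<Longrightarrow> mu \<tau> x = q * \<theta> x" by blast
      show ?thesis
        by (rule extension[OF W2(1) W2V \<tau> smooth_fun_scale[OF W2(1) smooth_fun_subset[OF \<theta>s W2(1,3)]] q])
    qed
    then show ?thesis using W2 W2V by blast
  qed
qed

text \<open>What the two conditions at \<open>pn\<close>-points have in common. It speaks of every
  nonvanishing period function because it is applied to differences of \<open>mu\<close> at two
  parameters.\<close>

definition periods_grow :: "'m set \<Rightarrow> 'm \<Rightarrow> bool" where
  "periods_grow U z \<longleftrightarrow> (\<forall>\<nu> M. period_fun U \<nu> \<longrightarrow> (\<forall>x\<in>U. \<nu> x \<noteq> 0) \<longrightarrow>
      (\<exists>N. open N \<and> z \<in> N \<and> (\<forall>x\<in>U \<inter> N. \<bar>\<nu> x\<bar> > M)))"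

text \<open>Growth is asked of connected sets with shrinking orbits, since these are the properties
  that \<open>dichotomy\<close> supplies for \<open>W0 - Z\<close>. \<open>B\<close> lets the domain
  of a given generator enter.\<close>

lemma extends_if_periods_grow:
  assumes z: "z \<in> Z" "z \<in> V" and nd: "nowhere_dense_in Z V" and lpc: "locally path_connected T"
    and def: "deformation A k V T \<H> \<Omega>" "1 \<le> k" and B: "open B" "z \<in> B"
    and grow: "\<And>U. U \<subseteq> B - Z \<Longrightarrow> connected U \<Longrightarrow> orbits_shrink U z \<Longrightarrow> periods_grow U z"
  shows "\<exists>W. open W \<and> z \<in> W \<and> W \<subseteq> V \<and>
    (\<forall>\<tau>\<in>T. \<exists>L. smooth_fun A W L \<and> (\<forall>x\<in>W - Z. L x = \<Lambda> (x, \<tau>)) \<and> (\<forall>x\<in>W. \<Omega> (x, \<tau>) = shift_map Fl L x))"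
proof -
  obtain c where c: "c \<in> A" "z \<in> cdom c" using obtain_chart .
  have BV: "open (B \<inter> V)" "z \<in> B \<inter> V" using B open_V z by auto
  obtain r where r: "r > 0" "half_space \<inter> ball (cmap c z) r \<subseteq> cmap c ` cdom c"
    "{x \<in> cdom c. cmap c x \<in> ball (cmap c z) r} \<subseteq> B \<inter> V"
    using chart_ball[OF c BV] .
  define W0 where "W0 = {x \<in> cdom c. cmap c x \<in> ball (cmap c z) r}"
  have W0: "open W0" "z \<in> W0" "W0 \<subseteq> V" "W0 \<subseteq> B"
    using open_chart_preimage[OF c(1) open_ball] c r by (auto simp: W0_def)
  have "\<exists>L. smooth_fun A W0 L \<and> (\<forall>x\<in>W0 - Z. L x = \<Lambda> (x, \<tau>)) \<and> (\<forall>x\<in>W0. \<Omega> (x, \<tau>) = shift_map Fl L x)"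
    if \<tau>: "\<tau> \<in> T" for \<tau>
  proof (cases "\<forall>\<tau>\<in>T. \<forall>x\<in>W0 - Z. mu \<tau> x = 0")
    case True
    show ?thesis by (rule extension_const[OF W0(1,3) \<tau>]) (use True \<tau> in blast)
  next
    case False
    then obtain \<tau>1 x1 where \<tau>1: "\<tau>1 \<in> T" and x1: "x1 \<in> W0 - Z" "mu \<tau>1 x1 \<noteq> 0" by blast
    note dich = dichotomy[OF c(1) r(2) W0_def W0(3) \<tau>1 x1]
    have shrink: "orbits_shrink (W0 - Z) z" by (rule dich(3)[OF W0(2) z(1)])
    have pg: "periods_grow (W0 - Z) z" by (rule grow[OF _ dich(1) shrink]) (use W0 in blast)
    have cl: "z \<in> closure (W0 - Z)"
      unfolding closure_iff_nhds_not_empty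
    proof (intro allI impI)
      fix Q S assume QS: "S \<subseteq> Q" "open S" "z \<in> S"
      have "(S \<inter> W0) - Z \<noteq> {}"
        by (rule minus_zeros_nonempty[OF nd]) (use QS W0 in auto)
      then show "(W0 - Z) \<inter> Q \<noteq> {}" using QS by blast
    qed
    have pgM: "\<exists>N. open N \<and> z \<in> N \<and> (\<forall>x\<in>(W0 - Z) \<inter> N. \<bar>\<nu> x\<bar> > M)"
      if "period_fun (W0 - Z) \<nu>" "\<And>x. x \<in> W0 - Z \<Longrightarrow> \<nu> x \<noteq> 0" for \<nu> M
    proof -
      have "\<forall>x\<in>W0 - Z. \<nu> x \<noteq> 0" using that(2) by (rule ballI)
      with that(1) pg show ?thesis unfolding periods_grow_def by (elim allE impE) assumption+
    qed
    have "mu \<tau> x = mu \<tau>\<^sub>0 x" if "x \<in> W0 - Z" for x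
    proof (rule mu_independent[OF _ \<tau> that])
      fix \<tau>' assume \<tau>': "\<tau>' \<in> T"
      show "\<exists>u. openin (top_of_set T) u \<and> \<tau>' \<in> u \<and> (\<forall>\<tau>\<in>u. \<forall>x\<in>W0 - Z. mu \<tau> x = mu \<tau>' x)"
        by (rule mu_locally_constant[OF c(1) W0(1,3,2) c(2) z(1) cl dich(1) shrink
              continuous_chart_deriv[OF def c(1)] pgM lpc \<tau>'])
    qed
    moreover have "mu \<tau>\<^sub>0 x = \<alpha> x + -1 * a \<tau>\<^sub>0 x" if "x \<in> W0 - Z" for x
      using \<Lambda>_init[of x] that W0(3) by (auto simp: mu_def)
    ultimately have eq: "mu \<tau> x = \<alpha> x + -1 * a \<tau>\<^sub>0 x" if "x \<in> W0 - Z" for x using that by simp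
    show ?thesis
      by (rule extension[OF W0(1,3) \<tau> smooth_fun_lincomb[OF W0(1) smooth_fun_subset[OF \<alpha>_smooth W0(1,3)]
            smooth_fun_subset[OF a_smooth[OF T(3)] W0(1,3)]] eq])
  qed
  then show ?thesis using W0 by blast
qed

lemma periods_grow_one_jet:
  assumes "one_jet_vanishes A F z" "U \<inter> Z = {}" "orbits_shrink U z"
  shows "periods_grow U z"
  unfolding periods_grow_def
proof (intro allI impI)
  fix \<nu> M assume \<nu>: "period_fun U \<nu>" "\<forall>x\<in>U. \<nu> x \<noteq> 0"
  obtain c where c: "c \<in> A" "z \<in> cdom c" using obtain_chart .
  obtain N where "open N" "z \<in> N" "\<And>x. x \<in> U \<Longrightarrow> x \<in> N \<Longrightarrow> \<bar>\<nu> x\<bar> > M"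
    using one_jet_vanishes_periods[OF c assms \<nu>(1) \<nu>(2)[rule_format]] by metis
  then show "\<exists>N. open N \<and> z \<in> N \<and> (\<forall>x\<in>U \<inter> N. \<bar>\<nu> x\<bar> > M)" by blast
qed

text \<open>Period functions on connected \<open>U\<close> are constant multiples of \<theta>, so a
  nonvanishing one inherits the limit up to the fixed factor \<open>\<bar>q\<bar>\<close>.\<close>

lemma periods_grow_generator:
  assumes z: "z \<in> Z" and B: "open B" and \<theta>: "positive_generator A Fl (B - Z) \<theta>"
    and lim: "filterlim \<theta> at_top (at z within (B - Z))" and U: "U \<subseteq> B - Z" "connected U"
  shows "periods_grow U z"
  unfolding periods_grow_def
proof (intro allI impI)
  fix \<nu> M assume \<nu>: "period_fun U \<nu>" "\<forall>x\<in>U. \<nu> x \<noteq> 0"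
  show "\<exists>N. open N \<and> z \<in> N \<and> (\<forall>x\<in>U \<inter> N. \<bar>\<nu> x\<bar> > M)"
  proof (cases "U = {}")
    case True then show ?thesis by (intro exI[of _ UNIV]) simp
  next
    case False
    then obtain x0 where x0: "x0 \<in> U" by blast
    have \<theta>pos: "\<theta> x > 0" if "x \<in> U" for x using that U(1) \<theta> unfolding positive_generator_def by blast
    have "period_fun (B - Z) \<theta>"
      by (rule positive_generator_period_fun[OF open_Diff[OF B closed_zeros] \<theta>])
    then have per: "period_fun U \<theta>" by (rule period_fun_subset[OF _ U(1)])
    have UZ: "U \<inter> Z = {}" using U(1) by blast
    have nz0: "\<nu> x0 \<noteq> 0" "\<theta> x0 \<noteq> 0" using \<nu>(2) \<theta>pos[OF x0] x0 by auto
    obtain q where q: "q \<noteq> 0" "\<And>x. x \<in> U \<Longrightarrow> \<nu> x = q * \<theta> x"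
      using period_funs_commensurable[OF U(2) UZ \<nu>(1) per x0 nz0] by blast
    have "eventually (\<lambda>x. M / \<bar>q\<bar> < \<theta> x) (at z within (B - Z))"
      using lim unfolding filterlim_at_top_dense by blast
    then obtain N where N: "open N" "z \<in> N" "\<And>x. x \<in> N \<Longrightarrow> x \<noteq> z \<Longrightarrow> x \<in> B - Z \<Longrightarrow> M / \<bar>q\<bar> < \<theta> x"
      unfolding eventually_at_topological by blast
    have "\<bar>\<nu> x\<bar> > M" if x: "x \<in> U \<inter> N" for x
    proof -
      have "M / \<bar>q\<bar> < \<theta> x" using N(3)[of x] x U(1) z by blast
      then have "M < \<bar>q\<bar> * \<theta> x" using q(1) by (simp add: field_simps)
      then show ?thesis using q(2)[of x] x \<theta>pos[of x] by (simp add: abs_mult)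
    qed
    with N show ?thesis by blast
  qed
qed

end

theorem theorem24:
  fixes A :: "('m::{t2_space,second_countable_topology}, 'e::euclidean_space) chart set"
    and F :: "('m, 'e) chart \<Rightarrow> 'm \<Rightarrow> 'e"
    and Fl :: "'m \<times> real \<Rightarrow> 'm"
    and k :: enat
    and V :: "'m set"
    and T :: "'t::topological_space set"
    and \<tau>\<^sub>0 :: 't
    and z :: 'm
    and \<Omega> :: "'m \<times> 't \<Rightarrow> 'm"
    and \<alpha> :: "'m \<Rightarrow> real"
    and \<Lambda> :: "'m \<times> 't \<Rightarrow> real"
  defines "\<Sigma> \<equiv> zeros A F"
  assumes "smooth_manifold A" and "connected (UNIV :: 'm set)"
    and "smooth_vector_field A F" and "tangent_to_boundary A F" and "global_flow A F Fl"
    and "open V" and "connected V" and "nowhere_dense_in \<Sigma> V"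
    and "compact T" and "simply_connected T" and "locally path_connected T" and "\<tau>\<^sub>0 \<in> T"
    and "z \<in> \<Sigma> \<inter> V"
    and "\<not> pn_point A F Fl z \<or>
         (pn_point A F Fl z \<and> one_jet_vanishes A F z \<and> 1 \<le> k) \<or>
         (strong_pn_point A F Fl z \<and> 1 \<le> k)"
    and "deformation A k V T (shift_image A Fl V) \<Omega>"
    and "smooth_fun A V \<alpha>" and "shift_function Fl V (\<lambda>x. \<Omega> (x, \<tau>\<^sub>0)) \<alpha>"
    and "continuous_on ((V - \<Sigma>) \<times> T) \<Lambda>"
    and "shift_function_family Fl ((V - \<Sigma>) \<times> T) \<Omega> \<Lambda>"
    and "\<forall>x\<in>V - \<Sigma>. \<Lambda> (x, \<tau>\<^sub>0) = \<alpha> x"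
  shows "\<exists>W. open W \<and> z \<in> W \<and> W \<subseteq> V \<and>
           (\<forall>\<tau>\<in>T. \<exists>L. smooth_fun A W L \<and> (\<forall>x\<in>W - \<Sigma>. L x = \<Lambda> (x, \<tau>)) \<and>
                      (\<forall>x\<in>W. \<Omega> (x, \<tau>) = shift_map Fl L x))"
proof -
  note def = \<open>deformation A k V T (shift_image A Fl V) \<Omega>\<close>
  have "\<forall>\<tau>\<in>T. \<exists>b. smooth_fun A V b \<and> (\<forall>x\<in>V. \<Omega> (x, \<tau>) = shift_map Fl b x)"
    using def unfolding deformation_def shift_image_def by blast
  then obtain a where a: "\<And>\<tau>. \<tau> \<in> T \<Longrightarrow> smooth_fun A V (a \<tau>)"
    "\<And>\<tau> x. \<tau> \<in> T \<Longrightarrow> x \<in> V \<Longrightarrow> \<Omega> (x, \<tau>) = Fl (x, a \<tau> x)"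
    unfolding shift_map_def by metis
  have fm: "flow_manifold A F Fl" by (rule flow_manifold.intro) fact+
  interpret flow_deformation A F Fl V T \<tau>\<^sub>0 \<Omega> \<alpha> \<Lambda> a
  proof (rule flow_deformation.intro[OF fm], unfold_locales)
    show "connected T" using \<open>simply_connected T\<close> by (rule simply_connected_connected)
    show "continuous_on (V \<times> T) \<Omega>" using def unfolding deformation_def by blast
    show "\<Omega> (x, \<tau>) = Fl (x, \<Lambda> (x, \<tau>))" if "\<tau> \<in> T" "x \<in> V - zeros A F" for \<tau> x
      using \<open>shift_function_family Fl ((V - \<Sigma>) \<times> T) \<Omega> \<Lambda>\<close> that
      unfolding shift_function_family_def \<Sigma>_def by blast
  qed (use assms a in \<open>auto simp: \<Sigma>_def\<close>)
  have z: "z \<in> zeros A F" "z \<in> V" using \<open>z \<in> \<Sigma> \<inter> V\<close> by (auto simp: \<Sigma>_def)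
  note nd = \<open>nowhere_dense_in \<Sigma> V\<close>[unfolded \<Sigma>_def] and lpc = \<open>locally path_connected T\<close>
  consider "\<not> pn_point A F Fl z" | "one_jet_vanishes A F z" "1 \<le> k" | "strong_pn_point A F Fl z" "1 \<le> k"
    using assms by blast
  then show ?thesis
  proof cases
    case 1
    then show "?thesis" unfolding \<Sigma>_def by (rule extends_not_pn[OF z nd])
  next
    case 2
    \<comment> \<open>The vanishing one-jet constrains periods on any domain with shrinking orbits,
      so \<open>B\<close> is the whole space; in the last case \<open>B\<close> is the neighbourhood
      that carries the generator.\<close>
    show "?thesis" unfolding \<Sigma>_def
      by (rule extends_if_periods_grow[OF z nd lpc def 2(2) open_UNIV UNIV_I periods_grow_one_jet[OF 2(1)]]) blast
  next
    case 3
    then obtain B \<theta> where B: "open B" "z \<in> B" "positive_generator A Fl (B - zeros A F) \<theta>"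
      "filterlim \<theta> at_top (at z within (B - zeros A F))"
      unfolding strong_pn_point_def pn_nbhd_def by blast
    show "?thesis" unfolding \<Sigma>_def
      by (rule extends_if_periods_grow[OF z nd lpc def 3(2) B(1,2) periods_grow_generator[OF z(1) B(1,3,4)]])
  qed
qed

end
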